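(* Let $(A,* )$ be a finite dimensional unital commutative associative algebra over $\mathbb{C}$ with identity $\hat1$, and let $B$ be a finite dimensional vertex $A$-algebroid such that $B$ is a simple Leibniz algebra that is not a Lie algebra. Then there exists a simple Lie algebra $\mathfrak g$ (a subalgebra of $B$) such that $B=\mathfrak g+\partial(A)$ and $\partial(A)$ is a simple $\mathfrak g$-module. In addition, there exists a $\mathfrak g$-module $N$ such that $A=\mathbb{C}\hat1\oplus N$. Let $(\,,\,):\mathfrak g\times\mathfrak g\to\mathbb{C}$ be a bilinear form such that $(b,b')\hat1=b_1b'$ for $b,b'\in\mathfrak g$. Assume that there exist $u,v\in\mathfrak g$ such that $u_1v\neq0$, that $\mathrm{Ker}(\partial)=\mathbb{C}\hat1$, and that $N\cdot B\subset\partial(A)$. Then: (i) $(\,,\,)$ is the Killing form of $\mathfrak g$ (normalized so that long roots have square length $2$). (ii) $A$ is a local algebra. Also, $a*a'=0$ for $a,a'\in N$. (iii) For $a\in N$, $u,v\in\mathfrak g$, $a'\in A$, $$a\cdot(u+\partial(a'))=\partial(u_0a),\qquad u_0v_0a+v_0u_0a=(u_1v)*a.$$ Moreover, there exists a dominant integral $\lambda$ such that $B\cong B_\lambda$ as vertex algebroids.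
   Context: A left Leibniz algebra is a complex vector space with a bilinear bracket satisfying $[a,[b,c]]=[[a,b],c]+[b,[a,c]]$. Put $\mathrm{Leib}(L)=\mathrm{Span}\{[u,u]\mid u\in L\}$. $L$ is simple if $[L,L]\ne\mathrm{Leib}(L)$ and $\{0\}$, $\mathrm{Leib}(L)$, $L$ are its only (two-sided) ideals. Let $(A,* )$ be a unital commutative associative $\mathbb{C}$-algebra with identity $\hat1$. A vertex $A$-algebroid is a complex vector space $B$ with: a bilinear map $A\times B\to B$, $(a,v)\mapsto a\cdot v$, with $\hat1\cdot v=v$ (not required to be associative); a left Leibniz bracket on $B$, written $u_0v=[u,v]$; a homomorphism of Leibniz algebras $B\to\mathrm{Der}(A)$, written $u\mapsto(a\mapsto u_0a)$; a symmetric bilinear pairing $B\times B\to A$, written $(u,v)\mapsto u_1v$; and a linear map $\partial:A\to B$ with $\partial(a)_0a'=0$; such that for all $a,a'\in A$, $u,v,v^1,v^2\in B$: $a\cdot(a'\cdot v)-(a*a')\cdot v=(v_0a)\cdot\partial(a')+(v_0a')\cdot\partial(a)$; $u_0(a\cdot v)=(u_0a)\cdot v+a\cdot(u_0v)$; $u_0v+v_0u=\partial(u_1v)$; $(a\cdot v)_0a'=a*(v_0a')$; $(a\cdot u)_1v=a*(u_1v)-u_0v_0a$; $v_0(v^1{}_1v^2)=(v_0v^1)_1v^2+v^1{}_1(v_0v^2)$; $\partial(a*a')=a\cdot\partial(a')+a'\cdot\partial(a)$; $v_0\partial(a)=\partial(v_0a)$; $v_1\partial(a)=v_0a$. $\mathfrak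 g\subset B$ acts on $A$ by $u_0a$. $N\cdot B=\mathrm{Span}\{n\cdot b\mid n\in N,b\in B\}$. A vertex algebroid homomorphism from a vertex $A$-algebroid $B$ to a vertex $A'$-algebroid $B'$ is a linear map $\tau:A\oplus B\to A'\oplus B'$ with $\tau(A)\subseteq A'$, $\tau(B)\subseteq B'$, such that $\tau|_A$ is an algebra homomorphism, $\tau|_B$ is a Leibniz homomorphism, $\tau(a\cdot b)=\tau(a)\cdot\tau(b)$, $\tau(u)_1\tau(v)=\tau(u_1v)$, $\tau\circ\partial=\partial\circ\tau$, $\tau(b_0a)=\tau(b)_0\tau(a)$; an isomorphism is a bijective homomorphism. Convention: "the Killing form" $\langle\,,\,\rangle$ of the simple Lie algebra $\mathfrak g$ means the nondegenerate symmetric invariant form normalized so that $\langle\alpha,\alpha\rangle=2$ for long roots $\alpha$ (a Cartan subalgebra $\mathfrak h$ being identified with $\mathfrak h^*$ via the form). $A_\lambda$, $B_\lambda$: for a dominant integral $\lambda\in\mathfrak h^*$ let $L_\lambda$ be the finite dimensional irreducible $\mathfrak g$-module of highest weight $\lambda$, and $A_\lambda=\mathbb{C}\hat1\oplus N_\lambda$ with $N_\lambda\cong L_\lambda$ as $\mathfrak g$-modules ($\mathfrak g$ kills $\hat1$), where $\hat1$ is the identity and $a*a'=0$ for $a,a'\in N_\lambda$. Let $\partial:N_\lambda\to L_\lambda$ be a $\mathfrak g$-isomorphism, extended by $\partial(\hat1)=0$, and $B_\lambda=\mathfrak g\oplus\partial(A_\lambda)$ with $(u+m)_0(v+n)=[u,v]+u\cdot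 n$ and $(u+m)_0a=u\cdot a$ ($u,v\in\mathfrak g$, $m,n\in\partial(A_\lambda)$, $a\in A_\lambda$); $g_1g'=\langle g,g'\rangle\hat1$, $g_1\partial(a)=\partial(a)_1g=g\cdot a$, $\partial(a)_1\partial(a')=0$; $\hat1\cdot v=v$, $a\cdot(g+\partial(a'))=\partial(g_0a)$ for $a\in N_\lambda$. *)

theory Defs
  imports
    Complex_Main
    "HOL-Library.Function_Algebras"
    "HOL-Library.Product_Plus"
    "HOL-Library.Set_Algebras"
    "HOL-Algebra.Ideal"
begin

section \<open>Complex vector spaces\<close>

class complex_vector = ab_group_add +
  fixes scaleC :: "complex \<Rightarrow> 'a \<Rightarrow> 'a" (infixr "*\<^sub>C" 75)
  assumes scaleC_add_right: "c *\<^sub>C (x + y) = c *\<^sub>C x + c *\<^sub>C y"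
    and scaleC_add_left: "(c + d) *\<^sub>C x = c *\<^sub>C x + d *\<^sub>C x"
    and scaleC_scaleC: "c *\<^sub>C (d *\<^sub>C x) = (c * d) *\<^sub>C x"
    and scaleC_one: "1 *\<^sub>C x = x"

instantiation complex :: complex_vector
begin

definition scaleC_complex :: "complex \<Rightarrow> complex \<Rightarrow> complex" where
  "scaleC_complex c x = c * x"

instance
  by standard (simp_all add: scaleC_complex_def algebra_simps)

end

instantiation prod :: (complex_vector, complex_vector) complex_vector
begin

definition scaleC_prod :: "complex \<Rightarrow> 'a \<times> 'b \<Rightarrow> 'a \<times> 'b" where
  "scaleC_prod c p = (c *\<^sub>C fst p, c *\<^sub>C snd p)"

instance
  by standard
    (simp_all add: scaleC_prod_def prod_eq_iff scaleC_add_right scaleC_add_left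
      scaleC_scaleC scaleC_one)

end

instantiation "fun" :: (type, complex_vector) complex_vector
begin

definition scaleC_fun :: "complex \<Rightarrow> ('a \<Rightarrow> 'b) \<Rightarrow> 'a \<Rightarrow> 'b" where
  "scaleC_fun c f = (\<lambda>x. c *\<^sub>C f x)"

instance
  by standard
    (simp_all add: scaleC_fun_def fun_eq_iff scaleC_add_right scaleC_add_left
      scaleC_scaleC scaleC_one)

end

global_interpretation complex_vector:
  vector_space "scaleC :: complex \<Rightarrow> 'a \<Rightarrow> 'a::complex_vector"
  defines cspan = complex_vector.span
    and csubspace = complex_vector.subspace
    and cdependent = complex_vector.dependent
  by unfold_locales
    (simp_all add: scaleC_add_right scaleC_add_left scaleC_scaleC scaleC_one)

text \<open>Vector spaces are carried by subspaces of ambient types of class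
  \<^class>\<open>complex_vector\<close>; maps matter only on the carriers.\<close>

definition finite_dim :: "'a::complex_vector set \<Rightarrow> bool" where
  "finite_dim X \<longleftrightarrow> (\<exists>S. finite S \<and> X = cspan S)"

definition linear_on ::
    "'a::complex_vector set \<Rightarrow> 'b::complex_vector set \<Rightarrow> ('a \<Rightarrow> 'b) \<Rightarrow> bool" where
  "linear_on X Y f \<longleftrightarrow>
     (\<forall>x\<in>X. f x \<in> Y) \<and>
     (\<forall>x\<in>X. \<forall>x'\<in>X. f (x + x') = f x + f x') \<and>
     (\<forall>c. \<forall>x\<in>X. f (c *\<^sub>C x) = c *\<^sub>C f x)"

definition bilinear_on ::
    "'a::complex_vector set \<Rightarrow> 'b::complex_vector set \<Rightarrow> 'c::complex_vector set \<Rightarrow>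
     ('a \<Rightarrow> 'b \<Rightarrow> 'c) \<Rightarrow> bool" where
  "bilinear_on X Y Z f \<longleftrightarrow>
     (\<forall>x\<in>X. linear_on Y Z (f x)) \<and> (\<forall>y\<in>Y. linear_on X Z (\<lambda>x. f x y))"

definition direct_sum :: "'a::complex_vector set \<Rightarrow> 'a set \<Rightarrow> 'a set \<Rightarrow> bool" where
  "direct_sum Z X Y \<longleftrightarrow> csubspace X \<and> csubspace Y \<and> Z = X + Y \<and> X \<inter> Y = {0}"

section \<open>Leibniz algebras, Lie algebras and their modules\<close>

locale left_leibniz_algebra =
  fixes L :: "'b::complex_vector set" and br :: "'b \<Rightarrow> 'b \<Rightarrow> 'b"
  assumes subspace: "csubspace L"
    and bilinear: "bilinear_on L L L br"
    and leibniz: "\<lbrakk>a \<in> L; b \<in> L; c \<in> L\<rbrakk> \<Longrightarrow>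
      br a (br b c) = br (br a b) c + br b (br a c)"

definition commutator :: "'b::complex_vector set \<Rightarrow> 'b set \<Rightarrow> ('b \<Rightarrow> 'b \<Rightarrow> 'b) \<Rightarrow> 'b set" where
  "commutator X Y br = cspan {br x y |x y. x \<in> X \<and> y \<in> Y}"

definition Leib :: "'b::complex_vector set \<Rightarrow> ('b \<Rightarrow> 'b \<Rightarrow> 'b) \<Rightarrow> 'b set" where
  "Leib L br = cspan {br u u |u. u \<in> L}"

definition leibniz_ideal :: "'b::complex_vector set \<Rightarrow> 'b set \<Rightarrow> ('b \<Rightarrow> 'b \<Rightarrow> 'b) \<Rightarrow> bool" where
  "leibniz_ideal I L br \<longleftrightarrow>
     csubspace I \<and> I \<subseteq> L \<and> (\<forall>x\<in>L. \<forall>y\<in>I. br x y \<in> I \<and> br y x \<in> I)"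

locale simple_leibniz_algebra = left_leibniz_algebra +
  assumes commutator_neq: "commutator L L br \<noteq> Leib L br"
    and ideals: "leibniz_ideal I L br \<Longrightarrow> I \<in> {{0}, Leib L br, L}"

locale lie_algebra = left_leibniz_algebra +
  assumes alternating: "x \<in> L \<Longrightarrow> br x x = 0"

locale simple_lie_algebra = lie_algebra +
  assumes nonabelian: "\<exists>x\<in>L. \<exists>y\<in>L. br x y \<noteq> 0"
    and ideals: "leibniz_ideal I L br \<Longrightarrow> I \<in> {{0}, L}"

locale lie_module = lie_algebra g br
  for g :: "'g::complex_vector set" and br +
  fixes M :: "'m::complex_vector set" and act :: "'g \<Rightarrow> 'm \<Rightarrow> 'm"
  assumes module_subspace: "csubspace M"
    and module_bilinear: "bilinear_on g M M act"
    and module_bracket: "\<lbrakk>x \<in> g; y \<in> g; m \<in> M\<rbrakk> \<Longrightarrow>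
      act (br x y) m = act x (act y m) - act y (act x m)"

locale simple_lie_module = lie_module +
  assumes nonzero: "M \<noteq> {0}"
    and submodules: "\<lbrakk>csubspace W; W \<subseteq> M; \<forall>x\<in>g. \<forall>w\<in>W. act x w \<in> W\<rbrakk> \<Longrightarrow> W \<in> {{0}, M}"

definition lie_module_iso ::
    "'g set \<Rightarrow> 'm::complex_vector set \<Rightarrow> ('g \<Rightarrow> 'm \<Rightarrow> 'm) \<Rightarrow>
     'n::complex_vector set \<Rightarrow> ('g \<Rightarrow> 'n \<Rightarrow> 'n) \<Rightarrow> ('m \<Rightarrow> 'n) \<Rightarrow> bool" where
  "lie_module_iso g M actM N actN f \<longleftrightarrow>
     linear_on M N f \<and> bij_betw f M N \<and> (\<forall>x\<in>g. \<forall>m\<in>M. f (actM x m) = actN x (f m))"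

section \<open>Cartan subalgebras, roots and weights\<close>

primrec lower_central ::
    "'g::complex_vector set \<Rightarrow> ('g \<Rightarrow> 'g \<Rightarrow> 'g) \<Rightarrow> nat \<Rightarrow> 'g set" where
  "lower_central h br 0 = h"
| "lower_central h br (Suc n) = commutator h (lower_central h br n) br"

definition cartan_subalgebra ::
    "'g::complex_vector set \<Rightarrow> ('g \<Rightarrow> 'g \<Rightarrow> 'g) \<Rightarrow> 'g set \<Rightarrow> bool" where
  "cartan_subalgebra g br h \<longleftrightarrow>
     h \<subseteq> g \<and> lie_algebra h br \<and>
     (\<exists>n. lower_central h br n = {0}) \<and>
     {x \<in> g. \<forall>y\<in>h. br x y \<in> h} = h"

text \<open>Functionals on \<open>h\<close> are extended by \<open>0\<close> outside \<open>h\<close>, so that equality of functionals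
  is equality of functions.\<close>

definition dual_space :: "'g::complex_vector set \<Rightarrow> ('g \<Rightarrow> complex) set" where
  "dual_space h = {\<alpha>. linear_on h UNIV \<alpha> \<and> (\<forall>x. x \<notin> h \<longrightarrow> \<alpha> x = 0)}"

definition root_space ::
    "'g::complex_vector set \<Rightarrow> ('g \<Rightarrow> 'g \<Rightarrow> 'g) \<Rightarrow> 'g set \<Rightarrow> ('g \<Rightarrow> complex) \<Rightarrow> 'g set" where
  "root_space g br h \<alpha> = {x \<in> g. \<forall>t\<in>h. br t x = \<alpha> t *\<^sub>C x}"

definition roots ::
    "'g::complex_vector set \<Rightarrow> ('g \<Rightarrow> 'g \<Rightarrow> 'g) \<Rightarrow> 'g set \<Rightarrow> ('g \<Rightarrow> complex) set" where
  "roots g br h = {\<alpha> \<in> dual_space h. \<alpha> \<noteq> 0 \<and> root_space g br h \<alpha> \<noteq> {0}}"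

definition nat_combinations :: "('g \<Rightarrow> complex) set \<Rightarrow> ('g \<Rightarrow> complex) set" where
  "nat_combinations \<Delta> = {\<Sum>\<alpha>\<in>\<Delta>. of_nat (k \<alpha>) *\<^sub>C \<alpha> |k :: ('g \<Rightarrow> complex) \<Rightarrow> nat. True}"

definition root_base ::
    "'g::complex_vector set \<Rightarrow> ('g \<Rightarrow> 'g \<Rightarrow> 'g) \<Rightarrow> 'g set \<Rightarrow> ('g \<Rightarrow> complex) set \<Rightarrow> bool" where
  "root_base g br h \<Delta> \<longleftrightarrow>
     finite \<Delta> \<and> \<Delta> \<subseteq> roots g br h \<and> \<not> cdependent \<Delta> \<and> cspan \<Delta> = dual_space h \<and>
     (\<forall>\<beta>\<in>roots g br h. \<beta> \<in> nat_combinations \<Delta> \<or> - \<beta> \<in> nat_combinations \<Delta>)"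

definition positive_roots ::
    "'g::complex_vector set \<Rightarrow> ('g \<Rightarrow> 'g \<Rightarrow> 'g) \<Rightarrow> 'g set \<Rightarrow> ('g \<Rightarrow> complex) set \<Rightarrow>
     ('g \<Rightarrow> complex) set" where
  "positive_roots g br h \<Delta> = roots g br h \<inter> nat_combinations \<Delta>"

text \<open>The identification of \<open>h\<close> with its dual by means of a form \<open>\<kappa>\<close> nondegenerate on \<open>h\<close>,
  and the form it induces on the dual.\<close>

definition dual_vector ::
    "'g set \<Rightarrow> ('g \<Rightarrow> 'g \<Rightarrow> complex) \<Rightarrow> ('g \<Rightarrow> complex) \<Rightarrow> 'g" where
  "dual_vector h \<kappa> \<alpha> = (THE t. t \<in> h \<and> (\<forall>x\<in>h. \<kappa> t x = \<alpha> x))"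

definition dual_form ::
    "'g set \<Rightarrow> ('g \<Rightarrow> 'g \<Rightarrow> complex) \<Rightarrow> ('g \<Rightarrow> complex) \<Rightarrow> ('g \<Rightarrow> complex) \<Rightarrow> complex" where
  "dual_form h \<kappa> \<alpha> \<beta> = \<kappa> (dual_vector h \<kappa> \<alpha>) (dual_vector h \<kappa> \<beta>)"

text \<open>Comparing absolute values makes the notion of a long root independent of the
  (complex) scaling of \<open>\<kappa>\<close>. If all roots have the same length, all of them are long.\<close>

definition long_roots ::
    "'g::complex_vector set \<Rightarrow> ('g \<Rightarrow> 'g \<Rightarrow> 'g) \<Rightarrow> 'g set \<Rightarrow> ('g \<Rightarrow> 'g \<Rightarrow> complex) \<Rightarrow>
     ('g \<Rightarrow> complex) set" where
  "long_roots g br h \<kappa> =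
     {\<alpha> \<in> roots g br h. \<forall>\<beta>\<in>roots g br h. cmod (dual_form h \<kappa> \<beta> \<beta>) \<le> cmod (dual_form h \<kappa> \<alpha> \<alpha>)}"

text \<open>For simple \<open>g\<close> this determines \<open>\<kappa>\<close> on \<open>g\<close>, and the normalization does not depend on
  the Cartan subalgebra.\<close>

definition normalized_killing_form ::
    "'g::complex_vector set \<Rightarrow> ('g \<Rightarrow> 'g \<Rightarrow> 'g) \<Rightarrow> ('g \<Rightarrow> 'g \<Rightarrow> complex) \<Rightarrow> bool" where
  "normalized_killing_form g br \<kappa> \<longleftrightarrow>
     bilinear_on g g UNIV \<kappa> \<and>
     (\<forall>x\<in>g. \<forall>y\<in>g. \<kappa> x y = \<kappa> y x) \<and>
     (\<forall>x\<in>g. \<forall>y\<in>g. \<forall>z\<in>g. \<kappa> (br x y) z = \<kappa> x (br y z)) \<and>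
     (\<forall>x\<in>g. (\<forall>y\<in>g. \<kappa> x y = 0) \<longrightarrow> x = 0) \<and>
     (\<forall>h. cartan_subalgebra g br h \<longrightarrow> (\<forall>\<alpha>\<in>long_roots g br h \<kappa>. dual_form h \<kappa> \<alpha> \<alpha> = 2))"

definition dominant_integral ::
    "'g::complex_vector set \<Rightarrow> ('g \<Rightarrow> complex) set \<Rightarrow> ('g \<Rightarrow> 'g \<Rightarrow> complex) \<Rightarrow>
     ('g \<Rightarrow> complex) \<Rightarrow> bool" where
  "dominant_integral h \<Delta> \<kappa> \<mu> \<longleftrightarrow>
     \<mu> \<in> dual_space h \<and> (\<forall>\<alpha>\<in>\<Delta>. 2 * dual_form h \<kappa> \<mu> \<alpha> / dual_form h \<kappa> \<alpha> \<alpha> \<in> \<nat>)"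

definition irreducible_highest_weight_module ::
    "'g::complex_vector set \<Rightarrow> ('g \<Rightarrow> 'g \<Rightarrow> 'g) \<Rightarrow> 'g set \<Rightarrow> ('g \<Rightarrow> complex) set \<Rightarrow>
     'm::complex_vector set \<Rightarrow> ('g \<Rightarrow> 'm \<Rightarrow> 'm) \<Rightarrow> ('g \<Rightarrow> complex) \<Rightarrow> bool" where
  "irreducible_highest_weight_module g br h \<Delta> M act \<mu> \<longleftrightarrow>
     simple_lie_module g br M act \<and> finite_dim M \<and>
     (\<exists>m\<in>M. m \<noteq> 0 \<and>
        (\<forall>t\<in>h. act t m = \<mu> t *\<^sub>C m) \<and>
        (\<forall>\<beta>\<in>positive_roots g br h \<Delta>. \<forall>x\<in>root_space g br h \<beta>. act x m = 0))"

section \<open>Vertex algebroids\<close>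

locale comm_algebra =
  fixes A :: "'a::complex_vector set" and mul :: "'a \<Rightarrow> 'a \<Rightarrow> 'a" and unit :: 'a
  assumes subspace: "csubspace A"
    and bilinear: "bilinear_on A A A mul"
    and assoc: "\<lbrakk>a \<in> A; b \<in> A; c \<in> A\<rbrakk> \<Longrightarrow> mul (mul a b) c = mul a (mul b c)"
    and comm: "\<lbrakk>a \<in> A; b \<in> A\<rbrakk> \<Longrightarrow> mul a b = mul b a"
    and unit_closed: "unit \<in> A"
    and unit_left: "a \<in> A \<Longrightarrow> mul unit a = a"

definition derivations :: "'a::complex_vector set \<Rightarrow> ('a \<Rightarrow> 'a \<Rightarrow> 'a) \<Rightarrow> ('a \<Rightarrow> 'a) set" where
  "derivations A mul =
     {D. linear_on A A D \<and> (\<forall>a\<in>A. \<forall>b\<in>A. D (mul a b) = mul (D a) b + mul a (D b))}"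

definition local_algebra :: "'a::complex_vector set \<Rightarrow> ('a \<Rightarrow> 'a \<Rightarrow> 'a) \<Rightarrow> 'a \<Rightarrow> bool" where
  "local_algebra A mul unit \<longleftrightarrow>
     (\<exists>!I. maximalideal I \<lparr>carrier = A, mult = mul, one = unit, zero = 0, add = (+)\<rparr>)"

text \<open>The two carriers and the operations of a vertex algebroid: \<open>a \<star> a'\<close> is the product of
  the algebra, \<open>a \<cdot> v\<close> its (nonassociative) action, \<open>u \<bullet>\<^sub>0 v\<close> the Leibniz bracket
  \<open>u\<^sub>0v\<close>, \<open>u \<rhd>\<^sub>0 a\<close> the action \<open>u\<^sub>0a\<close> by derivations and
  \<open>u \<bullet>\<^sub>1 v\<close> the pairing \<open>u\<^sub>1v\<close>.\<close>

record ('a, 'b) algebroid =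
  Alg :: "'a set"
  Vec :: "'b set"
  amult :: "'a \<Rightarrow> 'a \<Rightarrow> 'a" (infixl "\<star>\<index>" 70)
  aone :: 'a ("\<^bold>1\<index>")
  aact :: "'a \<Rightarrow> 'b \<Rightarrow> 'b" (infixr "\<cdot>\<index>" 75)
  bracket :: "'b \<Rightarrow> 'b \<Rightarrow> 'b" (infixr "\<bullet>\<^sub>0\<index>" 75)
  anchor :: "'b \<Rightarrow> 'a \<Rightarrow> 'a" (infixr "\<rhd>\<^sub>0\<index>" 75)
  pairing :: "'b \<Rightarrow> 'b \<Rightarrow> 'a" (infixr "\<bullet>\<^sub>1\<index>" 75)
  partial :: "'a \<Rightarrow> 'b" ("\<partial>\<index>")

locale vertex_algebroid =
  A: comm_algebra "Alg V" "amult V" "aone V" + B: left_leibniz_algebra "Vec V" "bracket V"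
  for V :: "('a::complex_vector, 'b::complex_vector) algebroid" (structure) +
  assumes act_bilinear: "bilinear_on (Alg V) (Vec V) (Vec V) (aact V)"
    and act_one: "v \<in> Vec V \<Longrightarrow> \<^bold>1 \<cdot> v = v"
    and anchor_bilinear: "bilinear_on (Vec V) (Alg V) (Alg V) (anchor V)"
    and anchor_derivation: "u \<in> Vec V \<Longrightarrow> anchor V u \<in> derivations (Alg V) (amult V)"
    and anchor_bracket: "\<lbrakk>u \<in> Vec V; v \<in> Vec V; a \<in> Alg V\<rbrakk> \<Longrightarrow>
      (u \<bullet>\<^sub>0 v) \<rhd>\<^sub>0 a = u \<rhd>\<^sub>0 (v \<rhd>\<^sub>0 a) - v \<rhd>\<^sub>0 (u \<rhd>\<^sub>0 a)"
    and pairing_bilinear: "bilinear_on (Vec V) (Vec V) (Alg V) (pairing V)"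
    and pairing_sym: "\<lbrakk>u \<in> Vec V; v \<in> Vec V\<rbrakk> \<Longrightarrow> u \<bullet>\<^sub>1 v = v \<bullet>\<^sub>1 u"
    and partial_linear: "linear_on (Alg V) (Vec V) (partial V)"
    and partial_anchor: "\<lbrakk>a \<in> Alg V; a' \<in> Alg V\<rbrakk> \<Longrightarrow> \<partial> a \<rhd>\<^sub>0 a' = 0"
    and act_act: "\<lbrakk>a \<in> Alg V; a' \<in> Alg V; v \<in> Vec V\<rbrakk> \<Longrightarrow>
      a \<cdot> (a' \<cdot> v) - (a \<star> a') \<cdot> v = (v \<rhd>\<^sub>0 a) \<cdot> \<partial> a' + (v \<rhd>\<^sub>0 a') \<cdot> \<partial> a"
    and bracket_act: "\<lbrakk>u \<in> Vec V; a \<in> Alg V; v \<in> Vec V\<rbrakk> \<Longrightarrow>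
      u \<bullet>\<^sub>0 (a \<cdot> v) = (u \<rhd>\<^sub>0 a) \<cdot> v + a \<cdot> (u \<bullet>\<^sub>0 v)"
    and bracket_sym: "\<lbrakk>u \<in> Vec V; v \<in> Vec V\<rbrakk> \<Longrightarrow> u \<bullet>\<^sub>0 v + v \<bullet>\<^sub>0 u = \<partial> (u \<bullet>\<^sub>1 v)"
    and act_anchor: "\<lbrakk>a \<in> Alg V; v \<in> Vec V; a' \<in> Alg V\<rbrakk> \<Longrightarrow>
      (a \<cdot> v) \<rhd>\<^sub>0 a' = a \<star> (v \<rhd>\<^sub>0 a')"
    and act_pairing: "\<lbrakk>a \<in> Alg V; u \<in> Vec V; v \<in> Vec V\<rbrakk> \<Longrightarrow>
      (a \<cdot> u) \<bullet>\<^sub>1 v = a \<star> (u \<bullet>\<^sub>1 v) - u \<rhd>\<^sub>0 (v \<rhd>\<^sub>0 a)"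
    and anchor_pairing: "\<lbrakk>v \<in> Vec V; v1 \<in> Vec V; v2 \<in> Vec V\<rbrakk> \<Longrightarrow>
      v \<rhd>\<^sub>0 (v1 \<bullet>\<^sub>1 v2) = (v \<bullet>\<^sub>0 v1) \<bullet>\<^sub>1 v2 + v1 \<bullet>\<^sub>1 (v \<bullet>\<^sub>0 v2)"
    and partial_mult: "\<lbrakk>a \<in> Alg V; a' \<in> Alg V\<rbrakk> \<Longrightarrow> \<partial> (a \<star> a') = a \<cdot> \<partial> a' + a' \<cdot> \<partial> a"
    and bracket_partial: "\<lbrakk>v \<in> Vec V; a \<in> Alg V\<rbrakk> \<Longrightarrow> v \<bullet>\<^sub>0 \<partial> a = \<partial> (v \<rhd>\<^sub>0 a)"
    and pairing_partial: "\<lbrakk>v \<in> Vec V; a \<in> Alg V\<rbrakk> \<Longrightarrow> v \<bullet>\<^sub>1 \<partial> a = v \<rhd>\<^sub>0 a"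

text \<open>A linear map \<open>Alg V \<oplus> Vec V \<rightarrow> Alg W \<oplus> Vec W\<close> preserving the summands is given by the pair
  \<open>(f, g)\<close> of its restrictions, and it is bijective iff both restrictions are.\<close>

definition algebroid_hom ::
    "('a::complex_vector, 'b::complex_vector) algebroid \<Rightarrow>
     ('c::complex_vector, 'd::complex_vector) algebroid \<Rightarrow> ('a \<Rightarrow> 'c) \<Rightarrow> ('b \<Rightarrow> 'd) \<Rightarrow> bool" where
  "algebroid_hom V W f g \<longleftrightarrow>
     linear_on (Alg V) (Alg W) f \<and> linear_on (Vec V) (Vec W) g \<and>
     f \<^bold>1\<^bsub>V\<^esub> = \<^bold>1\<^bsub>W\<^esub> \<and>
     (\<forall>a\<in>Alg V. \<forall>a'\<in>Alg V. f (a \<star>\<^bsub>V\<^esub> a') = f a \<star>\<^bsub>W\<^esub> f a') \<and>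
     (\<forall>u\<in>Vec V. \<forall>v\<in>Vec V. g (u \<bullet>\<^sub>0\<^bsub>V\<^esub> v) = g u \<bullet>\<^sub>0\<^bsub>W\<^esub> g v) \<and>
     (\<forall>a\<in>Alg V. \<forall>v\<in>Vec V. g (a \<cdot>\<^bsub>V\<^esub> v) = f a \<cdot>\<^bsub>W\<^esub> g v) \<and>
     (\<forall>u\<in>Vec V. \<forall>v\<in>Vec V. g u \<bullet>\<^sub>1\<^bsub>W\<^esub> g v = f (u \<bullet>\<^sub>1\<^bsub>V\<^esub> v)) \<and>
     (\<forall>a\<in>Alg V. g (\<partial>\<^bsub>V\<^esub> a) = \<partial>\<^bsub>W\<^esub> (f a)) \<and>
     (\<forall>v\<in>Vec V. \<forall>a\<in>Alg V. f (v \<rhd>\<^sub>0\<^bsub>V\<^esub> a) = g v \<rhd>\<^sub>0\<^bsub>W\<^esub> f a)"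

definition algebroid_isomorphic ::
    "('a::complex_vector, 'b::complex_vector) algebroid \<Rightarrow>
     ('c::complex_vector, 'd::complex_vector) algebroid \<Rightarrow> bool" where
  "algebroid_isomorphic V W \<longleftrightarrow>
     vertex_algebroid V \<and> vertex_algebroid W \<and>
     (\<exists>f g. algebroid_hom V W f g \<and> bij_betw f (Alg V) (Alg W) \<and> bij_betw g (Vec V) (Vec W))"

text \<open>\<open>B\<^sub>\<lambda>\<close>, built from a Lie algebra \<open>g\<close> with form \<open>\<kappa>\<close>, modules \<open>N\<close> and \<open>L\<close> and an isomorphism
  \<open>d : N \<rightarrow> L\<close>: the pair \<open>(c, n)\<close> is \<open>c1 + n\<close>, the pair \<open>(x, m)\<close> is \<open>x + m\<close>
  with \<open>m \<in> L = \<partial>(A\<^sub>\<lambda>)\<close>, and \<open>inv_into N d m\<close> is the \<open>a \<in> N\<close> with \<open>m = \<partial> a\<close>.\<close>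

definition B_lambda ::
    "'g::complex_vector set \<Rightarrow> ('g \<Rightarrow> 'g \<Rightarrow> 'g) \<Rightarrow> ('g \<Rightarrow> 'g \<Rightarrow> complex) \<Rightarrow>
     'n::complex_vector set \<Rightarrow> ('g \<Rightarrow> 'n \<Rightarrow> 'n) \<Rightarrow>
     'm::complex_vector set \<Rightarrow> ('g \<Rightarrow> 'm \<Rightarrow> 'm) \<Rightarrow> ('n \<Rightarrow> 'm) \<Rightarrow>
     (complex \<times> 'n, 'g \<times> 'm) algebroid" where
  "B_lambda g br \<kappa> N actN L actL d =
     \<lparr>Alg = UNIV \<times> N,
      Vec = g \<times> L,
      amult = (\<lambda>(c, n) (c', n'). (c * c', c *\<^sub>C n' + c' *\<^sub>C n)),
      aone = (1, 0),
      aact = (\<lambda>(c, n) (x, m). (c *\<^sub>C x, c *\<^sub>C m + d (actN x n))),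
      bracket = (\<lambda>(x, m) (x', m'). (br x x', actL x m')),
      anchor = (\<lambda>(x, m) (c, n). (0, actN x n)),
      pairing = (\<lambda>(x, m) (x', m').
        (\<kappa> x x', actN x (inv_into N d m') + actN x' (inv_into N d m))),
      partial = (\<lambda>(c, n). (0, d n))\<rparr>"

text \<open>The last line says that \<open>\<partial>(A)\<close> is a simple module under the bracket of \<open>B\<close>.\<close>

definition levi_factor ::
    "('a::complex_vector, 'b::complex_vector) algebroid \<Rightarrow> 'b set \<Rightarrow> bool" where
  "levi_factor V g \<longleftrightarrow>
     g \<subseteq> Vec V \<and> simple_lie_algebra g (bracket V) \<and>
     Vec V = g + partial V ` Alg V \<and>
     simple_lie_module g (bracket V) (partial V ` Alg V) (bracket V)"

definition unit_complement ::
    "('a::complex_vector, 'b::complex_vector) algebroid \<Rightarrow> 'b set \<Rightarrow> 'a set \<Rightarrow> bool" where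
  "unit_complement V g N \<longleftrightarrow>
     lie_module g (bracket V) N (anchor V) \<and>
     direct_sum (Alg V) (cspan {\<^bold>1\<^bsub>V\<^esub>}) N"

end

(*
  Let M = Leib B. The axioms give M = \<partial>(A), [M, B] = 0, [B, B] = B, and M is a simple left
  B-module.

  M has no nonzero invariants: otherwise B acts trivially on M. The Killing form of B is nonzero,
  because otherwise every left multiplication is nilpotent (pair it with the derivation that acts
  by the complex conjugate of its eigenvalues), contradicting Engel's theorem. The Casimir operator
  of the Killing form then kills M but not B/M, its image is an ideal complement of M, and B would
  be a Lie algebra.

  Let X be the span of all v_0 a. Comparing traces of multiplications shows X * X = 0, hence
  X \<cdot> B \<subseteq> M. By Schur's lemma p in A acts by a scalar \<chi> p on M = \<partial>(X), and the invariant form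
  \<psi>(u, v) = \<chi>(u_1 v) satisfies v_0(x \<cdot> u) = \<psi>(u, v) \<partial>x - u v \<partial>x. Together with the Casimir
  operator of \<psi> this forces the Clifford relation u v + v u = \<psi>(u, v) on M, whence
  [[w, u], v] = 2 \<psi>(u, v) w - 2 \<psi>(w, v) u modulo M. Now the Casimir operator acts on M and on
  B/M by different scalars, which splits B as g + M. A complement of the identity in A is the
  kernel of the trace of multiplications.

  Under the additional hypotheses N = X and the given form is \<psi>. The double bracket formula makes
  every Cartan subalgebra a line spanned by some t with \<psi>(t, t) \<noteq> 0, every root \<alpha> satisfies
  \<alpha>(t)^2 = 2 \<psi>(t, t), and the highest weight of M is \<alpha>/2.
*)
theory Submission
  imports Defs "HOL-Computational_Algebra.Fundamental_Theorem_Algebra"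
begin

section \<open>Linear maps on finite-dimensional subspaces\<close>

text \<open>Left multiplication by \<open>Leib\<close> is zero while right multiplication is not, so
  the theorems of Weyl and Levi do not apply to B directly. Each splitting comes from an operator
  that commutes with all left multiplications, is zero on M and nonzero on B/M; simplicity turns its
  image into a complement of M. Two forms are needed. The Casimir operator of the Killing form is
  known to kill M only when B acts trivially on M, so it serves just to exclude invariants. Only
  after that can elements of M be compared by the action of B on them, and elements of B modulo M by
  their action on M. The form \<psi> is the one for which all scalars can be computed, but it must
  first be shown to be nonzero: otherwise the relation that leads to the Clifford identity would
  make M trivial. The double bracket formula makes commuting elements of g proportional, so g has
  rank one. In effect g is sl_2 with its trace form and M is the two-dimensional module, which
  explains why the highest weight is half a root and why the Casimir scalars on M and B/M, n/2 and
  2n - 2, come out as 3/2 and 4.\<close>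

lemmas csub = complex_vector.subspace_add complex_vector.subspace_scale
  complex_vector.subspace_0 complex_vector.subspace_diff complex_vector.subspace_neg
  complex_vector.subspace_sum

lemma subspace_plus:
  assumes "csubspace X" "csubspace Y"
  shows "csubspace (X + Y)"
proof -
  have "X + Y = {x + y |x y. x \<in> X \<and> y \<in> Y}" by (auto simp: set_plus_def)
  then show ?thesis using complex_vector.subspace_sums[OF assms] by simp
qed

lemma linear_onI:
  assumes "\<And>x. x \<in> X \<Longrightarrow> f x \<in> Y"
    and "\<And>x y. \<lbrakk>x \<in> X; y \<in> X\<rbrakk> \<Longrightarrow> f (x + y) = f x + f y"
    and "\<And>c x. x \<in> X \<Longrightarrow> f (c *\<^sub>C x) = c *\<^sub>C f x"
  shows "linear_on X Y f"
  using assms by (simp add: linear_on_def)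

lemma linear_onD:
  assumes "linear_on X Y f"
  shows linear_on_mem: "x \<in> X \<Longrightarrow> f x \<in> Y"
    and linear_on_add: "\<lbrakk>x \<in> X; y \<in> X\<rbrakk> \<Longrightarrow> f (x + y) = f x + f y"
    and linear_on_scale: "x \<in> X \<Longrightarrow> f (c *\<^sub>C x) = c *\<^sub>C f x"
  using assms by (auto simp: linear_on_def)

lemma linear_on_zero: "\<lbrakk>linear_on X Y f; csubspace X\<rbrakk> \<Longrightarrow> f 0 = 0"
  using linear_on_scale[of X Y f 0 0] complex_vector.subspace_0[of X] by simp

lemma linear_on_neg: "\<lbrakk>linear_on X Y f; x \<in> X\<rbrakk> \<Longrightarrow> f (- x) = - f x"
  using linear_on_scale[of X Y f x "-1"] by simp

lemma linear_on_diff: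
  "\<lbrakk>linear_on X Y f; csubspace X; x \<in> X; y \<in> X\<rbrakk> \<Longrightarrow> f (x - y) = f x - f y"
  using linear_on_add[of X Y f x "- y"] linear_on_neg[of X Y f y]
    complex_vector.subspace_neg[of X y] by simp

lemma linear_on_sum:
  assumes "linear_on X Y f" "csubspace X" "\<And>i. i \<in> I \<Longrightarrow> x i \<in> X"
  shows "f (sum x I) = (\<Sum>i\<in>I. f (x i))"
  using assms(3)
proof (induction I rule: infinite_finite_induct)
  case (insert i I)
  then have "sum x I \<in> X"
    using complex_vector.subspace_sum[OF assms(2)] by blast
  with insert show ?case
    using linear_on_add[OF assms(1)] by simp
qed (use assms(1,2) linear_on_zero in auto)

lemma linear_on_comp:
  "\<lbrakk>linear_on X Y f; linear_on Y Z g\<rbrakk> \<Longrightarrow> linear_on X Z (\<lambda>x. g (f x))"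
  by (auto simp: linear_on_def)

lemma linear_on_funpow: "linear_on X X f \<Longrightarrow> linear_on X X (f ^^ n)"
  by (induction n) (auto simp: linear_on_def)

lemma linear_on_combine:
  assumes "linear_on X Y f" "linear_on X Y g" "csubspace Y"
  shows "linear_on X Y (\<lambda>x. f x + g x)" "linear_on X Y (\<lambda>x. f x - g x)"
    "linear_on X Y (\<lambda>x. c *\<^sub>C f x)"
  using assms
  by (auto simp: linear_on_def csub algebra_simps scaleC_add_right scaleC_scaleC
      complex_vector.scale_right_diff_distrib)

lemma linear_on_subset:
  assumes "linear_on X Y f" "X' \<subseteq> X" "\<And>x. x \<in> X' \<Longrightarrow> f x \<in> Y'"
  shows "linear_on X' Y' f"
  using assms(2,3) by (auto intro!: linear_onI simp: linear_on_add[OF assms(1)]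
      linear_on_scale[OF assms(1)] subset_iff)

text \<open>Induction over a span, carrying membership in \<open>X\<close> along because
  \<open>f\<close> is known to be linear only there. Statements about \<open>Leib\<close>,
  commutators and spans of products are reduced to generators in this form.\<close>

lemma linear_on_span_subset:
  assumes "linear_on X Y f" "csubspace X" "csubspace Y'" "S \<subseteq> X" "\<And>x. x \<in> S \<Longrightarrow> f x \<in> Y'"
    and "x \<in> cspan S"
  shows "f x \<in> Y'"
proof -
  have sub: "cspan S \<subseteq> X"
    using assms(2,4) complex_vector.span_minimal by blast
  have "x \<in> X \<and> f x \<in> Y'"
    using assms(6)
  proof (induction rule: complex_vector.span_induct_alt)
    case base
    then show ?case
      using assms by (simp add: linear_on_zero[OF assms(1,2)] csub)
  next
    case (step c x y)
    with assms have "x \<in> X" by blast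
    with step assms show ?case
      by (simp add: csub linear_on_add[OF assms(1)] linear_on_scale[OF assms(1)])
  qed
  then show ?thesis by simp
qed

lemma linear_on_image_subspace:
  assumes "linear_on X Y f" "csubspace X"
  shows "csubspace (f ` X)"
  unfolding complex_vector.subspace_def
proof (intro conjI ballI allI)
  show "0 \<in> f ` X"
    using assms linear_on_zero complex_vector.subspace_0 by (metis image_eqI)
next
  fix x y assume "x \<in> f ` X" "y \<in> f ` X"
  then show "x + y \<in> f ` X"
    using assms(2) linear_on_add[OF assms(1)] complex_vector.subspace_add
    by (smt (verit) image_iff)
next
  fix c x assume "x \<in> f ` X"
  then show "c *\<^sub>C x \<in> f ` X"
    using assms(2) linear_on_scale[OF assms(1)] complex_vector.subspace_scale
    by (smt (verit) image_iff)
qed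

lemma linear_on_preimage_subspace:
  assumes "linear_on X Y f" "csubspace X" "csubspace W"
  shows "csubspace {x \<in> X. f x \<in> W}"
  unfolding complex_vector.subspace_def
  using assms by (auto simp: csub linear_on_zero[OF assms(1,2)] linear_on_add[OF assms(1)]
      linear_on_scale[OF assms(1)])

lemma linear_on_inj:
  assumes "linear_on X Y f" "csubspace X" "\<And>x. \<lbrakk>x \<in> X; f x = 0\<rbrakk> \<Longrightarrow> x = 0"
  shows "inj_on f X"
proof (rule inj_onI)
  fix x y assume "x \<in> X" "y \<in> X" "f x = f y"
  then have "f (x - y) = 0" "x - y \<in> X"
    using linear_on_diff[OF assms(1,2)] assms(2) by (auto simp: csub)
  then show "x = y" using assms(3) by fastforce
qed

lemma bilinear_onD:
  assumes "bilinear_on X Y Z f"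
  shows bilinear_on_right: "x \<in> X \<Longrightarrow> linear_on Y Z (f x)"
    and bilinear_on_left: "y \<in> Y \<Longrightarrow> linear_on X Z (\<lambda>x. f x y)"
  using assms by (auto simp: bilinear_on_def)

section \<open>Bases, dimension and endomorphisms\<close>

definition is_basis :: "'b::complex_vector set \<Rightarrow> 'b set \<Rightarrow> bool" where
  "is_basis V S \<longleftrightarrow> finite S \<and> \<not> cdependent S \<and> cspan S = V"

lemma finite_dim_subspace: "finite_dim V \<Longrightarrow> csubspace V"
  unfolding finite_dim_def by auto

lemma basis_dim: "is_basis V S \<Longrightarrow> complex_vector.dim V = card S"
  using complex_vector.dim_eq_card_independent[of S] by (auto simp: is_basis_def)

text \<open>\<open>T\<close> may be infinite, as with a union of generalized eigenspaces; the finite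
  spanning set of \<open>V\<close> bounds the size of the independent set chosen inside
  \<open>T\<close>.\<close>

lemma basis_extends:
  assumes V: "finite_dim V" and S: "S \<subseteq> V" "\<not> cdependent S" and T: "S \<subseteq> T" "cspan T = V"
  obtains S' where "S \<subseteq> S'" "S' \<subseteq> T" "is_basis V S'"
proof -
  obtain S' where S': "S \<subseteq> S'" "S' \<subseteq> T" "\<not> cdependent S'" "T \<subseteq> cspan S'"
    using complex_vector.maximal_independent_subset_extend[OF T(1) S(2)] by blast
  obtain F where F: "finite F" "V = cspan F"
    using V finite_dim_def by blast
  have "cspan S' = V"
    using complex_vector.span_mono[OF S'(2)] complex_vector.span_minimal[OF S'(4)] T(2) by simp
  moreover have "finite S'"
    using complex_vector.independent_span_bound[of F S'] F S'(3) calculation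
      complex_vector.span_superset[of S'] by simp
  ultimately show ?thesis using that[of S'] S' by (simp add: is_basis_def)
qed

lemma basis_within:
  assumes V: "finite_dim V" and T: "cspan T = V"
  obtains S where "S \<subseteq> T" "is_basis V S"
proof -
  from basis_extends[OF V _ _ _ T, of "{}"] obtain S where "S \<subseteq> T" "is_basis V S"
    using complex_vector.independent_empty by auto
  then show ?thesis using that by simp
qed

lemma basis_ex: "finite_dim V \<Longrightarrow> \<exists>S. is_basis V S"
  using basis_within[of V V] finite_dim_subspace[of V] complex_vector.span_eq_iff[of V] by blast

lemma basis_finite_dim: "is_basis V S \<Longrightarrow> finite_dim V"
  by (auto simp: is_basis_def finite_dim_def)

lemma finite_dim_subset:
  assumes "finite_dim V" "csubspace U" "U \<subseteq> V"
  shows "finite_dim U"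
proof -
  obtain F where F: "finite F" "V = cspan F"
    using assms(1) finite_dim_def by blast
  obtain S where S: "S \<subseteq> U" "\<not> cdependent S" "U \<subseteq> cspan S"
    using complex_vector.maximal_independent_subset by blast
  have "finite S"
    using complex_vector.independent_span_bound[of F S] F S assms(3) by blast
  moreover have "U = cspan S"
    using S assms(2) complex_vector.span_minimal by blast
  ultimately show ?thesis unfolding finite_dim_def by blast
qed

lemma basis_extend_subspace:
  assumes "finite_dim V" "csubspace U" "U \<subseteq> V"
  obtains S T where "S \<subseteq> T" "is_basis U S" "is_basis V T"
proof -
  obtain S where S: "is_basis U S"
    using basis_ex finite_dim_subset[OF assms] by blast
  then have "S \<subseteq> V"
    using assms(3) complex_vector.span_superset is_basis_def by blast
  then show ?thesis
    using that S basis_extends[OF assms(1) \<open>S \<subseteq> V\<close>, of V] is_basis_def assms(1)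
      finite_dim_subspace complex_vector.span_eq_iff by metis
qed

lemma dim_less:
  assumes "finite_dim V" "csubspace U" "U \<subset> V"
  shows "complex_vector.dim U < complex_vector.dim V"
proof -
  obtain S T where ST: "S \<subseteq> T" "is_basis U S" "is_basis V T"
    using basis_extend_subspace[OF assms(1,2)] assms(3) by blast
  then have "S \<noteq> T" using assms(3) by (auto simp: is_basis_def)
  then have "S \<subset> T" using ST by blast
  then have "card S < card T" using ST by (simp add: is_basis_def psubset_card_mono)
  then show ?thesis
    using basis_dim[OF ST(2)] basis_dim[OF ST(3)] by simp
qed

text \<open>A basis goes to an independent set of the same size, whereas a proper subspace would
  have smaller dimension.\<close>

lemma inj_imp_surj_on:
  assumes "finite_dim V" "linear_on V V f" "inj_on f V"
  shows "f ` V = V"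
proof (rule ccontr)
  assume "f ` V \<noteq> V"
  note sub = finite_dim_subspace[OF assms(1)]
  have "f ` V \<subset> V"
    using \<open>f ` V \<noteq> V\<close> linear_on_mem[OF assms(2)] by blast
  have csf: "csubspace (f ` V)"
    using linear_on_image_subspace[OF assms(2) sub] .
  obtain S where S: "is_basis V S" using basis_ex assms(1) by blast
  have SV: "S \<subseteq> V" using S complex_vector.span_superset by (auto simp: is_basis_def)
  have indep: "\<not> cdependent (f ` S)"
  proof (rule complex_vector.independent_if_scalars_zero)
    show "finite (f ` S)" using S by (simp add: is_basis_def)
    fix g b assume 0: "(\<Sum>x\<in>f ` S. g x *\<^sub>C x) = 0" and b: "b \<in> f ` S"
    have inj: "inj_on f S" using assms(3) SV inj_on_subset by blast
    have "f (\<Sum>x\<in>S. g (f x) *\<^sub>C x) = (\<Sum>x\<in>S. g (f x) *\<^sub>C f x)"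
      using SV sub
      by (subst linear_on_sum[OF assms(2) sub])
        (auto simp: csub linear_on_scale[OF assms(2)] subset_iff intro!: sum.cong)
    also have "\<dots> = 0" using 0 by (simp add: sum.reindex[OF inj])
    finally have "f (\<Sum>x\<in>S. g (f x) *\<^sub>C x) = f 0"
      using linear_on_zero[OF assms(2) sub] by simp
    moreover have "(\<Sum>x\<in>S. g (f x) *\<^sub>C x) \<in> V"
      using SV sub by (auto simp: csub subset_iff)
    ultimately have "(\<Sum>x\<in>S. g (f x) *\<^sub>C x) = 0"
      using inj_onD[OF assms(3)] sub by (simp add: csub)
    then have "g (f x) = 0" if "x \<in> S" for x
      using complex_vector.independentD[of S S "\<lambda>x. g (f x)" x] S that by (simp add: is_basis_def)
    then show "g b = 0" using b by blast
  qed
  have "card (f ` S) = card S"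
    using card_image assms(3) SV inj_on_subset by blast
  moreover have "complex_vector.dim (f ` V) \<ge> card (f ` S)"
  proof -
    obtain T where T: "is_basis (f ` V) T"
      using basis_ex finite_dim_subset[OF assms(1) csf] \<open>f ` V \<subset> V\<close> by blast
    have "f ` S \<subseteq> cspan T" using T SV by (auto simp: is_basis_def)
    then have "card (f ` S) \<le> card T"
      using complex_vector.independent_span_bound[OF _ indep, of T] T by (simp add: is_basis_def)
    then show ?thesis
      using basis_dim[OF T] by simp
  qed
  moreover have "complex_vector.dim V = card S"
    using basis_dim[OF S] by simp
  ultimately show False using dim_less[OF assms(1) csf \<open>f ` V \<subset> V\<close>] by simp
qed

text \<open>The image of a basis spans \<open>V\<close> and has at most \<open>card S\<close>
  elements, so it is again a basis and no two elements of \<open>S\<close> are identified. The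
  coordinates of a kernel vector then form a relation in the image basis.\<close>

lemma surj_imp_inj_on:
  assumes V: "finite_dim V" and f: "linear_on V V f" "f ` V = V"
  shows "inj_on f V"
proof -
  note sub = finite_dim_subspace[OF V]
  obtain S where S: "is_basis V S" using basis_ex V by blast
  have SV: "S \<subseteq> V" using S complex_vector.span_superset by (auto simp: is_basis_def)
  have fS: "cspan (f ` S) = V"
  proof
    show "cspan (f ` S) \<subseteq> V"
      using SV linear_on_mem[OF f(1)] by (intro complex_vector.span_minimal sub) auto
    have "f x \<in> cspan (f ` S)" if "x \<in> V" for x
      by (rule linear_on_span_subset[OF f(1) sub complex_vector.subspace_span SV])
        (use that S in \<open>auto simp: is_basis_def intro: complex_vector.span_base\<close>)
    then show "V \<subseteq> cspan (f ` S)" by (metis f(2) image_subsetI)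
  qed
  have card: "card S \<le> card (f ` S)"
    using complex_vector.independent_span_bound[of "f ` S" S] S SV fS
    by (simp add: is_basis_def)
  then have injS: "inj_on f S" "card (f ` S) = card S"
    using card_image_le[of S f] eq_card_imp_inj_on[of S f] S by (auto simp: is_basis_def)
  obtain T where T: "T \<subseteq> f ` S" "is_basis V T"
    using basis_within[OF V fS] .
  have "card S \<le> card T"
    using complex_vector.independent_span_bound[of T S] S SV T by (simp add: is_basis_def)
  then have "T = f ` S"
    using T(1) injS S by (simp add: is_basis_def card_seteq)
  with T have indep: "\<not> cdependent (f ` S)" by (simp add: is_basis_def)
  show ?thesis
  proof (rule linear_on_inj[OF f(1) sub])
    fix x assume x: "x \<in> V" "f x = 0"
    let ?r = "complex_vector.representation S x"
    have xs: "(\<Sum>b\<in>S. ?r b *\<^sub>C b) = x"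
      using complex_vector.sum_representation_eq[of S x S] x S by (simp add: is_basis_def)
    have "0 = f (\<Sum>b\<in>S. ?r b *\<^sub>C b)" using xs x by simp
    also have "\<dots> = (\<Sum>b\<in>S. ?r b *\<^sub>C f b)"
      using SV sub
      by (subst linear_on_sum[OF f(1) sub])
        (auto simp: csub linear_on_scale[OF f(1)] subset_iff intro!: sum.cong)
    also have "\<dots> = (\<Sum>y\<in>f ` S. ?r (the_inv_into S f y) *\<^sub>C y)"
      by (subst sum.reindex[OF injS(1)]) (simp add: the_inv_into_f_f[OF injS(1)])
    finally have "?r (the_inv_into S f y) = 0" if "y \<in> f ` S" for y
      using complex_vector.independentD[OF indep, of "f ` S" "\<lambda>y. ?r (the_inv_into S f y)"] that S
      by (simp add: is_basis_def)
    then have "?r b = 0" if "b \<in> S" for b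
      using that the_inv_into_f_f[OF injS(1)] by force
    then show "x = 0" using xs by simp
  qed
qed

section \<open>The trace\<close>

text \<open>The carrier is implicit: it is the span of the basis \<open>S\<close>. For linear maps
  the value depends only on that span, by \<open>trace_indep\<close>.\<close>

definition trace_on :: "'b::complex_vector set \<Rightarrow> ('b \<Rightarrow> 'b) \<Rightarrow> complex" where
  "trace_on S f = (\<Sum>b\<in>S. complex_vector.representation S (f b) b)"

lemma basis_sum:
  assumes "is_basis V S" "v \<in> V"
  shows "(\<Sum>b\<in>S. complex_vector.representation S v b *\<^sub>C b) = v"
  using complex_vector.sum_representation_eq[of S v S] assms by (simp add: is_basis_def)

lemma linear_on_basis_expand:
  assumes S: "is_basis V S" and f: "linear_on V Y f" and v: "v \<in> V"
  shows "f v = (\<Sum>b\<in>S. complex_vector.representation S v b *\<^sub>C f b)"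
proof -
  have sub: "csubspace V" and SV: "S \<subseteq> V"
    using S complex_vector.span_superset by (auto simp: is_basis_def)
  have "f v = f (\<Sum>b\<in>S. complex_vector.representation S v b *\<^sub>C b)"
    using basis_sum[OF S v] by simp
  also have "\<dots> = (\<Sum>b\<in>S. complex_vector.representation S v b *\<^sub>C f b)"
    using SV sub
    by (subst linear_on_sum[OF f sub])
      (auto simp: csub linear_on_scale[OF f] subset_iff intro!: sum.cong)
  finally show ?thesis .
qed

lemma representation_linear:
  assumes "is_basis V S"
  shows "linear_on V UNIV (\<lambda>v. complex_vector.representation S v b)"
  using assms
  by (auto simp: is_basis_def linear_on_def scaleC_complex_def
      complex_vector.representation_add complex_vector.representation_scale)

lemma basis_mem: "\<lbrakk>is_basis V S; b \<in> S\<rbrakk> \<Longrightarrow> b \<in> V"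
  using complex_vector.span_base by (auto simp: is_basis_def)

lemma trace_comp:
  assumes S: "is_basis V S" and g: "linear_on V V g" and f: "linear_on V V f"
  shows "trace_on S (\<lambda>x. f (g x)) =
    (\<Sum>b\<in>S. \<Sum>c\<in>S. complex_vector.representation S (g b) c * complex_vector.representation S (f c) b)"
  unfolding trace_on_def
proof (rule sum.cong[OF refl])
  fix b assume "b \<in> S"
  then have "g b \<in> V" using S g basis_mem linear_on_mem by blast
  then show "complex_vector.representation S (f (g b)) b =
      (\<Sum>c\<in>S. complex_vector.representation S (g b) c * complex_vector.representation S (f c) b)"
    using linear_on_basis_expand[OF S linear_on_comp[OF f representation_linear[OF S]]]
    by (simp add: scaleC_complex_def)
qed

lemma trace_commute:
  assumes "is_basis V S" "linear_on V V f" "linear_on V V g"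
  shows "trace_on S (\<lambda>x. f (g x)) = trace_on S (\<lambda>x. g (f x))"
  unfolding trace_comp[OF assms(1,3,2)] trace_comp[OF assms]
  by (subst sum.swap) (simp add: mult.commute)

text \<open>Both sides are the trace of a product of the same two matrices with the factors
  exchanged: the coordinates of \<open>S\<close> in \<open>T\<close>, and the coordinates of
  \<open>f\<close> of \<open>T\<close> in \<open>S\<close>.\<close>

lemma trace_indep:
  assumes S: "is_basis V S" and T: "is_basis V T" and f: "linear_on V V f"
  shows "trace_on S f = trace_on T f"
proof -
  let ?s = "complex_vector.representation S" and ?t = "complex_vector.representation T"
  have "trace_on S f = (\<Sum>b\<in>S. \<Sum>c\<in>T. ?t b c * ?s (f c) b)"
    unfolding trace_on_def
    using linear_on_basis_expand[OF T linear_on_comp[OF f representation_linear[OF S]]] S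
    by (auto simp: scaleC_complex_def basis_mem intro!: sum.cong)
  also have "\<dots> = (\<Sum>c\<in>T. \<Sum>b\<in>S. ?s (f c) b * ?t b c)"
    by (subst sum.swap) (simp add: mult.commute)
  also have "\<dots> = trace_on T f"
    unfolding trace_on_def
    using linear_on_basis_expand[OF S representation_linear[OF T]] T f
    by (auto simp: scaleC_complex_def basis_mem linear_on_mem intro!: sum.cong)
  finally show ?thesis .
qed

lemma trace_add:
  assumes "is_basis V S" "linear_on V V f" "linear_on V V g"
  shows "trace_on S (\<lambda>x. f x + g x) = trace_on S f + trace_on S g"
  using assms linear_on_add[OF representation_linear[OF assms(1)]]
  by (simp add: trace_on_def sum.distrib basis_mem linear_on_mem)

lemma trace_scale:
  assumes "is_basis V S" "linear_on V V f"
  shows "trace_on S (\<lambda>x. c *\<^sub>C f x) = c * trace_on S f"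
  using assms linear_on_scale[OF representation_linear[OF assms(1)]]
  by (simp add: trace_on_def sum_distrib_left basis_mem linear_on_mem scaleC_complex_def)

lemma basis_subspace: "is_basis V S \<Longrightarrow> csubspace V"
  by (auto simp: is_basis_def)

lemma trace_diff:
  assumes "is_basis V S" "linear_on V V f" "linear_on V V g"
  shows "trace_on S (\<lambda>x. f x - g x) = trace_on S f - trace_on S g"
  using assms linear_on_diff[OF representation_linear[OF assms(1)]]
  by (simp add: trace_on_def sum_subtractf basis_mem linear_on_mem basis_subspace)

lemma trace_sum:
  assumes "is_basis V S" "\<And>i. i \<in> I \<Longrightarrow> linear_on V V (f i)"
  shows "trace_on S (\<lambda>x. \<Sum>i\<in>I. f i x) = (\<Sum>i\<in>I. trace_on S (f i))"
proof -
  have "trace_on S (\<lambda>x. \<Sum>i\<in>I. f i x) =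
      (\<Sum>b\<in>S. \<Sum>i\<in>I. complex_vector.representation S (f i b) b)"
    unfolding trace_on_def
    using assms
    by (intro sum.cong[OF refl] linear_on_sum[OF representation_linear[OF assms(1)]])
      (auto simp: basis_subspace intro: basis_mem linear_on_mem)
  also have "\<dots> = (\<Sum>i\<in>I. trace_on S (f i))"
    unfolding trace_on_def by (rule sum.swap)
  finally show ?thesis .
qed

lemma trace_cong:
  assumes "is_basis V S" "\<And>x. x \<in> V \<Longrightarrow> f x = g x"
  shows "trace_on S f = trace_on S g"
  using assms by (auto simp: trace_on_def basis_mem intro!: sum.cong)

lemma representation_subspace_zero:
  assumes "is_basis V T" "S \<subseteq> T" "is_basis U S" "u \<in> U" "b \<in> T" "b \<notin> S"
  shows "complex_vector.representation T u b = 0"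
proof -
  have "u \<in> cspan S" using assms(3,4) by (simp add: is_basis_def)
  then show ?thesis
    using assms complex_vector.representation_extend[of T u S]
      complex_vector.representation_ne_zero[of S u b] by (auto simp: is_basis_def)
qed

text \<open>In a basis of \<open>V\<close> that extends one of \<open>U\<close>, the added vectors
  contribute nothing: their images lie in \<open>U\<close> and have no coordinate along
  them.\<close>

lemma trace_range:
  assumes V: "is_basis V T" and f: "linear_on V V f" and U: "csubspace U" "U \<subseteq> V" "f ` V \<subseteq> U"
    and S: "is_basis U S"
  shows "trace_on T f = trace_on S f"
proof -
  note fd = basis_finite_dim[OF V]
  obtain S' T' where ST: "S' \<subseteq> T'" "is_basis U S'" "is_basis V T'"
    using basis_extend_subspace[OF fd U(1,2)] .
  have fU: "linear_on U U f" using linear_on_subset[OF f U(2)] U by blast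
  have "trace_on T f = (\<Sum>b\<in>T'. complex_vector.representation T' (f b) b)"
    using trace_indep[OF V ST(3) f] by (simp add: trace_on_def)
  also have "\<dots> = (\<Sum>b\<in>S'. complex_vector.representation T' (f b) b)"
  proof (rule sum.mono_neutral_right)
    show "finite T'" using ST by (simp add: is_basis_def)
    show "\<forall>b\<in>T' - S'. complex_vector.representation T' (f b) b = 0"
      using representation_subspace_zero[OF ST(3,1,2)] U(3) basis_mem[OF ST(3)] by blast
  qed (fact ST)
  also have "\<dots> = trace_on S' f"
    unfolding trace_on_def
  proof (rule sum.cong[OF refl])
    fix b assume "b \<in> S'"
    then have "f b \<in> cspan S'"
      using ST basis_mem[OF ST(2)] U is_basis_def by (metis image_subset_iff subset_iff)
    then show "complex_vector.representation T' (f b) b = complex_vector.representation S' (f b) b"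
      using complex_vector.representation_extend[of T' "f b" S'] ST
      by (simp add: is_basis_def)
  qed
  also have "\<dots> = trace_on S f"
    using trace_indep[OF ST(2) S fU] .
  finally show ?thesis .
qed

lemma trace_id: "is_basis V S \<Longrightarrow> (\<And>x. x \<in> V \<Longrightarrow> f x = x) \<Longrightarrow> trace_on S f = of_nat (card S)"
  by (simp add: trace_on_def basis_mem is_basis_def complex_vector.representation_basis
      cong: sum.cong)

lemma trace_zero: "is_basis V S \<Longrightarrow> (\<And>x. x \<in> V \<Longrightarrow> f x = 0) \<Longrightarrow> trace_on S f = 0"
  by (simp add: trace_on_def basis_mem complex_vector.representation_zero cong: sum.cong)

text \<open>Induction on the dimension, replacing \<open>V\<close> by the image of \<open>f\<close>,
  which carries the whole trace. If the image is all of \<open>V\<close>, then \<open>f\<close> is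
  injective and nilpotency leaves only the zero space.\<close>

lemma trace_nilpotent:
  assumes "is_basis V S" "linear_on V V f" "\<And>x. x \<in> V \<Longrightarrow> \<exists>k. (f ^^ k) x = 0"
  shows "trace_on S f = 0"
  using assms
proof (induction "complex_vector.dim V" arbitrary: V S rule: less_induct)
  case less
  note sub = basis_subspace[OF less.prems(1)]
  note fd = basis_finite_dim[OF less.prems(1)]
  show ?case
  proof (cases "f ` V = V")
    case True
    have inj: "inj_on f V" using surj_imp_inj_on[OF fd less.prems(2) True] .
    have "x = 0" if "x \<in> V" "(f ^^ k) x = 0" for k x
      using that
    proof (induction k arbitrary: x)
      case (Suc k)
      have "(f ^^ k) (f x) = 0" using Suc.prems(2) by (simp add: funpow_swap1)
      then have "f x = 0" using Suc linear_on_mem[OF less.prems(2)] by blast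
      then show ?case
        using inj Suc.prems(1) linear_on_zero[OF less.prems(2) sub] sub
        by (metis complex_vector.subspace_0 inj_onD)
    qed simp
    then have "x = 0" if "x \<in> V" for x using less.prems(3) that by blast
    then show ?thesis
      using trace_zero[OF less.prems(1)] linear_on_mem[OF less.prems(2)] by blast
  next
    case False
    let ?U = "f ` V"
    have U: "csubspace ?U" "?U \<subset> V"
      using linear_on_image_subspace[OF less.prems(2) sub] False linear_on_mem[OF less.prems(2)]
      by blast+
    obtain S' where S': "is_basis ?U S'"
      using basis_ex finite_dim_subset[OF fd U(1)] U(2) by blast
    have "linear_on ?U ?U f"
      using U(2) by (intro linear_on_subset[OF less.prems(2)]) auto
    then have "trace_on S' f = 0"
      using less.hyps[OF dim_less[OF fd U] S'] less.prems(3) U(2) by blast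
    then show ?thesis
      using trace_range[OF less.prems(1,2) U(1) _ _ S'] U(2) by auto
  qed
qed

section \<open>Generalized eigenspaces\<close>

definition poly_map :: "complex poly \<Rightarrow> ('b::complex_vector \<Rightarrow> 'b) \<Rightarrow> 'b \<Rightarrow> 'b" where
  "poly_map p f v = (\<Sum>i\<le>degree p. poly.coeff p i *\<^sub>C (f ^^ i) v)"

lemma poly_map_bound:
  assumes "degree p \<le> n"
  shows "poly_map p f v = (\<Sum>i\<le>n. poly.coeff p i *\<^sub>C (f ^^ i) v)"
  unfolding poly_map_def
  by (rule sum.mono_neutral_left) (use assms in \<open>auto simp: coeff_eq_0\<close>)

lemma poly_map_pCons:
  assumes "linear_on V V f" "csubspace V" "v \<in> V"
  shows "poly_map (pCons a p) f v = a *\<^sub>C v + f (poly_map p f v)"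
proof -
  have mem: "(f ^^ i) v \<in> V" for i
    using linear_on_mem[OF linear_on_funpow[OF assms(1)] assms(3)] .
  have "poly_map (pCons a p) f v =
      (\<Sum>i\<le>Suc (degree p). poly.coeff (pCons a p) i *\<^sub>C (f ^^ i) v)"
    by (rule poly_map_bound) (rule degree_pCons_le)
  also have "\<dots> = a *\<^sub>C v + (\<Sum>i\<le>degree p. poly.coeff p i *\<^sub>C f ((f ^^ i) v))"
    by (simp add: sum.atMost_Suc_shift del: sum.atMost_Suc)
  also have "(\<Sum>i\<le>degree p. poly.coeff p i *\<^sub>C f ((f ^^ i) v)) = f (poly_map p f v)"
    unfolding poly_map_def
    using mem assms
    by (subst linear_on_sum[OF assms(1,2)]) (auto simp: csub linear_on_scale[OF assms(1)])
  finally show ?thesis .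
qed

lemma poly_map_0 [simp]: "poly_map 0 f v = 0"
  by (simp add: poly_map_def)

lemma poly_map_add: "poly_map (p + q) f v = poly_map p f v + poly_map q f v"
  using poly_map_bound[of "p + q" "max (degree p) (degree q)" f v]
    poly_map_bound[of p "max (degree p) (degree q)" f v]
    poly_map_bound[of q "max (degree p) (degree q)" f v]
  by (simp add: degree_add_le_max scaleC_add_left sum.distrib)

lemma poly_map_smult: "poly_map (Polynomial.smult c p) f v = c *\<^sub>C poly_map p f v"
  by (cases "c = 0")
    (auto simp: poly_map_def complex_vector.scale_sum_right scaleC_scaleC)

lemma poly_map_mem:
  assumes "linear_on V V f" "csubspace V" "v \<in> V"
  shows "poly_map p f v \<in> V"
proof -
  have mem: "(f ^^ i) v \<in> V" for i
    using linear_on_mem[OF linear_on_funpow[OF assms(1)] assms(3)] .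
  then show ?thesis
    using assms by (simp add: poly_map_def csub)
qed

lemma poly_map_linear_factor:
  assumes "linear_on V V f" "csubspace V" "v \<in> V"
  shows "poly_map ([:- z, 1:] * p) f v = f (poly_map p f v) - z *\<^sub>C poly_map p f v"
  using assms
  by (simp add: poly_map_add poly_map_smult poly_map_pCons[OF assms] del: smult_minus_left)

text \<open>Split off linear factors of \<open>p\<close> one at a time. The last nonzero vector met
  before the product annihilates \<open>v\<close> is an eigenvector.\<close>

lemma eigenvector_of_annihilator:
  assumes f: "linear_on V V f" "csubspace V" and v: "v \<in> V" "v \<noteq> 0"
    and p: "p \<noteq> 0" "poly_map p f v = 0"
  shows "\<exists>w z. w \<in> V \<and> w \<noteq> 0 \<and> f w = z *\<^sub>C w"
  using p
proof (induction "degree p" arbitrary: p)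
  case 0
  then obtain c where "p = [:c:]" using degree_eq_zeroE by metis
  with 0 v show ?case by (simp add: poly_map_def)
next
  case (Suc n)
  obtain z where "poly p z = 0"
    using fundamental_theorem_of_algebra[of p] Suc.hyps(2)
    by (auto simp: constant_degree)
  then obtain q where q: "p = [:- z, 1:] * q"
    using poly_eq_0_iff_dvd dvdE by metis
  show ?case
  proof (cases "poly_map q f v = 0")
    case True
    have "q \<noteq> 0" using q Suc.prems by auto
    moreover have "n = degree q"
      using Suc.hyps(2) q \<open>q \<noteq> 0\<close> by (simp add: degree_mult_eq del: mult_pCons_left)
    ultimately show ?thesis using Suc.hyps(1) True by blast
  next
    case False
    have "f (poly_map q f v) = z *\<^sub>C poly_map q f v"
      using Suc.prems(2) poly_map_linear_factor[OF f v(1)] q by auto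
    then show ?thesis
      using False poly_map_mem[OF f v(1)] by blast
  qed
qed

text \<open>The first \<open>card S + 1\<close> iterates of \<open>v\<close> cannot be independent.
  Dependence is a notion for sets, so the case of two equal iterates is separate and uses a
  difference of monomials.\<close>

lemma annihilator_ex:
  assumes V: "finite_dim V" and f: "linear_on V V f" and v: "v \<in> V"
  shows "\<exists>p. p \<noteq> 0 \<and> poly_map p f v = 0"
proof -
  let ?x = "\<lambda>i. (f ^^ i) v"
  have mem: "?x i \<in> V" for i
    using linear_on_mem[OF linear_on_funpow[OF f] v] .
  obtain S where S: "is_basis V S" using basis_ex[OF V] by blast
  let ?n = "card S"
  show ?thesis
  proof (cases "inj_on ?x {..?n}")
    case False
    then obtain i j where ij: "i \<noteq> j" "?x i = ?x j" by (auto simp: inj_on_def)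
    let ?p = "Polynomial.monom 1 i - Polynomial.monom (1::complex) j"
    have "?p \<noteq> 0"
      using ij(1) by (metis coeff_monom eq_iff_diff_eq_0 zero_neq_one)
    moreover have "poly_map ?p f v = 0"
    proof -
      have m: "poly_map (Polynomial.monom c k) f v = c *\<^sub>C ?x k" for c k
        using poly_map_bound[of "Polynomial.monom c k" k f v]
        by (simp add: degree_monom_le if_distrib[of "\<lambda>c. c *\<^sub>C _"] sum.delta cong: if_cong)
      have "poly_map ?p f v = poly_map (Polynomial.monom 1 i + Polynomial.monom (-1) j) f v"
        by (simp flip: minus_monom)
      also have "\<dots> = 0" using ij by (simp add: poly_map_add m scaleC_one)
      finally show ?thesis .
    qed
    ultimately show ?thesis by blast
  next
    case True
    have "cdependent (?x ` {..?n})"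
    proof (rule ccontr)
      assume "\<not> cdependent (?x ` {..?n})"
      then have "card (?x ` {..?n}) \<le> card S"
        using complex_vector.independent_span_bound[of S "?x ` {..?n}"] S mem
        by (auto simp: is_basis_def)
      then show False using card_image[OF True] by simp
    qed
    then obtain t u where t: "finite t" "t \<subseteq> ?x ` {..?n}" "(\<Sum>w\<in>t. u w *\<^sub>C w) = 0"
      and ne: "\<exists>w\<in>t. u w \<noteq> 0"
      unfolding complex_vector.dependent_explicit by auto
    let ?c = "\<lambda>i. if ?x i \<in> t then u (?x i) else 0"
    define p where "p = (\<Sum>i\<le>?n. Polynomial.monom (if ?x i \<in> t then u (?x i) else 0) i)"
    have cp: "poly.coeff p i = (if i \<le> ?n then ?c i else 0)" for i
      unfolding p_def by (simp add: coeff_sum)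
    have "degree p \<le> ?n" by (rule degree_le) (simp add: cp)
    then have "poly_map p f v = (\<Sum>i\<le>?n. ?c i *\<^sub>C ?x i)"
      using poly_map_bound[of p ?n f v] cp by simp
    also have "\<dots> = (\<Sum>w\<in>?x ` {..?n}. (if w \<in> t then u w else 0) *\<^sub>C w)"
      by (simp add: sum.reindex[OF True])
    also have "\<dots> = (\<Sum>w\<in>t. u w *\<^sub>C w)"
      by (rule sum.mono_neutral_cong_right) (use t in auto)
    finally have "poly_map p f v = 0" using t by simp
    moreover have "p \<noteq> 0"
    proof -
      obtain i where "i \<le> ?n" "?x i \<in> t" "u (?x i) \<noteq> 0" using ne t(2) by blast
      then have "poly.coeff p i \<noteq> 0" by (simp add: cp)
      then show ?thesis by auto
    qed
    ultimately show ?thesis by blast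
  qed
qed

lemma eigenvector_ex:
  assumes "finite_dim V" "V \<noteq> {0}" "linear_on V V f"
  shows "\<exists>w z. w \<in> V \<and> w \<noteq> 0 \<and> f w = z *\<^sub>C w"
proof -
  have sub: "csubspace V" using assms(1) finite_dim_subspace by blast
  then obtain v where v: "v \<in> V" "v \<noteq> 0"
    using assms(2) complex_vector.subspace_0 by blast
  then show ?thesis
    using annihilator_ex[OF assms(1,3)] eigenvector_of_annihilator[OF assms(3) sub] by blast
qed

definition shift :: "('b::complex_vector \<Rightarrow> 'b) \<Rightarrow> complex \<Rightarrow> 'b \<Rightarrow> 'b" where
  "shift f z v = f v - z *\<^sub>C v"

definition gen_eigenspace :: "'b::complex_vector set \<Rightarrow> ('b \<Rightarrow> 'b) \<Rightarrow> complex \<Rightarrow> 'b set" where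
  "gen_eigenspace V f z = {v \<in> V. \<exists>k. (shift f z ^^ k) v = 0}"

lemma linear_on_shift:
  assumes "linear_on V V f" "csubspace V"
  shows "linear_on V V (shift f z)"
  unfolding shift_def
  using assms by (intro linear_on_combine(2)) (auto simp: linear_on_def csub algebra_simps
      scaleC_add_right scaleC_scaleC)

lemma shift_commute:
  assumes "linear_on V V f" "csubspace V" "v \<in> V"
  shows "shift f z (shift f w v) = shift f w (shift f z v)"
  using assms
  by (simp add: shift_def linear_on_diff[OF assms(1,2)] linear_on_scale[OF assms(1)]
      linear_on_mem[OF assms(1)] csub complex_vector.scale_right_diff_distrib scaleC_scaleC
      mult.commute)

lemma funpow_kernel_subspace:
  assumes g: "linear_on V V g" "csubspace V"
  shows "csubspace {v \<in> V. \<exists>k. (g ^^ k) v = 0}"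
proof -
  have later: "(g ^^ (k + l)) v = 0" if "(g ^^ k) v = 0" for k l v
    using that linear_on_zero[OF linear_on_funpow[OF g(1)] g(2), of l]
    by (metis add.commute comp_apply funpow_add)
  show ?thesis
    unfolding complex_vector.subspace_def
  proof (intro conjI ballI allI)
    show "0 \<in> {v \<in> V. \<exists>k. (g ^^ k) v = 0}"
      using g(2) by (auto simp: csub intro: exI[of _ 0])
  next
    fix x y assume xy: "x \<in> {v \<in> V. \<exists>k. (g ^^ k) v = 0}" "y \<in> {v \<in> V. \<exists>k. (g ^^ k) v = 0}"
    then obtain k l where "(g ^^ k) x = 0" "(g ^^ l) y = 0" by auto
    then have "(g ^^ (k + l)) x = 0" "(g ^^ (k + l)) y = 0"
      using later[of k x l] later[of l y k] by (auto simp: add.commute)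
    then have "(g ^^ (k + l)) (x + y) = 0"
      using linear_on_add[OF linear_on_funpow[OF g(1)]] xy by simp
    then show "x + y \<in> {v \<in> V. \<exists>k. (g ^^ k) v = 0}"
      using xy g(2) by (auto simp: csub)
  next
    fix c x assume "x \<in> {v \<in> V. \<exists>k. (g ^^ k) v = 0}"
    then show "c *\<^sub>C x \<in> {v \<in> V. \<exists>k. (g ^^ k) v = 0}"
      using g(2) linear_on_scale[OF linear_on_funpow[OF g(1)]] by (force simp: csub)
  qed
qed

lemma gen_eigenspace_subspace:
  "\<lbrakk>linear_on V V f; csubspace V\<rbrakk> \<Longrightarrow> csubspace (gen_eigenspace V f z)"
  unfolding gen_eigenspace_def by (rule funpow_kernel_subspace[OF linear_on_shift])

lemma shift_pow_commute:
  assumes "linear_on V V f" "csubspace V" "v \<in> V"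
  shows "(shift f z ^^ k) (shift f w v) = shift f w ((shift f z ^^ k) v)"
  using assms(3)
proof (induction k)
  case (Suc k)
  then show ?case
    using shift_commute[OF assms(1,2), of "(shift f z ^^ k) v" z w]
      linear_on_mem[OF linear_on_funpow[OF linear_on_shift[OF assms(1,2)]], of v k z]
    by simp
qed simp

lemma shift_gen_eigenspace:
  assumes f: "linear_on V V f" "csubspace V" and v: "v \<in> gen_eigenspace V f z"
  shows "shift f w v \<in> gen_eigenspace V f z"
proof -
  obtain k where k: "v \<in> V" "(shift f z ^^ k) v = 0"
    using v by (auto simp: gen_eigenspace_def)
  then have "(shift f z ^^ k) (shift f w v) = 0"
    using shift_pow_commute[OF f k(1)] linear_on_zero[OF linear_on_shift[OF f] f(2)] by simp
  then show ?thesis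
    using linear_on_mem[OF linear_on_shift[OF f] k(1)] by (auto simp: gen_eigenspace_def)
qed

lemma shift_inj_gen_eigenspace:
  assumes f: "linear_on V V f" "csubspace V" and v: "v \<in> gen_eigenspace V f z"
    and w: "w \<noteq> z" "shift f w v = 0"
  shows "v = 0"
proof -
  have fv: "f v = w *\<^sub>C v" using w(2) by (simp add: shift_def)
  have vV: "v \<in> V" using v by (simp add: gen_eigenspace_def)
  have "(shift f z ^^ k) v = ((w - z) ^ k) *\<^sub>C v" for k :: nat
  proof (induction k)
    case 0
    then show ?case by (simp add: scaleC_one)
  next
    case (Suc k)
    then show ?case
      using linear_on_scale[OF f(1) vV]
      by (simp add: shift_def fv scaleC_scaleC algebra_simps complex_vector.scale_left_diff_distrib)
  qed
  then show ?thesis using v w(1) by (auto simp: gen_eigenspace_def)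
qed

lemma gen_eigenspace_pow_zero_inj:
  assumes f: "linear_on V V f" "csubspace V" and v: "v \<in> gen_eigenspace V f z"
    and w: "w \<noteq> (z::complex)" "(shift f w ^^ k) v = 0"
  shows "v = 0"
  using v w(2)
proof (induction k arbitrary: v)
  case (Suc k)
  then have "shift f w v = 0"
    using shift_gen_eigenspace[OF f] by (metis comp_apply funpow_Suc_right)
  then show ?case using shift_inj_gen_eigenspace[OF f] Suc.prems(1) w(1) by blast
qed simp

text \<open>A power of \<open>shift f y\<close> that kills \<open>w y\<close> preserves the other
  generalized eigenspaces and is injective on them, so the induction hypothesis applies to the
  images of the remaining summands.\<close>

lemma gen_eigenspaces_independent:
  assumes f: "linear_on V V f" "csubspace V" and "finite Z"
    and "\<And>z. z \<in> Z \<Longrightarrow> w z \<in> gen_eigenspace V f z" and "(\<Sum>z\<in>Z. w z) = 0" and "z \<in> Z"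
  shows "w z = 0"
  using assms(3-)
proof (induction Z arbitrary: w z rule: finite_induct)
  case (insert y Z)
  obtain k where k: "(shift f y ^^ k) (w y) = 0"
    using insert.prems(1)[of y] by (auto simp: gen_eigenspace_def)
  let ?g = "shift f y ^^ k"
  have g: "linear_on V V ?g" using linear_on_funpow[OF linear_on_shift[OF f]] .
  have wV: "w x \<in> V" if "x \<in> insert y Z" for x
    using insert.prems(1)[OF that] by (simp add: gen_eigenspace_def)
  have gw: "?g (w x) \<in> gen_eigenspace V f x" if "x \<in> Z" for x
  proof -
    have "(shift f y ^^ j) (w x) \<in> gen_eigenspace V f x" for j
      by (induction j) (use insert.prems(1)[of x] that shift_gen_eigenspace[OF f] in auto)
    then show ?thesis .
  qed
  have "0 = ?g (\<Sum>x\<in>insert y Z. w x)"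
    using insert.prems(2) linear_on_zero[OF g f(2)] by simp
  also have "\<dots> = (\<Sum>x\<in>insert y Z. ?g (w x))"
    using linear_on_sum[OF g f(2)] wV by blast
  also have "\<dots> = (\<Sum>x\<in>Z. ?g (w x))" using insert.hyps k by simp
  finally have gz: "?g (w x) = 0" if "x \<in> Z" for x
    using insert.IH[of "\<lambda>x. ?g (w x)" x] gw that by simp
  have wz: "w x = 0" if "x \<in> Z" for x
    using gen_eigenspace_pow_zero_inj[OF f insert.prems(1)[of x], of y k] insert.hyps(2) gz that
    by auto
  then have "w y = 0" using insert.prems(2) insert.hyps by simp
  then show ?case using wz insert.prems(3) by blast
qed simp

lemma gen_eigenspaces_span:
  assumes "finite_dim V" "linear_on V V f"
  shows "cspan (\<Union>z. gen_eigenspace V f z) = V"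
  using assms
proof (induction "complex_vector.dim V" arbitrary: V rule: less_induct)
  case less
  note sub = finite_dim_subspace[OF less.prems(1)]
  note f = less.prems(2)
  let ?G = "cspan (\<Union>z. gen_eigenspace V f z)"
  have GV: "?G \<subseteq> V"
    by (rule complex_vector.span_minimal) (auto simp: gen_eigenspace_def sub)
  show ?case
  proof (cases "V = {0}")
    case True
    then show ?thesis using GV complex_vector.span_zero by blast
  next
    case False
    obtain e z where e: "e \<in> V" "e \<noteq> 0" "f e = z *\<^sub>C e"
      using eigenvector_ex[OF less.prems(1) False f] by blast
    let ?s = "shift f z"
    have s: "linear_on V V ?s" using linear_on_shift[OF f sub] .
    let ?W = "?s ` V"
    have W: "csubspace ?W" "?W \<subseteq> V"
      using linear_on_image_subspace[OF s sub] linear_on_mem[OF s] by auto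
    have "?W \<noteq> V"
    proof
      assume "?W = V"
      then have "inj_on ?s V" using surj_imp_inj_on[OF less.prems(1) s] by blast
      moreover have "?s e = ?s 0" using e linear_on_zero[OF s sub] by (simp add: shift_def)
      ultimately show False using e sub by (meson complex_vector.subspace_0 inj_onD)
    qed
    then have WV: "?W \<subset> V" using W by blast
    have fW: "linear_on ?W ?W f"
    proof (rule linear_on_subset[OF f W(2)])
      fix x assume "x \<in> ?W"
      then obtain v where v: "v \<in> V" "x = ?s v" by blast
      have "f x = ?s (f v)"
        using v by (simp add: shift_def linear_on_diff[OF f sub] linear_on_scale[OF f] csub sub
            linear_on_mem[OF f])
      then show "f x \<in> ?W" using linear_on_mem[OF f] v by blast
    qed
    have IH: "cspan (\<Union>y. gen_eigenspace ?W f y) = ?W"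
      using less.hyps[OF dim_less[OF less.prems(1) W(1) WV] finite_dim_subset[OF less.prems(1) W] fW] .
    have Ez: "csubspace (gen_eigenspace V f y)" for y
      using gen_eigenspace_subspace[OF f sub] .
    let ?P = "?s ` ?G + gen_eigenspace V f z"
    have sG: "csubspace (?s ` ?G)"
      by (rule linear_on_image_subspace[of _ V]) (use linear_on_subset[OF s GV] GV linear_on_mem[OF s] in auto)
    have "csubspace ?P" using subspace_plus[OF sG Ez] .
    moreover have "gen_eigenspace ?W f y \<subseteq> ?P" for y
    proof
      fix w assume "w \<in> gen_eigenspace ?W f y"
      then have w: "w \<in> gen_eigenspace V f y" using W by (auto simp: gen_eigenspace_def)
      show "w \<in> ?P"
      proof (cases "y = z")
        case True
        then show ?thesis using set_plus_intro[of 0 "?s ` ?G" w] w csub(3)[OF sG] by simp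
      next
        case False
        let ?E = "gen_eigenspace V f y"
        have EV: "?E \<subseteq> V" by (auto simp: gen_eigenspace_def)
        have sE: "linear_on ?E ?E ?s"
          using linear_on_subset[OF s EV] shift_gen_eigenspace[OF f sub] by blast
        have "?s ` ?E = ?E"
        proof (rule inj_imp_surj_on[OF _ sE])
          show "finite_dim ?E" using finite_dim_subset[OF less.prems(1) Ez EV] .
          show "inj_on ?s ?E"
            using linear_on_inj[OF sE Ez] shift_inj_gen_eigenspace[OF f sub] False by metis
        qed
        then obtain u where u: "u \<in> ?E" "?s u = w" using w by (metis imageE)
        have "u \<in> ?G" by (rule complex_vector.span_base) (use u(1) in blast)
        then have "w + 0 \<in> ?P" using u(2) csub(3)[OF Ez] by (intro set_plus_intro) auto
        then show ?thesis by simp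
      qed
    qed
    ultimately have WP: "?W \<subseteq> ?P"
      using IH complex_vector.span_minimal[of "\<Union>y. gen_eigenspace ?W f y" ?P] by blast
    have "v \<in> ?G" if v: "v \<in> V" for v
    proof -
      have "?s v \<in> ?P" using WP v by blast
      then obtain a e where ae: "?s v = a + e" "a \<in> ?s ` ?G" "e \<in> gen_eigenspace V f z"
        by (rule set_plus_elim)
      then obtain u where u: "u \<in> ?G" "a = ?s u" by blast
      have uV: "u \<in> V" using u(1) GV by blast
      have "?s (v - u) = e" using linear_on_diff[OF s sub v uV] ae(1) u(2) by simp
      then have "v - u \<in> gen_eigenspace V f z"
        using ae(3) csub(4)[OF sub v uV]
        unfolding gen_eigenspace_def by (auto intro: exI[of _ "Suc _"] simp: funpow_swap1)
      then have "v - u \<in> ?G" using complex_vector.span_base by blast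
      then show ?thesis using complex_vector.span_add[OF _ u(1)] by fastforce
    qed
    then show ?thesis using GV by blast
  qed
qed

text \<open>\<open>Y\<close> is prescribed on a basis of generalized eigenvectors; independence of
  the eigenspaces shows that the scalar is right on each whole eigenspace. The identity for
  \<open>g\<close> gives the semisimple part of \<open>f\<close>, and \<open>cnj\<close> its
  conjugate.\<close>

lemma gen_eigenspace_scalar_ex:
  assumes V: "finite_dim V" and f: "linear_on V V f"
  shows "\<exists>Y. linear_on V V Y \<and> (\<forall>z. \<forall>v\<in>gen_eigenspace V f z. Y v = g z *\<^sub>C v)"
proof -
  note sub = finite_dim_subspace[OF V]
  obtain S where S: "S \<subseteq> (\<Union>z. gen_eigenspace V f z)" "is_basis V S"
    using basis_within[OF V gen_eigenspaces_span[OF V f]] .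
  then have "\<forall>b\<in>S. \<exists>z. b \<in> gen_eigenspace V f z" by blast
  then obtain l where l: "\<And>b. b \<in> S \<Longrightarrow> b \<in> gen_eigenspace V f (l b)" by metis
  let ?r = "complex_vector.representation S"
  have fin: "finite S" using S(2) by (simp add: is_basis_def)
  have SV: "b \<in> V" if "b \<in> S" for b using basis_mem[OF S(2) that] .
  define Y where "Y v = (\<Sum>b\<in>S. ?r v b *\<^sub>C (g (l b) *\<^sub>C b))" for v
  have r: "linear_on V UNIV (\<lambda>v. ?r v b)" for b using representation_linear[OF S(2)] .
  have "linear_on V V Y"
  proof (rule linear_onI)
    fix x assume "x \<in> V"
    then show "Y x \<in> V" using sub SV by (simp add: Y_def csub)
  next
    fix x y assume "x \<in> V" "y \<in> V"
    then show "Y (x + y) = Y x + Y y"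
      by (simp add: Y_def linear_on_add[OF r] scaleC_add_left distrib_right sum.distrib)
  next
    fix c x assume "x \<in> V"
    then show "Y (c *\<^sub>C x) = c *\<^sub>C Y x"
      by (simp add: Y_def linear_on_scale[OF r] complex_vector.scale_sum_right scaleC_scaleC
          scaleC_complex_def mult.assoc)
  qed
  moreover have "Y v = g z *\<^sub>C v" if v: "v \<in> gen_eigenspace V f z" for z v
  proof -
    have vV: "v \<in> V" using v by (simp add: gen_eigenspace_def)
    let ?Z = "insert z (l ` S)"
    define w where "w y = (\<Sum>b\<in>{b \<in> S. l b = y}. ?r v b *\<^sub>C b)" for y
    have Ez: "csubspace (gen_eigenspace V f y)" for y
      using gen_eigenspace_subspace[OF f sub] .
    have wE: "w y \<in> gen_eigenspace V f y" for y
      unfolding w_def using l Ez by (auto intro!: csub)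
    have regroup: "(\<Sum>y\<in>?Z. \<Sum>b\<in>{b \<in> S. l b = y}. h b) = sum h S" for h :: "'a \<Rightarrow> 'a"
      using fin by (intro sum.group) auto
    have "(\<Sum>y\<in>?Z. w y) = v"
      unfolding w_def regroup using basis_sum[OF S(2) vV] .
    \<comment> \<open>Moving \<open>v\<close> into the summand of its own eigenvalue gives a
      vanishing sum, so independence yields \<open>w z = v\<close> and kills the other components.
      \<open>z\<close> is inserted into \<open>?Z\<close> because it need not be the eigenvalue of a
      basis vector.\<close>
    then have "(\<Sum>y\<in>?Z. (if y = z then w y - v else w y)) = 0"
      using fin by (subst (asm) sum.remove[of _ z], simp, simp)
        (subst sum.remove[of _ z], simp, simp, simp add: algebra_simps)
    then have w0: "(if y = z then w y - v else w y) = 0" if "y \<in> ?Z" for y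
      using gen_eigenspaces_independent[OF f sub, of ?Z "\<lambda>y. if y = z then w y - v else w y" y]
        that fin wE Ez v by (simp add: csub)
    have "Y v = (\<Sum>y\<in>?Z. \<Sum>b\<in>{b \<in> S. l b = y}. ?r v b *\<^sub>C (g (l b) *\<^sub>C b))"
      unfolding regroup Y_def ..
    also have "\<dots> = (\<Sum>y\<in>?Z. g y *\<^sub>C w y)"
      unfolding w_def complex_vector.scale_sum_right
      by (intro sum.cong) (auto simp: scaleC_scaleC mult.commute)
    also have "\<dots> = (\<Sum>y\<in>{z}. g y *\<^sub>C w y)"
    proof (rule sum.mono_neutral_right)
      show "\<forall>y\<in>?Z - {z}. g y *\<^sub>C w y = 0" using w0 by (metis DiffE complex_vector.scale_zero_right singletonI)
    qed (use fin in auto)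
    also have "\<dots> = g z *\<^sub>C v" using w0[of z] by simp
    finally show ?thesis .
  qed
  ultimately show ?thesis by blast
qed

text \<open>Conjugation is additive, so \<open>Y\<close> inherits being a derivation from \<open>f\<close>, while
  the trace of \<open>Y \<circ> f\<close> is the sum of the squared absolute values of the eigenvalues.\<close>

lemma nilpotent_if_conj_trace_zero:
  assumes S: "is_basis V S" and f: "linear_on V V f" and Y: "linear_on V V Y"
    and Yv: "\<And>z v. v \<in> gen_eigenspace V f z \<Longrightarrow> Y v = cnj z *\<^sub>C v"
    and tr: "trace_on S (\<lambda>v. Y (f v)) = 0" and v: "v \<in> V"
  shows "\<exists>k. (f ^^ k) v = 0"
proof -
  note fd = basis_finite_dim[OF S] and sub = basis_subspace[OF S]
  obtain D where D: "linear_on V V D" "\<And>z v. v \<in> gen_eigenspace V f z \<Longrightarrow> D v = z *\<^sub>C v"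
    using gen_eigenspace_scalar_ex[OF fd f, of "\<lambda>z. z"] by blast
  obtain T where T: "T \<subseteq> (\<Union>z. gen_eigenspace V f z)" "is_basis V T"
    using basis_within[OF fd gen_eigenspaces_span[OF fd f]] .
  then have "\<forall>b\<in>T. \<exists>z. b \<in> gen_eigenspace V f z" by blast
  then obtain l where l: "\<And>b. b \<in> T \<Longrightarrow> b \<in> gen_eigenspace V f (l b)" by metis
  have Ez: "csubspace (gen_eigenspace V f y)" for y
    using gen_eigenspace_subspace[OF f sub] .
  \<comment> \<open>\<open>D\<close> is the semisimple part of \<open>f\<close>. On the generalized
    eigenspace of \<open>z\<close> the map \<open>N\<close> is \<open>cnj z\<close> times
    \<open>shift f z\<close>, hence nilpotent, so \<open>D\<close> may replace \<open>f\<close> in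
    the trace.\<close>
  define N where "N v = Y (f v - D v)" for v
  have N: "linear_on V V N"
    unfolding N_def using linear_on_comp[OF linear_on_combine(2)[OF f D(1) sub] Y] .
  have "trace_on T N = 0"
  proof (rule trace_nilpotent[OF T(2) N])
    have "gen_eigenspace V f z \<subseteq> {v \<in> V. \<exists>k. (N ^^ k) v = 0}" for z
    proof
      fix v assume v: "v \<in> gen_eigenspace V f z"
      have "(N ^^ k) v = (cnj z ^ k) *\<^sub>C (shift f z ^^ k) v \<and>
          (shift f z ^^ k) v \<in> gen_eigenspace V f z" for k
      proof (induction k)
        case 0
        then show ?case using v by (simp add: scaleC_one)
      next
        case (Suc k)
        let ?u = "(shift f z ^^ k) v"
        have u: "?u \<in> gen_eigenspace V f z" "?u \<in> V"
          using Suc by (auto simp: gen_eigenspace_def)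
        have s: "shift f z ?u \<in> gen_eigenspace V f z" using shift_gen_eigenspace[OF f sub u(1)] .
        have "N ?u = cnj z *\<^sub>C shift f z ?u"
          using D(2)[OF u(1)] Yv[OF s] by (simp add: N_def shift_def)
        then show ?case
          using Suc s linear_on_scale[OF N u(2)] by (simp add: scaleC_scaleC mult.commute)
      qed
      then show "v \<in> {v \<in> V. \<exists>k. (N ^^ k) v = 0}"
        using v by (force simp: gen_eigenspace_def)
    qed
    then have "V \<subseteq> {v \<in> V. \<exists>k. (N ^^ k) v = 0}"
      using complex_vector.span_minimal[of "\<Union>z. gen_eigenspace V f z"]
        funpow_kernel_subspace[OF N sub] gen_eigenspaces_span[OF fd f] by (metis (no_types, lifting) UN_least)
    then show "\<exists>k. (N ^^ k) x = 0" if "x \<in> V" for x using that by blast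
  qed
  moreover have "trace_on T (\<lambda>v. Y (D v)) = (\<Sum>b\<in>T. l b * cnj (l b))"
    unfolding trace_on_def
  proof (rule sum.cong[OF refl])
    fix b assume b: "b \<in> T"
    then have "Y (D b) = (l b * cnj (l b)) *\<^sub>C b"
      using D(2)[OF l[OF b]] Yv[OF l[OF b]] linear_on_scale[OF Y basis_mem[OF T(2) b]]
      by (simp add: scaleC_scaleC)
    then show "complex_vector.representation T (Y (D b)) b = l b * cnj (l b)"
      using b T(2) complex_vector.representation_scale[of T b "l b * cnj (l b)"]
        complex_vector.representation_basis[of T b] complex_vector.span_base[of b T]
      by (simp add: is_basis_def)
  qed
  moreover have "trace_on S (\<lambda>v. Y (f v)) = trace_on T (\<lambda>v. Y (D v)) + trace_on T N"
  proof -
    have "trace_on S (\<lambda>v. Y (f v)) = trace_on T (\<lambda>v. Y (f v))"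
      using trace_indep[OF S T(2) linear_on_comp[OF f Y]] .
    also have "\<dots> = trace_on T (\<lambda>v. Y (D v) + N v)"
      by (rule trace_cong[OF T(2)])
        (simp add: N_def linear_on_diff[OF Y sub] linear_on_mem[OF f] linear_on_mem[OF D(1)])
    finally show ?thesis using trace_add[OF T(2) linear_on_comp[OF D(1) Y] N] by simp
  qed
  ultimately have "(\<Sum>b\<in>T. l b * cnj (l b)) = 0" using tr by simp
  then have "of_real (\<Sum>b\<in>T. (cmod (l b))\<^sup>2) = (0::complex)"
    by (simp add: complex_norm_square flip: of_real_power)
  then have "(\<Sum>b\<in>T. (cmod (l b))\<^sup>2) = 0" using of_real_eq_0_iff by blast
  then have "l b = 0" if "b \<in> T" for b
    using that T(2) sum_nonneg_eq_0_iff[of T "\<lambda>b. (cmod (l b))\<^sup>2"] by (simp add: is_basis_def)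
  then have "T \<subseteq> gen_eigenspace V f 0" using l by force
  then have "V \<subseteq> gen_eigenspace V f 0"
    using T(2) complex_vector.span_minimal[OF _ Ez] by (auto simp: is_basis_def)
  moreover have "shift f 0 = f" by (simp add: shift_def fun_eq_iff)
  ultimately show ?thesis using v by (auto simp: gen_eigenspace_def)
qed

text \<open>Gram-Schmidt for a complex symmetric bilinear form that may be degenerate: what is left
  of \<open>u\<close> after projection lies in the radical. By polarization a nonzero form has a
  vector of nonzero square, and a complex square root normalizes it; then pass to its orthogonal
  space.\<close>

lemma orthonormal_family_ex:
  assumes "finite_dim V" "bilinear_on V V UNIV \<psi>" "\<And>x y. \<lbrakk>x \<in> V; y \<in> V\<rbrakk> \<Longrightarrow> \<psi> x y = \<psi> y x"
  shows "\<exists>n (e :: nat \<Rightarrow> 'b::complex_vector). (\<forall>i<n. e i \<in> V \<and> \<psi> (e i) (e i) = 1) \<and>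
    (\<forall>u\<in>V. \<forall>w\<in>V. \<psi> (u - (\<Sum>i<n. \<psi> (e i) u *\<^sub>C e i)) w = 0)"
  using assms
proof (induction "complex_vector.dim V" arbitrary: V rule: less_induct)
  case less
  note sub = finite_dim_subspace[OF less.prems(1)]
  have lr: "linear_on V UNIV (\<psi> x)" and ll: "linear_on V UNIV (\<lambda>y. \<psi> y x)" if "x \<in> V" for x
    using less.prems(2) that by (auto simp: bilinear_on_def)
  show ?case
  proof (cases "\<forall>x\<in>V. \<psi> x x = 0")
    case True
    have "\<psi> x y = 0" if xy: "x \<in> V" "y \<in> V" for x y
    proof -
      have "\<psi> (x + y) (x + y) = \<psi> x x + \<psi> x y + (\<psi> y x + \<psi> y y)"
        using xy sub linear_on_add[OF ll] linear_on_add[OF lr] by (simp add: csub)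
      then show ?thesis using True xy sub less.prems(3)[OF xy] by (simp add: csub)
    qed
    then show ?thesis by (intro exI[of _ 0]) simp
  next
    case False
    then obtain y where y: "y \<in> V" "\<psi> y y \<noteq> 0" by blast
    define x where "x = (1 / csqrt (\<psi> y y)) *\<^sub>C y"
    have xV: "x \<in> V" using y sub by (simp add: x_def csub)
    have xx: "\<psi> x x = 1"
    proof -
      have "\<psi> x x = (1 / csqrt (\<psi> y y)) * ((1 / csqrt (\<psi> y y)) * \<psi> y y)"
        using linear_on_scale[OF ll[OF xV] y(1)] linear_on_scale[OF lr[OF y(1)] y(1)]
        by (simp add: x_def scaleC_complex_def)
      also have "\<dots> = \<psi> y y / (csqrt (\<psi> y y))\<^sup>2"
        by (simp add: power2_eq_square)
      finally show ?thesis using y(2) by simp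
    qed
    let ?U = "{u \<in> V. \<psi> x u = 0}"
    have U: "csubspace ?U"
      using linear_on_preimage_subspace[OF lr[OF xV] sub, of "{0}"] by simp
    have "x \<notin> ?U" using xx by simp
    then have UV: "?U \<subset> V" using xV by blast
    have "finite_dim ?U" using finite_dim_subset[OF less.prems(1) U] by blast
    moreover have "bilinear_on ?U ?U UNIV \<psi>"
      using less.prems(2) by (auto simp: bilinear_on_def linear_on_def)
    ultimately obtain n and e :: "nat \<Rightarrow> 'b"
      where e: "\<And>i. i < n \<Longrightarrow> e i \<in> ?U \<and> \<psi> (e i) (e i) = 1"
        and ex: "\<And>u w. \<lbrakk>u \<in> ?U; w \<in> ?U\<rbrakk> \<Longrightarrow> \<psi> (u - (\<Sum>i<n. \<psi> (e i) u *\<^sub>C e i)) w = 0"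
      using less.hyps[OF dim_less[OF less.prems(1) U UV]] less.prems(3) by (smt (verit) mem_Collect_eq)
    define e' where "e' i = (if i = n then x else e i)" for i
    have "\<psi> (u - (\<Sum>i<Suc n. \<psi> (e' i) u *\<^sub>C e' i)) w = 0" if u: "u \<in> V" and w: "w \<in> V" for u w
    proof -
      have proj: "v - \<psi> x v *\<^sub>C x \<in> ?U" if "v \<in> V" for v
        using that xV xx sub
        by (simp add: csub linear_on_diff[OF lr[OF xV] sub] linear_on_scale[OF lr[OF xV]]
            scaleC_complex_def)
      let ?u = "u - \<psi> x u *\<^sub>C x"
      have "\<psi> (e i) ?u = \<psi> (e i) u" if "i < n" for i
        using e[OF that] u xV sub less.prems(3)[of x "e i"]
        by (simp add: csub linear_on_diff[OF lr sub] linear_on_scale[OF lr] scaleC_complex_def)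
      then have eq: "u - (\<Sum>i<Suc n. \<psi> (e' i) u *\<^sub>C e' i) = ?u - (\<Sum>i<n. \<psi> (e i) ?u *\<^sub>C e i)"
        by (simp add: e'_def)
      let ?r = "?u - (\<Sum>i<n. \<psi> (e i) ?u *\<^sub>C e i)"
      have r: "?r \<in> ?U"
        by (rule complex_vector.subspace_diff[OF U proj[OF u] complex_vector.subspace_sum[OF U
              complex_vector.subspace_scale[OF U]]]) (use e in blast)
      then have rV: "?r \<in> V" by blast
      have "\<psi> ?r ((w - \<psi> x w *\<^sub>C x) + \<psi> x w *\<^sub>C x) =
          \<psi> ?r (w - \<psi> x w *\<^sub>C x) + \<psi> ?r (\<psi> x w *\<^sub>C x)"
        by (rule linear_on_add[OF lr[OF rV]]) (use w xV sub in \<open>auto simp: csub\<close>)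
      then have "\<psi> ?r w = \<psi> ?r (w - \<psi> x w *\<^sub>C x) + \<psi> ?r (\<psi> x w *\<^sub>C x)"
        unfolding diff_add_cancel .
      also have "\<psi> ?r (\<psi> x w *\<^sub>C x) = 0"
        using linear_on_scale[OF lr[OF rV] xV] r less.prems(3)[OF xV rV] by (simp add: scaleC_complex_def)
      finally show ?thesis unfolding eq using ex[OF proj[OF u] proj[OF w]] by simp
    qed
    moreover have "\<forall>i<Suc n. e' i \<in> V \<and> \<psi> (e' i) (e' i) = 1"
      using e xV xx by (auto simp: e'_def less_Suc_eq)
    ultimately show ?thesis by blast
  qed
qed

section \<open>Simple Leibniz algebras\<close>

context left_leibniz_algebra
begin

lemma br_right_linear: "x \<in> L \<Longrightarrow> linear_on L L (br x)"
  and br_left_linear: "y \<in> L \<Longrightarrow> linear_on L L (\<lambda>x. br x y)"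
  using bilinear by (auto simp: bilinear_on_def)

lemma br_mem: "\<lbrakk>x \<in> L; y \<in> L\<rbrakk> \<Longrightarrow> br x y \<in> L"
  using linear_on_mem[OF br_right_linear] .

lemma br_simps:
  "\<lbrakk>x \<in> L; y \<in> L; z \<in> L\<rbrakk> \<Longrightarrow> br x (y + z) = br x y + br x z"
  "\<lbrakk>x \<in> L; y \<in> L; z \<in> L\<rbrakk> \<Longrightarrow> br (x + y) z = br x z + br y z"
  "\<lbrakk>x \<in> L; y \<in> L; z \<in> L\<rbrakk> \<Longrightarrow> br x (y - z) = br x y - br x z"
  "\<lbrakk>x \<in> L; y \<in> L; z \<in> L\<rbrakk> \<Longrightarrow> br (x - y) z = br x z - br y z"
  "\<lbrakk>x \<in> L; y \<in> L\<rbrakk> \<Longrightarrow> br x (c *\<^sub>C y) = c *\<^sub>C br x y"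
  "\<lbrakk>x \<in> L; y \<in> L\<rbrakk> \<Longrightarrow> br (c *\<^sub>C x) y = c *\<^sub>C br x y"
  "x \<in> L \<Longrightarrow> br x 0 = 0"
  "y \<in> L \<Longrightarrow> br 0 y = 0"
  "\<lbrakk>x \<in> L; y \<in> L\<rbrakk> \<Longrightarrow> br x (- y) = - br x y"
  "\<lbrakk>x \<in> L; y \<in> L\<rbrakk> \<Longrightarrow> br (- x) y = - br x y"
  using linear_on_add[OF br_right_linear] linear_on_add[OF br_left_linear]
    linear_on_diff[OF br_right_linear] linear_on_diff[OF br_left_linear]
    linear_on_scale[OF br_right_linear] linear_on_scale[OF br_left_linear]
    linear_on_zero[OF br_right_linear] linear_on_zero[OF br_left_linear]
    linear_on_neg[OF br_right_linear] linear_on_neg[OF br_left_linear]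
    subspace
  by simp_all

lemma br_sum:
  "\<lbrakk>x \<in> L; \<And>i. i \<in> I \<Longrightarrow> f i \<in> L\<rbrakk> \<Longrightarrow> br x (sum f I) = (\<Sum>i\<in>I. br x (f i))"
  "\<lbrakk>y \<in> L; \<And>i. i \<in> I \<Longrightarrow> f i \<in> L\<rbrakk> \<Longrightarrow> br (sum f I) y = (\<Sum>i\<in>I. br (f i) y)"
  by (rule linear_on_sum[OF br_right_linear subspace] linear_on_sum[OF br_left_linear subspace];
      simp)+

lemmas L_closed = br_mem complex_vector.subspace_add[OF subspace]
  complex_vector.subspace_scale[OF subspace] complex_vector.subspace_diff[OF subspace]
  complex_vector.subspace_0[OF subspace] complex_vector.subspace_neg[OF subspace]
  complex_vector.subspace_sum[OF subspace]

lemma left_mult_bracket: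
  "\<lbrakk>a \<in> L; b \<in> L; c \<in> L\<rbrakk> \<Longrightarrow> br (br a b) c = br a (br b c) - br b (br a c)"
  using leibniz[of a b c] by (simp add: algebra_simps)

end

locale nonlie_simple_leibniz = simple_leibniz_algebra L br
  for L :: "'b::complex_vector set" and br +
  assumes fin_dim: "finite_dim L" and nonlie: "\<not> lie_algebra L br"
begin

abbreviation M where "M \<equiv> Leib L br"

lemma M_sub: "csubspace M"
  unfolding Leib_def by simp

lemma M_L: "M \<subseteq> L"
  unfolding Leib_def
  by (rule complex_vector.span_minimal) (auto intro: br_mem subspace)

lemma M_mem: "m \<in> M \<Longrightarrow> m \<in> L"
  using M_L by blast

lemma square_mem: "u \<in> L \<Longrightarrow> br u u \<in> M"
  unfolding Leib_def by (rule complex_vector.span_base) blast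

lemma sym_mem:
  assumes "a \<in> L" "b \<in> L"
  shows "br a b + br b a \<in> M"
proof -
  have "br a b + br b a = br (a + b) (a + b) - br a a - br b b"
    using assms by (simp add: br_simps L_closed)
  then show ?thesis
    using assms square_mem[of "a + b"] square_mem[of a] square_mem[of b] M_sub
    by (simp add: csub L_closed)
qed

lemma M_left: "\<lbrakk>m \<in> M; x \<in> L\<rbrakk> \<Longrightarrow> br m x = 0"
proof -
  assume m: "m \<in> M" and x: "x \<in> L"
  have "br m x \<in> {0}"
    by (rule linear_on_span_subset[OF br_left_linear[OF x] subspace, of "{0}" "{br u u |u. u \<in> L}"])
      (use m x in \<open>auto simp: br_mem Leib_def left_mult_bracket\<close>)
  then show ?thesis by simp
qed

lemma M_right:
  assumes "x \<in> L" "m \<in> M"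
  shows "br x m \<in> M"
proof (rule linear_on_span_subset[OF br_right_linear[OF assms(1)] subspace M_sub,
      of "{br u u |u. u \<in> L}"])
  fix y assume "y \<in> {br u u |u. u \<in> L}"
  then obtain u where u: "u \<in> L" "y = br u u" by blast
  then show "br x y \<in> M"
    using leibniz[of x u u] sym_mem[of "br x u" u] assms by (simp add: br_mem)
qed (use assms in \<open>auto simp: br_mem Leib_def\<close>)

lemma br_swap_mem:
  assumes "csubspace H" "M \<subseteq> H" "a \<in> L" "b \<in> L" "br a b \<in> H"
  shows "br b a \<in> H"
proof -
  have "br b a = (br a b + br b a) - br a b" by simp
  then show ?thesis
    using assms sym_mem[of a b] by (metis complex_vector.subspace_diff subset_iff)
qed

text \<open>Modulo \<open>M\<close> the bracket is antisymmetric, so above \<open>M\<close>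
  stability under left multiplication gives a two-sided ideal. Kernels, radicals, images and
  annihilators are all identified in this way.\<close>

lemma left_ideal_cases:
  assumes "csubspace I" "M \<subseteq> I" "I \<subseteq> L" "\<And>x y. \<lbrakk>x \<in> L; y \<in> I\<rbrakk> \<Longrightarrow> br x y \<in> I"
  shows "I = M \<or> I = L"
proof -
  have "leibniz_ideal I L br"
    unfolding leibniz_ideal_def using assms br_swap_mem[OF assms(1,2)] by blast
  then have "I = {0} \<or> I = M \<or> I = L" using ideals by blast
  moreover have "I = M" if "I = {0}"
    using that assms(2) M_sub complex_vector.subspace_0 by blast
  ultimately show ?thesis by blast
qed

text \<open>Elements of \<open>M\<close> multiply to zero from the left, so a left submodule of
  \<open>M\<close> is automatically an ideal. This is the simplicity of \<open>M\<close> as a left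
  module.\<close>

lemma submodule_cases:
  assumes "csubspace W" "W \<subseteq> M" "\<And>x y. \<lbrakk>x \<in> L; y \<in> W\<rbrakk> \<Longrightarrow> br x y \<in> W"
  shows "W = {0} \<or> W = M"
proof -
  have "br y x \<in> W" if "x \<in> L" "y \<in> W" for x y
    using that assms(1,2) M_left by (simp add: csub subset_iff)
  then have "leibniz_ideal W L br"
    unfolding leibniz_ideal_def using assms M_L by blast
  then show ?thesis using ideals assms(2) M_L by blast
qed

lemma M_nonzero: "M \<noteq> {0}"
proof
  assume "M = {0}"
  then have "lie_algebra L br"
    using square_mem by unfold_locales auto
  then show False using nonlie by blast
qed

text \<open>The commutator is an ideal containing all squares, so it is \<open>M\<close> or
  \<open>L\<close>, and \<open>commutator_neq\<close> excludes the first.\<close>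

lemma perfect: "commutator L L br = L"
proof -
  let ?C = "commutator L L br"
  have CL: "?C \<subseteq> L"
    unfolding commutator_def
    by (rule complex_vector.span_minimal) (auto intro: br_mem subspace)
  moreover have "M \<subseteq> ?C"
    unfolding Leib_def commutator_def by (rule complex_vector.span_mono) blast
  moreover have "br x y \<in> ?C" if "x \<in> L" "y \<in> ?C" for x y
  proof -
    have "br x y \<in> {br x y |x y. x \<in> L \<and> y \<in> L}" using that CL by blast
    then show ?thesis unfolding commutator_def by (rule complex_vector.span_base)
  qed
  ultimately have "?C = M \<or> ?C = L"
    by (intro left_ideal_cases) (auto simp: commutator_def)
  then show ?thesis using commutator_neq by blast
qed

lemma perfect_subset:
  assumes "csubspace P" "\<And>x y. \<lbrakk>x \<in> L; y \<in> L\<rbrakk> \<Longrightarrow> br x y \<in> P"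
  shows "L \<subseteq> P"
  using complex_vector.span_minimal[OF _ assms(1), of "{br x y |x y. x \<in> L \<and> y \<in> L}"]
    perfect assms(2) by (auto simp: commutator_def)

lemma perfect_kills:
  assumes "csubspace Z" "linear_on L Z f" "\<And>x y. \<lbrakk>x \<in> L; y \<in> L\<rbrakk> \<Longrightarrow> f (br x y) = 0" "x \<in> L"
  shows "f x = 0"
  using perfect_subset[OF linear_on_preimage_subspace[OF assms(2) subspace, of "{0}"]] assms
  by (auto simp: br_mem)

lemma M_neq_L: "M \<noteq> L"
  using commutator_neq perfect by simp

section \<open>Engel's theorem for subalgebras containing Leib\<close>

definition subalgebra :: "'b set \<Rightarrow> bool" where
  "subalgebra H \<longleftrightarrow> csubspace H \<and> M \<subseteq> H \<and> H \<subseteq> L \<and> (\<forall>x\<in>H. \<forall>y\<in>H. br x y \<in> H)"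

text \<open>The conclusion of Engel's theorem for all sections \<open>V/W\<close> of the left module
  \<open>L\<close>. The quotient is needed because the theorem is applied to \<open>H/K\<close> for
  a subalgebra \<open>K\<close> of \<open>H\<close> as well as inside an arbitrary module.\<close>

definition has_invariant :: "'b set \<Rightarrow> bool" where
  "has_invariant H \<longleftrightarrow> (\<forall>V W. csubspace V \<longrightarrow> csubspace W \<longrightarrow> W \<subset> V \<longrightarrow> V \<subseteq> L \<longrightarrow>
     (\<forall>h\<in>H. \<forall>v\<in>V. br h v \<in> V) \<longrightarrow> (\<forall>h\<in>H. \<forall>w\<in>W. br h w \<in> W) \<longrightarrow>
     (\<exists>v\<in>V - W. \<forall>h\<in>H. br h v \<in> W))"

text \<open>Subalgebras above \<open>M\<close> correspond to those of the Lie algebra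
  \<open>L/M\<close>. Since \<open>M\<close> acts by zero from the left, it takes the place of the
  zero subalgebra at the start of the induction.\<close>

lemma subalgebra_M: "subalgebra M"
  using M_sub M_L M_right by (auto simp: subalgebra_def)

text \<open>Take a proper subalgebra \<open>K\<close> of greatest dimension. An invariant of
  \<open>H/K\<close> under \<open>K\<close> gives \<open>v\<close> outside \<open>K\<close> with
  \<open>[K, v]\<close> inside \<open>K\<close>, so \<open>K\<close> together with \<open>v\<close>
  spans a larger subalgebra, which must be \<open>H\<close>. As \<open>[v, v]\<close> lies in
  \<open>M\<close> and hence in \<open>K\<close>, all brackets of \<open>H\<close> fall into
  \<open>K\<close>.\<close>

lemma codimension_one:
  assumes H: "subalgebra H" "H \<noteq> M"
    and inv: "\<And>H'. \<lbrakk>subalgebra H'; H' \<subset> H\<rbrakk> \<Longrightarrow> has_invariant H'"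
  obtains H' v where "subalgebra H'" "H' \<subset> H" "v \<in> H" "\<And>h. h \<in> H' \<Longrightarrow> br h v \<in> H'"
    "\<And>x. x \<in> H \<Longrightarrow> \<exists>h\<in>H'. \<exists>c. x = h + c *\<^sub>C v" "\<And>x y. \<lbrakk>x \<in> H; y \<in> H\<rbrakk> \<Longrightarrow> br x y \<in> H'"
proof -
  have Hs: "csubspace H" "M \<subseteq> H" "H \<subseteq> L" "\<And>x y. \<lbrakk>x \<in> H; y \<in> H\<rbrakk> \<Longrightarrow> br x y \<in> H"
    using H(1) by (auto simp: subalgebra_def)
  have fdH: "finite_dim H" using finite_dim_subset[OF fin_dim Hs(1,3)] .
  let ?P = "\<lambda>K. subalgebra K \<and> K \<subset> H"
  have "?P M" using subalgebra_M H(2) Hs(2) by blast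
  moreover have "\<forall>K. ?P K \<longrightarrow> complex_vector.dim K < complex_vector.dim H"
    using dim_less[OF fdH] by (auto simp: subalgebra_def)
  ultimately obtain K where K: "?P K" "\<And>K'. ?P K' \<Longrightarrow> complex_vector.dim K' \<le> complex_vector.dim K"
    using ex_has_greatest_nat[of ?P M complex_vector.dim "complex_vector.dim H"] by blast
  then have Ks: "csubspace K" "M \<subseteq> K" "K \<subseteq> L" "K \<subset> H" "\<And>x y. \<lbrakk>x \<in> K; y \<in> K\<rbrakk> \<Longrightarrow> br x y \<in> K"
    by (auto simp: subalgebra_def)
  have "has_invariant K" using inv K(1) by blast
  moreover have "\<forall>h\<in>K. \<forall>v\<in>H. br h v \<in> H" using Hs(4) Ks(4) by blast
  ultimately have "\<exists>v\<in>H - K. \<forall>h\<in>K. br h v \<in> K"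
    unfolding has_invariant_def using Hs(1,3) Ks(1,4,5) by simp
  then obtain v where v: "v \<in> H" "v \<notin> K" "\<And>h. h \<in> K \<Longrightarrow> br h v \<in> K" by blast
  have vL: "v \<in> L" using v Hs by blast
  let ?K = "{h + c *\<^sub>C v |h c. h \<in> K}"
  have Kadd: "\<exists>h\<in>K. \<exists>c. x = h + c *\<^sub>C v" if "x \<in> ?K" for x using that by blast
  have "?K = K + cspan {v}"
    by (fastforce simp: set_plus_def complex_vector.span_singleton)
  then have sub: "csubspace ?K" using subspace_plus[OF Ks(1), of "cspan {v}"] by simp
  have brK: "br x y \<in> K" if xy: "x \<in> ?K" "y \<in> ?K" for x y
  proof -
    obtain h k c d where *: "x = h + c *\<^sub>C v" "y = k + d *\<^sub>C v" "h \<in> K" "k \<in> K"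
      using xy by blast
    have L: "h \<in> L" "k \<in> L" using * Ks by auto
    have "br x y = br h k + d *\<^sub>C br h v + c *\<^sub>C br v k + (c * d) *\<^sub>C br v v"
      using * L vL by (simp add: br_simps L_closed scaleC_add_right scaleC_scaleC)
    moreover have "br v k \<in> K" using br_swap_mem[OF Ks(1,2) L(2) vL] v(3) * by blast
    moreover have "br v v \<in> K" using square_mem[OF vL] Ks(2) by blast
    ultimately show ?thesis using Ks(1,5) v(3) * by (simp add: csub)
  qed
  have KK: "K \<subseteq> ?K"
  proof
    fix x assume "x \<in> K"
    moreover have "x = x + 0 *\<^sub>C v" by simp
    ultimately show "x \<in> ?K" by blast
  qed
  have "v \<in> ?K"
  proof -
    have "v = 0 + 1 *\<^sub>C v" "0 \<in> K" using Ks(1) by (auto simp: csub scaleC_one)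
    then show ?thesis by blast
  qed
  have KH: "?K \<subseteq> H" using v(1) Ks(4) Hs(1) by (auto simp: csub subset_iff psubset_eq)
  have "subalgebra ?K"
    unfolding subalgebra_def using sub Ks(2) KK KH Hs(3) brK by blast
  moreover have "complex_vector.dim K < complex_vector.dim ?K"
    using dim_less[OF finite_dim_subset[OF fdH sub KH] Ks(1)] KK \<open>v \<in> ?K\<close> v(2) by blast
  ultimately have "?K = H" using K(2)[of ?K] KH by fastforce
  show ?thesis
  proof (rule that[of K v])
    show "\<exists>h\<in>K. \<exists>c. x = h + c *\<^sub>C v" if "x \<in> H" for x using Kadd that \<open>?K = H\<close> by blast
    show "br x y \<in> K" if "x \<in> H" "y \<in> H" for x y using brK that \<open>?K = H\<close> by blast
  qed (use K(1) v in auto)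
qed

text \<open>For \<open>K\<close> and \<open>v\<close> as in \<open>codimension_one\<close>, the
  vectors that \<open>K\<close> sends into \<open>W\<close> form a space stable under
  \<open>v\<close>. By nilpotency of \<open>v\<close> some iterate of such a vector lies in
  \<open>W\<close>; the iterate just before the first one that does is the required
  invariant.\<close>

lemma engel:
  assumes nil: "\<And>x y. \<lbrakk>x \<in> L; y \<in> L\<rbrakk> \<Longrightarrow> \<exists>k. (br x ^^ k) y = 0" and "subalgebra H"
  shows "has_invariant H"
  using assms(2)
proof (induction "complex_vector.dim H" arbitrary: H rule: less_induct)
  case less
  have Hs: "csubspace H" "M \<subseteq> H" "H \<subseteq> L"
    using less.prems by (auto simp: subalgebra_def)
  have fdH: "finite_dim H" using finite_dim_subset[OF fin_dim Hs(1,3)] .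
  show ?case
    unfolding has_invariant_def
  proof (intro allI impI)
    fix V W
    assume V: "csubspace V" "V \<subseteq> L" "\<forall>h\<in>H. \<forall>v\<in>V. br h v \<in> V"
      and W: "csubspace W" "W \<subset> V" "\<forall>h\<in>H. \<forall>w\<in>W. br h w \<in> W"
    show "\<exists>v\<in>V - W. \<forall>h\<in>H. br h v \<in> W"
    proof (cases "H = M")
      case True
      obtain v where "v \<in> V - W" using W(2) by blast
      moreover have "br h v \<in> W" if "h \<in> H" for h
        using that True M_left[of h v] \<open>v \<in> V - W\<close> V(2) W(1) by (auto simp: csub subset_iff)
      ultimately show ?thesis by blast
    next
      case False
      have IH: "has_invariant K" if "subalgebra K" "K \<subset> H" for K
        using less.hyps[OF dim_less[OF fdH _ that(2)] that(1)] that(1)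
        by (auto simp: subalgebra_def)
      obtain K v where K: "subalgebra K" "K \<subset> H" "v \<in> H" "\<And>h. h \<in> K \<Longrightarrow> br h v \<in> K"
        "\<And>x. x \<in> H \<Longrightarrow> \<exists>h\<in>K. \<exists>c. x = h + c *\<^sub>C v"
        using codimension_one[OF less.prems False IH] by metis
      have KL: "K \<subseteq> L" "v \<in> L" using K Hs by auto
      define U where "U = {u \<in> V. \<forall>h\<in>K. br h u \<in> W}"
      have "\<forall>h\<in>K. \<forall>v\<in>V. br h v \<in> V" "\<forall>h\<in>K. \<forall>w\<in>W. br h w \<in> W"
        using V(3) W(3) K(2) by blast+
      then have "\<exists>u\<in>V - W. \<forall>h\<in>K. br h u \<in> W"
        using IH[OF K(1,2)] V(1,2) W(1,2) unfolding has_invariant_def by simp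
      then obtain u where u: "u \<in> U" "u \<notin> W" by (auto simp: U_def)
      have vU: "br v x \<in> U" if x: "x \<in> U" for x
      proof -
        have xV: "x \<in> V" "x \<in> L" using x V by (auto simp: U_def)
        have "br h (br v x) \<in> W" if h: "h \<in> K" for h
        proof -
          have "br h (br v x) = br (br h v) x + br v (br h x)"
            using leibniz[of h v x] h KL xV by blast
          moreover have "br (br h v) x \<in> W" using K(4)[OF h] x by (simp add: U_def)
          moreover have "br v (br h x) \<in> W" using W(3) K(3) x h by (simp add: U_def)
          ultimately show ?thesis using W(1) by (simp add: csub)
        qed
        then show ?thesis using V(3) K(3) xV by (simp add: U_def)
      qed
      have uL: "u \<in> L" using u(1) V(2) by (auto simp: U_def)
      have ex: "\<exists>k. (br v ^^ k) u \<in> W"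
      proof -
        obtain k where "(br v ^^ k) u = 0" using nil[OF KL(2) uL] by blast
        then have "(br v ^^ k) u \<in> W" using complex_vector.subspace_0[OF W(1)] by simp
        then show ?thesis by blast
      qed
      define k where "k = (LEAST k. (br v ^^ k) u \<in> W)"
      have k: "(br v ^^ k) u \<in> W" unfolding k_def using ex by (rule LeastI_ex)
      then have "k \<noteq> 0" using u(2) by (cases k) auto
      then obtain j where j: "k = Suc j" using not0_implies_Suc by blast
      have jW: "(br v ^^ j) u \<notin> W" using not_less_Least[of j "\<lambda>k. (br v ^^ k) u \<in> W"] j
        by (simp add: k_def)
      let ?w = "(br v ^^ j) u"
      have wU: "?w \<in> U" by (induction j) (use u(1) vU in auto)
      have wV: "?w \<in> V" "?w \<in> L" using wU V(2) by (auto simp: U_def)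
      have "br x ?w \<in> W" if x: "x \<in> H" for x
      proof -
        obtain h c where h: "h \<in> K" "x = h + c *\<^sub>C v" using K(5)[OF x] by blast
        then have "br x ?w = br h ?w + c *\<^sub>C br v ?w"
          using KL wV by (simp add: br_simps L_closed subset_iff)
        moreover have "br h ?w \<in> W" using wU h by (simp add: U_def)
        moreover have "br v ?w \<in> W" using k j by simp
        ultimately show ?thesis using W(1) by (simp add: csub)
      qed
      then show ?thesis using wV(1) jW by blast
    qed
  qed
qed

text \<open>Otherwise Engel's theorem allows \<open>codimension_one\<close> for
  \<open>H = L\<close>, which puts all brackets into a proper subalgebra and contradicts
  \<open>perfect\<close>.\<close>

lemma not_all_nilpotent: "\<exists>x\<in>L. \<exists>y\<in>L. \<forall>k. (br x ^^ k) y \<noteq> 0"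
proof (rule ccontr)
  assume "\<not> ?thesis"
  then have nil: "\<And>x y. \<lbrakk>x \<in> L; y \<in> L\<rbrakk> \<Longrightarrow> \<exists>k. (br x ^^ k) y = 0" by blast
  have "subalgebra L" using subspace M_L by (auto simp: subalgebra_def br_mem)
  then obtain K v where K: "subalgebra K" "K \<subset> L" "\<And>x y. \<lbrakk>x \<in> L; y \<in> L\<rbrakk> \<Longrightarrow> br x y \<in> K"
    using codimension_one[of L] engel[OF nil] M_neq_L by metis
  then have "L \<subseteq> K" using perfect_subset[of K] by (auto simp: subalgebra_def)
  then show False using K(2) by blast
qed

section \<open>The Killing form of the left multiplications\<close>

definition killing :: "'b set \<Rightarrow> 'b \<Rightarrow> 'b \<Rightarrow> complex" where
  "killing S x y = trace_on S (\<lambda>v. br x (br y v))"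

text \<open>Brackets add eigenvalues of \<open>br x\<close> and conjugation is additive, so the
  conjugate operator \<open>Y\<close> is a derivation. Its trace against left multiplication by a
  bracket is a value of the Killing form, and perfectness carries the vanishing from brackets to
  \<open>x\<close>.\<close>

lemma killing_zero_imp_nilpotent:
  assumes S: "is_basis L S" and zero: "\<And>x y. \<lbrakk>x \<in> L; y \<in> L\<rbrakk> \<Longrightarrow> killing S x y = 0"
    and x: "x \<in> L" and v: "v \<in> L"
  shows "\<exists>k. (br x ^^ k) v = 0"
proof -
  let ?f = "br x"
  have f: "linear_on L L ?f" using br_right_linear[OF x] .
  obtain Y where Y: "linear_on L L Y" "\<And>z v. v \<in> gen_eigenspace L ?f z \<Longrightarrow> Y v = cnj z *\<^sub>C v"
    using gen_eigenspace_scalar_ex[OF fin_dim f, of cnj] by blast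
  have graded: "br b c \<in> gen_eigenspace L ?f (z + w)"
    if b: "b \<in> gen_eigenspace L ?f z" and c: "c \<in> gen_eigenspace L ?f w" for b c z w
  proof -
    have shift_br: "shift ?f (z + w) (br b c) = br (shift ?f z b) c + br b (shift ?f w c)"
      if "b \<in> L" "c \<in> L" for b c
      using leibniz[OF x that] that x
      by (simp add: shift_def br_simps L_closed scaleC_add_left algebra_simps)
    have sL: "shift ?f z b \<in> L" if "b \<in> L" for b z
      using linear_on_mem[OF linear_on_shift[OF f subspace] that] .
    \<comment> \<open>By the Leibniz rule each application of the shifted operator lowers one of the
      two exponents, so \<open>i + j\<close> applications suffice. Exponent 0 means that the
      argument itself is 0.\<close>
    have "(shift ?f (z + w) ^^ n) (br b c) = 0"
      if "b \<in> L" "c \<in> L" "(shift ?f z ^^ i) b = 0" "(shift ?f w ^^ j) c = 0" "n = i + j"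
      for b c i j n
      using that
    proof (induction n arbitrary: i j b c)
      case 0
      then show ?case by (simp add: br_simps)
    next
      case (Suc n)
      let ?s = "shift ?f (z + w)"
      have lin: "linear_on L L (?s ^^ n)" using linear_on_funpow[OF linear_on_shift[OF f subspace]] .
      have 1: "(?s ^^ n) (br (shift ?f z b) c) = 0"
      proof (cases i)
        case 0
        then have "b = 0" using Suc.prems by simp
        then have "shift ?f z b = 0" using x by (simp add: shift_def br_simps)
        then show ?thesis using Suc.prems linear_on_zero[OF lin subspace] by (simp add: br_simps)
      next
        case (Suc i')
        then show ?thesis
          using Suc.IH[of "shift ?f z b" c i' j] Suc.prems sL by (simp add: funpow_swap1)
      qed
      have 2: "(?s ^^ n) (br b (shift ?f w c)) = 0"
      proof (cases j)
        case 0
        then have "c = 0" using Suc.prems by simp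
        then have "shift ?f w c = 0" using x by (simp add: shift_def br_simps)
        then show ?thesis using Suc.prems linear_on_zero[OF lin subspace] by (simp add: br_simps)
      next
        case (Suc j')
        then show ?thesis
          using Suc.IH[of b "shift ?f w c" i j'] Suc.prems sL by (simp add: funpow_swap1)
      qed
      have "(?s ^^ Suc n) (br b c) = (?s ^^ n) (?s (br b c))" by (simp add: funpow_swap1)
      also have "\<dots> = 0"
        using shift_br Suc.prems 1 2 linear_on_add[OF lin] sL by (simp add: L_closed)
      finally show ?case .
    qed
    then show ?thesis using b c by (fastforce simp: gen_eigenspace_def br_mem)
  qed
  have spanL: "L = cspan (\<Union>z. gen_eigenspace L ?f z)"
    using gen_eigenspaces_span[OF fin_dim f] by simp
  have geL: "(\<Union>z. gen_eigenspace L ?f z) \<subseteq> L" by (auto simp: gen_eigenspace_def)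
  have zsub: "csubspace {0::'b}" by simp
  \<comment> \<open>\<open>D\<close> measures the failure of \<open>Y\<close> to be a derivation. It
    is bilinear, so it may be tested on generalized eigenvectors, one argument at a time.\<close>
  define D where "D b c = Y (br b c) - br (Y b) c - br b (Y c)" for b c
  have Dr: "linear_on L L (D b)" if "b \<in> L" for b
    unfolding D_def
    using that linear_on_mem[OF Y(1)]
    by (intro linear_on_combine subspace linear_on_comp[OF br_right_linear Y(1)]
        linear_on_comp[OF Y(1) br_right_linear] br_right_linear)
  have Dl: "linear_on L L (\<lambda>b. D b c)" if "c \<in> L" for c
    unfolding D_def
    using that linear_on_mem[OF Y(1)]
    by (intro linear_on_combine subspace linear_on_comp[OF br_left_linear Y(1)]
        linear_on_comp[OF Y(1) br_left_linear] br_left_linear)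
  have D1: "D b c = 0" if "b \<in> gen_eigenspace L ?f z" "c \<in> gen_eigenspace L ?f w" for b c z w
  proof -
    have "b \<in> L" "c \<in> L" using that by (auto simp: gen_eigenspace_def)
    then show ?thesis
      using Y(2)[OF graded[OF that]] Y(2)[OF that(1)] Y(2)[OF that(2)]
      by (simp add: D_def br_simps scaleC_add_left)
  qed
  have D2: "D b c = 0" if "b \<in> gen_eigenspace L ?f z" "c \<in> L" for b c z
  proof -
    have "b \<in> L" using that by (auto simp: gen_eigenspace_def)
    then have "D b c \<in> {0}"
      by (rule linear_on_span_subset[OF Dr subspace zsub geL]) (use D1 that spanL in auto)
    then show ?thesis by simp
  qed
  have D0: "D b c = 0" if "b \<in> L" "c \<in> L" for b c
  proof -
    have "D b c \<in> {0}"
      by (rule linear_on_span_subset[OF Dl[OF that(2)] subspace zsub geL])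
        (use D2 that spanL in auto)
    then show ?thesis by simp
  qed
  have der: "Y (br b c) = br (Y b) c + br b (Y c)" if "b \<in> L" "c \<in> L" for b c
    using D0[OF that] by (simp add: D_def algebra_simps)
  have YL: "Y b \<in> L" if "b \<in> L" for b using linear_on_mem[OF Y(1) that] .
  \<comment> \<open>The commutator of \<open>Y\<close> with left multiplication by \<open>b\<close>
    is left multiplication by \<open>Y b\<close>; cyclicity of the trace leaves
    \<open>killing S (Y b) c\<close>.\<close>
  have tr_br: "trace_on S (\<lambda>v. Y (br (br b c) v)) = 0" if b: "b \<in> L" and c: "c \<in> L" for b c
  proof -
    note lb = br_right_linear[OF b] and lc = br_right_linear[OF c]
    note Yc = linear_on_comp[OF lc Y(1)]
    note Ybc = linear_on_comp[OF linear_on_comp[OF lc lb] Y(1)]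
    note bYc = linear_on_comp[OF Yc lb]
    have "trace_on S (\<lambda>v. Y (br (br b c) v)) =
        trace_on S (\<lambda>v. Y (br b (br c v)) - Y (br c (br b v)))"
      by (rule trace_cong[OF S])
        (use b c in \<open>simp add: left_mult_bracket linear_on_diff[OF Y(1) subspace] L_closed\<close>)
    also have "\<dots> = trace_on S (\<lambda>v. Y (br b (br c v))) - trace_on S (\<lambda>v. Y (br c (br b v)))"
      by (rule trace_diff[OF S Ybc linear_on_comp[OF lb Yc]])
    also have "trace_on S (\<lambda>v. Y (br c (br b v))) = trace_on S (\<lambda>v. br b (Y (br c v)))"
      by (rule trace_commute[OF S Yc lb])
    also have "trace_on S (\<lambda>v. Y (br b (br c v))) - \<dots> =
        trace_on S (\<lambda>v. Y (br b (br c v)) - br b (Y (br c v)))"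
      by (rule trace_diff[OF S Ybc bYc, symmetric])
    also have "\<dots> = trace_on S (\<lambda>v. br (Y b) (br c v))"
      by (rule trace_cong[OF S]) (use b c der in \<open>simp add: L_closed\<close>)
    also have "\<dots> = 0" using zero[OF YL[OF b] c] by (simp add: killing_def)
    finally show ?thesis .
  qed
  have lin: "linear_on L UNIV (\<lambda>u. trace_on S (\<lambda>v. Y (br u v)))"
  proof (rule linear_onI)
    fix u w assume u: "u \<in> L" and w: "w \<in> L"
    have "trace_on S (\<lambda>v. Y (br (u + w) v)) = trace_on S (\<lambda>v. Y (br u v) + Y (br w v))"
      by (rule trace_cong[OF S]) (use u w in \<open>simp add: br_simps linear_on_add[OF Y(1)] L_closed\<close>)
    then show "trace_on S (\<lambda>v. Y (br (u + w) v)) =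
        trace_on S (\<lambda>v. Y (br u v)) + trace_on S (\<lambda>v. Y (br w v))"
      using trace_add[OF S linear_on_comp[OF br_right_linear[OF u] Y(1)]
          linear_on_comp[OF br_right_linear[OF w] Y(1)]] by simp
  next
    fix c u assume u: "u \<in> L"
    have "trace_on S (\<lambda>v. Y (br (c *\<^sub>C u) v)) = trace_on S (\<lambda>v. c *\<^sub>C Y (br u v))"
      by (rule trace_cong[OF S]) (use u in \<open>simp add: br_simps linear_on_scale[OF Y(1)] L_closed\<close>)
    then show "trace_on S (\<lambda>v. Y (br (c *\<^sub>C u) v)) = c *\<^sub>C trace_on S (\<lambda>v. Y (br u v))"
      using trace_scale[OF S linear_on_comp[OF br_right_linear[OF u] Y(1)]]
      by (simp add: scaleC_complex_def)
  qed simp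
  have "trace_on S (\<lambda>v. Y (br x v)) = 0"
    by (rule perfect_kills[OF complex_vector.subspace_UNIV lin tr_br x])
  then show ?thesis using nilpotent_if_conj_trace_zero[OF S f Y _ v] by blast
qed

end

section \<open>Invariant forms and Casimir operators\<close>

context nonlie_simple_leibniz
begin

text \<open>The last clause makes \<open>\<psi>\<close> a form on the Lie algebra
  \<open>L/M\<close>; invariance means that left multiplications are skew.\<close>

definition invariant_form :: "('b \<Rightarrow> 'b \<Rightarrow> complex) \<Rightarrow> bool" where
  "invariant_form \<psi> \<longleftrightarrow> bilinear_on L L UNIV \<psi> \<and>
     (\<forall>x\<in>L. \<forall>y\<in>L. \<psi> x y = \<psi> y x) \<and>
     (\<forall>z\<in>L. \<forall>x\<in>L. \<forall>y\<in>L. \<psi> (br z x) y + \<psi> x (br z y) = 0) \<and>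
     (\<forall>m\<in>M. \<forall>y\<in>L. \<psi> m y = 0)"

lemma invariant_formD:
  assumes "invariant_form \<psi>"
  shows form_right: "x \<in> L \<Longrightarrow> linear_on L UNIV (\<psi> x)"
    and form_left: "y \<in> L \<Longrightarrow> linear_on L UNIV (\<lambda>x. \<psi> x y)"
    and form_sym: "\<lbrakk>x \<in> L; y \<in> L\<rbrakk> \<Longrightarrow> \<psi> x y = \<psi> y x"
    and form_inv: "\<lbrakk>x \<in> L; y \<in> L; z \<in> L\<rbrakk> \<Longrightarrow> \<psi> (br z x) y = - \<psi> x (br z y)"
    and form_M: "\<lbrakk>m \<in> M; y \<in> L\<rbrakk> \<Longrightarrow> \<psi> m y = 0"
    and form_M': "\<lbrakk>m \<in> M; y \<in> L\<rbrakk> \<Longrightarrow> \<psi> y m = 0"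
  using assms M_mem by (auto simp: invariant_form_def bilinear_on_def eq_neg_iff_add_eq_0)

lemma form_radical:
  assumes \<psi>: "invariant_form \<psi>" and ne: "\<exists>x\<in>L. \<exists>y\<in>L. \<psi> x y \<noteq> 0"
    and x: "x \<in> L" "\<And>y. y \<in> L \<Longrightarrow> \<psi> x y = 0"
  shows "x \<in> M"
proof -
  let ?R = "{x \<in> L. \<forall>y\<in>L. \<psi> x y = 0}"
  have "?R = M \<or> ?R = L"
  proof (rule left_ideal_cases)
    show "csubspace ?R"
      unfolding complex_vector.subspace_def
      by (auto simp: L_closed linear_on_zero[OF form_left[OF \<psi>] subspace]
          linear_on_add[OF form_left[OF \<psi>]] linear_on_scale[OF form_left[OF \<psi>]])
    show "M \<subseteq> ?R" using form_M[OF \<psi>] M_mem by blast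
    show "br z y \<in> ?R" if "z \<in> L" "y \<in> ?R" for z y
      using that form_inv[OF \<psi>] by (simp add: br_mem)
  qed blast
  then show ?thesis using ne x by blast
qed

text \<open>In effect an orthonormal basis of \<open>L/M\<close>, encoded by unit squares and the
  expansion of every element modulo \<open>M\<close>. For an invariant form this makes the Gram
  matrix idempotent of trace \<open>n\<close>, hence the identity.\<close>

definition orthonormal_mod_M :: "('b \<Rightarrow> 'b \<Rightarrow> complex) \<Rightarrow> nat \<Rightarrow> (nat \<Rightarrow> 'b) \<Rightarrow> bool" where
  "orthonormal_mod_M \<psi> n e \<longleftrightarrow> n \<noteq> 0 \<and> (\<forall>i<n. e i \<in> L \<and> \<psi> (e i) (e i) = 1) \<and>
     (\<forall>u\<in>L. u - (\<Sum>i<n. \<psi> (e i) u *\<^sub>C e i) \<in> M)"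

lemma orthonormal_mod_M_ex:
  assumes \<psi>: "invariant_form \<psi>" and ne: "\<exists>x\<in>L. \<exists>y\<in>L. \<psi> x y \<noteq> 0"
  shows "\<exists>n e. orthonormal_mod_M \<psi> n e"
proof -
  have "\<exists>n (e :: nat \<Rightarrow> 'b). (\<forall>i<n. e i \<in> L \<and> \<psi> (e i) (e i) = 1) \<and>
      (\<forall>u\<in>L. \<forall>w\<in>L. \<psi> (u - (\<Sum>i<n. \<psi> (e i) u *\<^sub>C e i)) w = 0)"
    using orthonormal_family_ex[OF fin_dim, of \<psi>] \<psi> by (simp add: invariant_form_def)
  then obtain n and e :: "nat \<Rightarrow> 'b" where e: "\<forall>i<n. e i \<in> L \<and> \<psi> (e i) (e i) = 1"
    "\<forall>u\<in>L. \<forall>w\<in>L. \<psi> (u - (\<Sum>i<n. \<psi> (e i) u *\<^sub>C e i)) w = 0" by blast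
  have "u - (\<Sum>i<n. \<psi> (e i) u *\<^sub>C e i) \<in> M" if u: "u \<in> L" for u
  proof (rule form_radical[OF \<psi> ne])
    show "u - (\<Sum>i<n. \<psi> (e i) u *\<^sub>C e i) \<in> L"
      using e(1) u by (auto intro!: L_closed)
  qed (use e(2) u in blast)
  moreover have "n \<noteq> 0"
  proof
    assume "n = 0"
    then show False using e(2) ne by simp
  qed
  ultimately show ?thesis using e(1) unfolding orthonormal_mod_M_def by blast
qed

lemma orthonormal_mod_MD:
  assumes "orthonormal_mod_M \<psi> n e"
  shows "n \<noteq> 0" "\<And>i. i < n \<Longrightarrow> e i \<in> L" "\<And>i. i < n \<Longrightarrow> \<psi> (e i) (e i) = 1"
    "\<And>u. u \<in> L \<Longrightarrow> u - (\<Sum>i<n. \<psi> (e i) u *\<^sub>C e i) \<in> M"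
  using assms by (simp_all add: orthonormal_mod_M_def)

text \<open>The \<open>e i\<close> are representatives of classes modulo \<open>M\<close>; since
  \<open>M\<close> acts by zero from the left, the operator depends only on the classes.\<close>

definition casimir :: "nat \<Rightarrow> (nat \<Rightarrow> 'b) \<Rightarrow> 'b \<Rightarrow> 'b" where
  "casimir n e b = (\<Sum>i<n. br (e i) (br (e i) b))"

text \<open>Invariance makes the matrix of \<open>br v\<close> in the family \<open>e\<close> skew,
  so the sum of the tensor squares of the \<open>e i\<close> is invariant. It is stated for any
  bilinear \<open>\<Phi>\<close> that descends to \<open>L/M\<close>, since it serves both for the
  Casimir operator and for the defect of the Clifford relation.\<close>

lemma casimir_skew:
  assumes \<psi>: "invariant_form \<psi>" and on: "orthonormal_mod_M \<psi> n e"
    and \<Phi>: "bilinear_on L L L \<Phi>" "\<And>m x. \<lbrakk>m \<in> M; x \<in> L\<rbrakk> \<Longrightarrow> \<Phi> m x = 0"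
    "\<And>m x. \<lbrakk>m \<in> M; x \<in> L\<rbrakk> \<Longrightarrow> \<Phi> x m = 0"
    and v: "v \<in> L"
  shows "(\<Sum>i<n. \<Phi> (br v (e i)) (e i) + \<Phi> (e i) (br v (e i))) = 0"
proof -
  note e = orthonormal_mod_MD(2)[OF on] orthonormal_mod_MD(4)[OF on]
  have \<Phi>r: "linear_on L L (\<Phi> x)" and \<Phi>l: "linear_on L L (\<lambda>y. \<Phi> y x)" if "x \<in> L" for x
    using \<Phi>(1) that by (auto simp: bilinear_on_def)
  let ?c = "\<lambda>i j. \<psi> (e j) (br v (e i))"
  have ve: "br v (e i) \<in> L" if "i < n" for i using e(1)[OF that] v by (simp add: br_mem)
  have sL: "(\<Sum>j<n. ?c i j *\<^sub>C e j) \<in> L" for i using e(1) by (intro L_closed) auto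
  have 1: "\<Phi> (br v (e i)) (e i) = (\<Sum>j<n. ?c i j *\<^sub>C \<Phi> (e j) (e i))" if i: "i < n" for i
  proof -
    note l = \<Phi>l[OF e(1)[OF i]]
    have "\<Phi> (br v (e i) - (\<Sum>j<n. ?c i j *\<^sub>C e j)) (e i) = 0"
      using \<Phi>(2)[OF e(2)[OF ve[OF i]] e(1)[OF i]] .
    then have "\<Phi> (br v (e i)) (e i) = \<Phi> (\<Sum>j<n. ?c i j *\<^sub>C e j) (e i)"
      using linear_on_diff[OF l subspace ve[OF i] sL] by simp
    also have "\<dots> = (\<Sum>j<n. \<Phi> (?c i j *\<^sub>C e j) (e i))"
      by (rule linear_on_sum[OF l subspace]) (use e(1) in \<open>auto intro!: L_closed\<close>)
    finally show ?thesis using linear_on_scale[OF l] e(1) by simp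
  qed
  have 2: "\<Phi> (e i) (br v (e i)) = (\<Sum>j<n. ?c i j *\<^sub>C \<Phi> (e i) (e j))" if i: "i < n" for i
  proof -
    note r = \<Phi>r[OF e(1)[OF i]]
    have "\<Phi> (e i) (br v (e i) - (\<Sum>j<n. ?c i j *\<^sub>C e j)) = 0"
      using \<Phi>(3)[OF e(2)[OF ve[OF i]] e(1)[OF i]] .
    then have "\<Phi> (e i) (br v (e i)) = \<Phi> (e i) (\<Sum>j<n. ?c i j *\<^sub>C e j)"
      using linear_on_diff[OF r subspace ve[OF i] sL] by simp
    also have "\<dots> = (\<Sum>j<n. \<Phi> (e i) (?c i j *\<^sub>C e j))"
      by (rule linear_on_sum[OF r subspace]) (use e(1) in \<open>auto intro!: L_closed\<close>)
    finally show ?thesis using linear_on_scale[OF r] e(1) by simp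
  qed
  have "(\<Sum>i<n. \<Phi> (br v (e i)) (e i) + \<Phi> (e i) (br v (e i))) =
      (\<Sum>i<n. \<Sum>j<n. ?c i j *\<^sub>C \<Phi> (e j) (e i)) + (\<Sum>i<n. \<Sum>j<n. ?c i j *\<^sub>C \<Phi> (e i) (e j))"
    using 1 2 by (simp add: sum.distrib)
  also have "(\<Sum>i<n. \<Sum>j<n. ?c i j *\<^sub>C \<Phi> (e i) (e j)) = (\<Sum>i<n. \<Sum>j<n. ?c j i *\<^sub>C \<Phi> (e j) (e i))"
    by (rule sum.swap)
  also have "(\<Sum>i<n. \<Sum>j<n. ?c i j *\<^sub>C \<Phi> (e j) (e i)) + \<dots> =
      (\<Sum>i<n. \<Sum>j<n. (?c i j + ?c j i) *\<^sub>C \<Phi> (e j) (e i))"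
    by (simp add: sum.distrib scaleC_add_left)
  also have "\<dots> = 0"
  proof (intro sum.neutral ballI)
    fix i j assume "i \<in> {..<n}" "j \<in> {..<n}"
    then have "e i \<in> L" "e j \<in> L" using e(1) by auto
    then have "?c i j + ?c j i = 0"
      using form_inv[OF \<psi>, of "e j" "e i" v] form_sym[OF \<psi>, of "e i" "br v (e j)"] v
      by (simp add: br_mem)
    then show "(?c i j + ?c j i) *\<^sub>C \<Phi> (e j) (e i) = 0" by simp
  qed
  finally show ?thesis .
qed

lemma casimir_mem: "\<lbrakk>orthonormal_mod_M \<psi> n e; b \<in> L\<rbrakk> \<Longrightarrow> casimir n e b \<in> L"
  unfolding casimir_def using orthonormal_mod_MD(2) by (intro L_closed) auto

lemma casimir_linear:
  assumes "orthonormal_mod_M \<psi> n e"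
  shows "linear_on L L (casimir n e)"
  by (rule linear_onI, erule casimir_mem[OF assms])
    (auto simp: casimir_def br_simps br_mem orthonormal_mod_MD(2)[OF assms] sum.distrib
      complex_vector.scale_sum_right)

lemma casimir_commute:
  assumes \<psi>: "invariant_form \<psi>" and on: "orthonormal_mod_M \<psi> n e"
    and v: "v \<in> L" and b: "b \<in> L"
  shows "br v (casimir n e b) = casimir n e (br v b)"
proof -
  note e = orthonormal_mod_MD(2)[OF on] orthonormal_mod_MD(4)[OF on]
  let ?\<Phi> = "\<lambda>p q. br p (br q b)"
  have "bilinear_on L L L ?\<Phi>"
    unfolding bilinear_on_def
    using b linear_on_comp[OF br_left_linear[OF b] br_right_linear] br_left_linear
    by (auto simp: br_mem)
  then have skew: "(\<Sum>i<n. ?\<Phi> (br v (e i)) (e i) + ?\<Phi> (e i) (br v (e i))) = 0"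
    using b M_left by (intro casimir_skew[OF \<psi> on _ _ _ v]) (auto simp: br_mem br_simps)
  have step: "br v (br (e i) (br (e i) b)) =
      (?\<Phi> (br v (e i)) (e i) + ?\<Phi> (e i) (br v (e i))) + br (e i) (br (e i) (br v b))"
    if "i < n" for i
    using leibniz[of v "e i" "br (e i) b"] leibniz[of v "e i" b] e(1)[OF that] v b
    by (simp add: br_mem br_simps)
  have "br v (casimir n e b) = (\<Sum>i<n. br v (br (e i) (br (e i) b)))"
    unfolding casimir_def by (rule br_sum(1)[OF v]) (use e b in \<open>auto simp: br_mem\<close>)
  also have "\<dots> = (\<Sum>i<n. ?\<Phi> (br v (e i)) (e i) + ?\<Phi> (e i) (br v (e i))) + casimir n e (br v b)"
    using step by (simp add: casimir_def sum.distrib)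
  finally show ?thesis using skew by simp
qed

lemma split_by_intertwiner:
  assumes T: "linear_on L L T" and comm: "\<forall>v\<in>L. \<forall>b\<in>L. br v (T b) = T (br v b)"
    and TM: "\<forall>m\<in>M. T m = 0" and b: "b \<in> L" "T b \<notin> M"
  shows "csubspace (T ` L)" "T ` L \<subseteq> L" "\<And>x w. \<lbrakk>x \<in> L; w \<in> T ` L\<rbrakk> \<Longrightarrow> br x w \<in> T ` L"
    "T ` L \<inter> M = {0}" "L = T ` L + M"
proof -
  show W: "csubspace (T ` L)" using linear_on_image_subspace[OF T subspace] .
  show WL: "T ` L \<subseteq> L" using linear_on_mem[OF T] by blast
  show stable: "br x w \<in> T ` L" if "x \<in> L" "w \<in> T ` L" for x w
    using that comm br_mem by auto
  let ?K = "{x \<in> L. T x \<in> M}"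
  have "?K = M \<or> ?K = L"
  proof (rule left_ideal_cases)
    show "csubspace ?K" using linear_on_preimage_subspace[OF T subspace M_sub] .
    show "M \<subseteq> ?K" using TM M_mem M_sub by (auto simp: csub)
    show "br x y \<in> ?K" if "x \<in> L" "y \<in> ?K" for x y
      using that comm M_right[of x "T y"] by (simp add: br_mem)
  qed blast
  then have K: "?K = M" using b by blast
  show "T ` L \<inter> M = {0}"
  proof (intro equalityI subsetI)
    fix x assume "x \<in> T ` L \<inter> M"
    then obtain y where "y \<in> L" "x = T y" "T y \<in> M" by blast
    then have "y \<in> M" using K by blast
    then show "x \<in> {0}" using TM \<open>x = T y\<close> by simp
  qed (use W M_sub in \<open>auto simp: csub\<close>)
  have "T ` L + M = M \<or> T ` L + M = L"
  proof (rule left_ideal_cases)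
    show "csubspace (T ` L + M)"
      by (rule subspace_plus[OF W M_sub])
    show "M \<subseteq> T ` L + M"
      using set_zero_plus2[of "T ` L" M] complex_vector.subspace_0[OF W] by simp
    show "T ` L + M \<subseteq> L" using WL M_L by (auto elim!: set_plus_elim simp: L_closed subset_iff)
    show "br x y \<in> T ` L + M" if x: "x \<in> L" and y: "y \<in> T ` L + M" for x y
    proof -
      obtain w m where wm: "y = w + m" "w \<in> T ` L" "m \<in> M" using y by (rule set_plus_elim)
      then have "br x y = br x w + br x m"
        using x WL M_mem by (simp add: br_simps subset_iff)
      then show ?thesis using stable[OF x wm(2)] M_right[OF x wm(3)] by (simp add: set_plus_intro)
    qed
  qed
  moreover have "T b \<in> T ` L + M"
    using set_plus_intro[of "T b" "T ` L" 0 M] b(1) M_sub by (simp add: csub)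
  ultimately show "L = T ` L + M" using b(2) by blast
qed

section \<open>The Killing form as an invariant form, and the invariants of Leib\<close>

lemma killing_invariant:
  assumes S: "is_basis L S"
  shows "invariant_form (killing S)"
  unfolding invariant_form_def
proof (intro conjI ballI)
  have lin: "linear_on L L (\<lambda>v. br x (br y v))" if "x \<in> L" "y \<in> L" for x y
    using that by (intro linear_on_comp[OF br_right_linear br_right_linear])
  have left: "linear_on L UNIV (\<lambda>x. killing S x y)" if y: "y \<in> L" for y
  proof (rule linear_onI)
    fix a b assume ab: "a \<in> L" "b \<in> L"
    show "killing S (a + b) y = killing S a y + killing S b y"
      unfolding killing_def trace_add[OF S lin[OF ab(1) y] lin[OF ab(2) y], symmetric]
      by (rule trace_cong[OF S]) (use ab y in \<open>simp add: br_simps br_mem\<close>)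
  next
    fix a c assume a: "a \<in> L"
    show "killing S (c *\<^sub>C a) y = c *\<^sub>C killing S a y"
      unfolding killing_def scaleC_complex_def trace_scale[OF S lin[OF a y], symmetric]
      by (rule trace_cong[OF S]) (use a y in \<open>simp add: br_simps br_mem\<close>)
  qed simp
  show sym: "killing S x y = killing S y x" if "x \<in> L" "y \<in> L" for x y
    unfolding killing_def using trace_commute[OF S br_right_linear br_right_linear] that .
  have "linear_on L UNIV (killing S x)" if "x \<in> L" for x
    using left[OF that] sym that by (auto simp: linear_on_def L_closed)
  then show "bilinear_on L L UNIV (killing S)"
    using left by (simp add: bilinear_on_def)
  show "killing S m y = 0" if "m \<in> M" "y \<in> L" for m y
    unfolding killing_def by (rule trace_zero[OF S]) (use that M_left in \<open>auto simp: br_mem\<close>)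
  show "killing S (br z x) y + killing S x (br z y) = 0" if "z \<in> L" "x \<in> L" "y \<in> L" for x y z
  proof -
    note zxy = linear_on_comp[OF lin[OF that(2,3)] br_right_linear[OF that(1)]]
      and xzy = linear_on_comp[OF lin[OF that(1,3)] br_right_linear[OF that(2)]]
      and xyz = linear_on_comp[OF lin[OF that(3,1)] br_right_linear[OF that(2)]]
    have "killing S (br z x) y =
        trace_on S (\<lambda>v. br z (br x (br y v)) - br x (br z (br y v)))"
      unfolding killing_def
      by (rule trace_cong[OF S]) (use that in \<open>simp add: left_mult_bracket br_mem\<close>)
    moreover have "killing S x (br z y) =
        trace_on S (\<lambda>v. br x (br z (br y v)) - br x (br y (br z v)))"
      unfolding killing_def
      by (rule trace_cong[OF S]) (use that in \<open>simp add: left_mult_bracket br_mem br_simps\<close>)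
    moreover have "trace_on S (\<lambda>v. br z (br x (br y v))) = trace_on S (\<lambda>v. br x (br y (br z v)))"
      by (rule trace_commute[OF S br_right_linear[OF that(1)] lin[OF that(2,3)]])
    ultimately show ?thesis
      by (simp add: trace_diff[OF S zxy xzy] trace_diff[OF S xzy xyz])
  qed
qed

lemma killing_nonzero:
  assumes "is_basis L S"
  shows "\<exists>x\<in>L. \<exists>y\<in>L. killing S x y \<noteq> 0"
  using killing_zero_imp_nilpotent[OF assms] not_all_nilpotent by blast

lemma invariants_zero:
  assumes m: "m \<in> M" "\<And>x. x \<in> L \<Longrightarrow> br x m = 0"
  shows "m = 0"
proof (rule ccontr)
  assume "m \<noteq> 0"
  let ?Z = "{m \<in> M. \<forall>x\<in>L. br x m = 0}"
  have "?Z = {0} \<or> ?Z = M"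
  proof (rule submodule_cases)
    show "csubspace ?Z"
      unfolding complex_vector.subspace_def
      using M_sub M_mem by (auto simp: csub br_simps)
    show "br x y \<in> ?Z" if "x \<in> L" "y \<in> ?Z" for x y
      using that M_sub by (simp add: csub br_simps)
  qed blast
  then have triv: "br x m' = 0" if "x \<in> L" "m' \<in> M" for x m'
    using m \<open>m \<noteq> 0\<close> that by blast
  obtain S where S: "is_basis L S" using basis_ex[OF fin_dim] by blast
  let ?\<psi> = "killing S"
  note inv = killing_invariant[OF S]
  obtain n e where on: "orthonormal_mod_M ?\<psi> n e"
    using orthonormal_mod_M_ex[OF inv killing_nonzero[OF S]] by blast
  note n = orthonormal_mod_MD(1)[OF on] and e = orthonormal_mod_MD(2)[OF on]
    and e1 = orthonormal_mod_MD(3)[OF on] and ex = orthonormal_mod_MD(4)[OF on]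
  let ?C = "casimir n e"
  have C: "linear_on L L ?C" using casimir_linear[OF on] .
  have CM: "?C m' = 0" if "m' \<in> M" for m'
    using triv that e M_sub by (simp add: casimir_def br_simps)
  have lin: "linear_on L L (\<lambda>v. br (e i) (br (e i) v))" if "i < n" for i
    using linear_on_comp[OF br_right_linear br_right_linear] e[OF that] by blast
  \<comment> \<open>The trace of the Casimir operator is the sum of the squares of the
    \<open>e i\<close>, which is \<open>n\<close>. If the operator mapped \<open>L\<close> into
    \<open>M\<close>, its square would be zero and its trace would vanish.\<close>
  have "trace_on S ?C = (\<Sum>i<n. ?\<psi> (e i) (e i))"
    unfolding casimir_def killing_def by (rule trace_sum[OF S]) (use lin in auto)
  then have "trace_on S ?C \<noteq> 0" using n e1 by simp
  moreover have "trace_on S ?C = 0" if "\<And>b. b \<in> L \<Longrightarrow> ?C b \<in> M"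
    by (rule trace_nilpotent[OF S C]) (use CM that in \<open>auto intro!: exI[of _ 2] simp: numeral_2_eq_2\<close>)
  ultimately obtain b where b: "b \<in> L" "?C b \<notin> M" by blast
  have comm: "\<forall>v\<in>L. \<forall>b\<in>L. br v (?C b) = ?C (br v b)"
    using casimir_commute[OF inv on] by blast
  have kill: "\<forall>m\<in>M. ?C m = 0" using CM by blast
  note split = split_by_intertwiner[OF C comm kill b]
  \<comment> \<open>The complement part \<open>w\<close> has its square in the complement and in
    \<open>M\<close>, hence 0. The mixed terms vanish because here \<open>M\<close> is killed from
    both sides.\<close>
  have "br x x = 0" if x: "x \<in> L" for x
  proof -
    obtain w m' where wm: "x = w + m'" "w \<in> ?C ` L" "m' \<in> M"
      using x split(5) by (metis set_plus_elim)
    have wL: "w \<in> L" "m' \<in> L" using wm split(2) M_mem by auto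
    have "br w w \<in> ?C ` L \<inter> M" using split(3)[OF wL(1) wm(2)] square_mem[OF wL(1)] by blast
    then have "br w w = 0" using split(4) by blast
    then show ?thesis
      using wm wL triv[of _ m'] M_left[of m'] by (simp add: br_simps L_closed)
  qed
  then have "lie_algebra L br" by unfold_locales auto
  then show False using nonlie by blast
qed

text \<open>The annihilator of \<open>M\<close> is left stable and contains \<open>M\<close>; it is
  not \<open>L\<close>, since \<open>M\<close> has no nonzero invariants. Identities modulo
  \<open>M\<close> can therefore be verified by their action on \<open>M\<close>.\<close>

lemma kernel_M:
  assumes "z \<in> L" "\<And>m. m \<in> M \<Longrightarrow> br z m = 0"
  shows "z \<in> M"
proof -
  let ?K = "{z \<in> L. \<forall>m\<in>M. br z m = 0}"
  have "?K = M \<or> ?K = L"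
  proof (rule left_ideal_cases)
    show "csubspace ?K"
      unfolding complex_vector.subspace_def using M_mem by (auto simp: L_closed br_simps)
    show "M \<subseteq> ?K" using M_left M_mem by blast
    show "br x y \<in> ?K" if "x \<in> L" "y \<in> ?K" for x y
      using that M_mem M_right by (auto simp: br_mem left_mult_bracket br_simps)
  qed blast
  moreover have "?K \<noteq> L"
  proof
    assume "?K = L"
    then have "m = 0" if "m \<in> M" for m using invariants_zero[OF that] that by blast
    then show False using M_nonzero M_sub csub(3) by blast
  qed
  ultimately show ?thesis using assms by blast
qed

section \<open>The Clifford relation\<close>

text \<open>If \<open>\<psi>\<close> vanished, computing \<open>[w, v] c\<close> in two ways would
  make \<open>[w, u] (v m)\<close> symmetric in \<open>w\<close> and \<open>v\<close>. It is
  antisymmetric in \<open>w\<close> and \<open>u\<close>, and these two symmetries together force it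
  to be 0. Perfectness then makes all \<open>v m\<close> invariant, hence 0, so \<open>m\<close> is
  invariant too.\<close>

lemma clifford_form_nonzero:
  assumes H: "\<And>m u. \<lbrakk>m \<in> M; u \<in> L\<rbrakk> \<Longrightarrow> \<exists>c\<in>M. \<forall>v\<in>L. br v c = \<psi> u v *\<^sub>C m - br u (br v m)"
  shows "\<exists>x\<in>L. \<exists>y\<in>L. \<psi> x y \<noteq> 0"
proof (rule ccontr)
  assume "\<not> ?thesis"
  then have zero: "\<psi> x y = 0" if "x \<in> L" "y \<in> L" for x y using that by blast
  let ?t = "\<lambda>w u v m. br (br w u) (br v m)"
  have cyc: "?t w u v m = ?t v u w m" if uvw: "u \<in> L" "v \<in> L" "w \<in> L" and m: "m \<in> M" for u v w m
  proof -
    obtain c where c: "c \<in> M" "\<And>v. v \<in> L \<Longrightarrow> br v c = \<psi> u v *\<^sub>C m - br u (br v m)"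
      using H[OF m uvw(1)] by blast
    have c': "br v c = - br u (br v m)" if "v \<in> L" for v using c(2)[OF that] zero[OF uvw(1) that] by simp
    have L: "m \<in> L" "c \<in> L" using m c M_mem by auto
    have "br (br w v) c = br w (br v c) - br v (br w c)"
      using left_mult_bracket[of w v c] uvw L by blast
    then have "br u (br (br w v) m) = br w (br u (br v m)) - br v (br u (br w m))"
      using c' uvw L by (simp add: br_mem br_simps algebra_simps)
    then show ?thesis
      using uvw L by (simp add: left_mult_bracket br_mem br_simps algebra_simps)
  qed
  have anti: "?t w u v m = - ?t u w v m" if "u \<in> L" "v \<in> L" "w \<in> L" "m \<in> M" for u v w m
  proof -
    have "br (br w u + br u w) (br v m) = 0"
      using M_left[OF sym_mem[of w u]] that M_mem by (simp add: br_mem)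
    then show ?thesis using that M_mem by (simp add: br_simps br_mem eq_neg_iff_add_eq_0)
  qed
  have t0: "?t w u v m = 0" if "u \<in> L" "v \<in> L" "w \<in> L" "m \<in> M" for u v w m
  proof -
    \<comment> \<open>Applying the two symmetries alternately runs through all six orders of
      \<open>u\<close>, \<open>v\<close>, \<open>w\<close> and comes back with sign -1.\<close>
    have "?t w u v m = - ?t w u v m"
      using cyc[of u v w m] anti[of u w v m] cyc[of v w u m] anti[of w u v m] cyc[of w u v m]
        anti[of u v w m] that by simp
    then have "2 *\<^sub>C ?t w u v m = 0"
      by (metis add_eq_0_iff2 one_add_one scaleC_add_left scaleC_one)
    then show ?thesis by simp
  qed
  have "br v m = 0" if v: "v \<in> L" and m: "m \<in> M" for v m
  proof (rule invariants_zero[OF M_right[OF v m]])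
    fix x assume "x \<in> L"
    then show "br x (br v m) = 0"
      using perfect_kills[OF subspace br_left_linear[of "br v m"]] t0 v m M_mem br_mem by blast
  qed
  then have "m = 0" if "m \<in> M" for m using invariants_zero that by blast
  then show False using M_nonzero M_sub csub(3) by blast
qed

text \<open>If \<open>c\<close> were \<open>br u m\<close>, hypothesis \<open>H\<close> would be
  exactly the relation to be shown, so the point is that the defect \<open>c - br u m\<close>
  vanishes. The Casimir operator of \<open>\<psi>\<close> multiplies every element of
  \<open>M\<close> by n/2 but sends such a defect to 0.\<close>

lemma clifford:
  assumes \<psi>: "invariant_form \<psi>"
    and H: "\<And>m u. \<lbrakk>m \<in> M; u \<in> L\<rbrakk> \<Longrightarrow> \<exists>c\<in>M. \<forall>v\<in>L. br v c = \<psi> u v *\<^sub>C m - br u (br v m)"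
    and uv: "u \<in> L" "v \<in> L" and m: "m \<in> M"
  shows "br u (br v m) + br v (br u m) = \<psi> u v *\<^sub>C m"
proof -
  note ne = clifford_form_nonzero[OF H]
  obtain n e where on: "orthonormal_mod_M \<psi> n e"
    using orthonormal_mod_M_ex[OF \<psi> ne] by blast
  note n = orthonormal_mod_MD(1)[OF on] and e = orthonormal_mod_MD(2)[OF on]
    and e1 = orthonormal_mod_MD(3)[OF on] and ex = orthonormal_mod_MD(4)[OF on]
  let ?C = "casimir n e"
  note comm = casimir_commute[OF \<psi> on] and C = casimir_linear[OF on]
  define s where "s m u v = \<psi> u v *\<^sub>C m - br u (br v m) - br v (br u m)" for m u v
  have ssym: "s m u v = s m v u" if "u \<in> L" "v \<in> L" for m u v
    using form_sym[OF \<psi> that] by (simp add: s_def algebra_simps)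
  text \<open>There are \<open>f u \<in> M\<close> with \<open>s m u v = br v (f u)\<close>. Since this is symmetric in \<open>u\<close> and
    \<open>v\<close>, the Casimir operator sends \<open>f w\<close> to \<open>br w F\<close> for a vector \<open>F\<close> independent of \<open>w\<close>,
    and the same symmetry shows that \<open>F\<close> is invariant, hence \<open>0\<close>.\<close>
  have *: "of_nat n *\<^sub>C m = 2 *\<^sub>C ?C m \<and> (\<forall>g\<in>M. (\<forall>v\<in>L. br v g = s m w v) \<longrightarrow> ?C g = 0)"
    if m: "m \<in> M" and w: "w \<in> L" for m w
  proof -
    have mL: "m \<in> L" using m M_mem by blast
    have "\<exists>f\<in>M. \<forall>v\<in>L. br v f = s m u v" if u: "u \<in> L" for u
    proof -
      obtain c where c: "c \<in> M" "\<And>v. v \<in> L \<Longrightarrow> br v c = \<psi> u v *\<^sub>C m - br u (br v m)"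
        using H[OF m u] by blast
      have "br v (c - br u m) = s m u v" if "v \<in> L" for v
        using c(2)[OF that] that u mL c(1) M_mem by (simp add: br_simps br_mem s_def)
      then show ?thesis using c(1) M_right[OF u m] M_sub by (intro bexI[of _ "c - br u m"]) (auto simp: csub)
    qed
    then obtain f where f: "\<And>u. u \<in> L \<Longrightarrow> f u \<in> M" "\<And>u v. \<lbrakk>u \<in> L; v \<in> L\<rbrakk> \<Longrightarrow> br v (f u) = s m u v"
      by metis
    have fL: "f u \<in> L" if "u \<in> L" for u using f(1) that M_mem by blast
    define F where "F = (\<Sum>i<n. br (e i) (f (e i)))"
    have FM: "F \<in> M" unfolding F_def using f(1) e M_right M_sub by (auto intro!: csub)
    then have FL: "F \<in> L" using M_mem by blast
    have bil: "bilinear_on L L L (s m)"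
      unfolding bilinear_on_def linear_on_def s_def
      using mL form_right[OF \<psi>] form_left[OF \<psi>]
      by (auto simp: L_closed br_simps linear_on_add[OF form_right[OF \<psi>]]
          linear_on_add[OF form_left[OF \<psi>]] linear_on_scale[OF form_right[OF \<psi>]]
          linear_on_scale[OF form_left[OF \<psi>]] scaleC_add_left scaleC_complex_def
          complex_vector.scale_right_diff_distrib scaleC_scaleC)
    have sM: "s m x k = 0" if "k \<in> M" "x \<in> L" for k x
      using that M_left mL form_M'[OF \<psi> that] M_right[OF that(2) m] M_mem
      by (simp add: s_def br_simps br_mem)
    have Ms: "s m k x = 0" if "k \<in> M" "x \<in> L" for k x
      using sM[OF that] ssym that M_mem by simp
    \<comment> \<open>\<open>s m\<close> descends to \<open>L/M\<close> and is symmetric, so the sum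
      that vanishes by \<open>casimir_skew\<close> consists of two equal halves.\<close>
    have skew: "(\<Sum>i<n. s m (br x (e i)) (e i)) = 0" if x: "x \<in> L" for x
    proof -
      have "(\<Sum>i<n. s m (br x (e i)) (e i) + s m (e i) (br x (e i))) = 0"
        by (rule casimir_skew[OF \<psi> on bil Ms sM x])
      moreover have "(\<Sum>i<n. s m (br x (e i)) (e i) + s m (e i) (br x (e i))) =
          2 *\<^sub>C (\<Sum>i<n. s m (br x (e i)) (e i))"
        unfolding complex_vector.scale_sum_right
      proof (rule sum.cong[OF refl])
        fix i assume "i \<in> {..<n}"
        then have "s m (e i) (br x (e i)) = s m (br x (e i)) (e i)"
          using ssym e x br_mem by simp
        moreover have "2 *\<^sub>C y = y + y" for y :: 'b
          by (metis one_add_one scaleC_add_left scaleC_one)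
        ultimately show "s m (br x (e i)) (e i) + s m (e i) (br x (e i)) = 2 *\<^sub>C s m (br x (e i)) (e i)"
          by simp
      qed
      ultimately show ?thesis by simp
    qed
    have Cf: "?C (f x) = br x F" if x: "x \<in> L" for x
    proof -
      have "br (e i) (br (e i) (f x)) = br x (br (e i) (f (e i))) - s m (br x (e i)) (e i)" if "i < n" for i
      proof -
        have ei: "e i \<in> L" using e that by blast
        have "br (e i) (br (e i) (f x)) = br (e i) (br x (f (e i)))"
          using f(2) ssym ei x by simp
        also have "\<dots> = br x (br (e i) (f (e i))) - br (br x (e i)) (f (e i))"
          using left_mult_bracket[of x "e i" "f (e i)"] ei x fL by simp
        also have "br (br x (e i)) (f (e i)) = s m (br x (e i)) (e i)"
          using f(2)[OF ei] ssym ei x br_mem by simp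
        finally show ?thesis .
      qed
      then have "?C (f x) = (\<Sum>i<n. br x (br (e i) (f (e i)))) - (\<Sum>i<n. s m (br x (e i)) (e i))"
        by (simp add: casimir_def sum_subtractf)
      also have "(\<Sum>i<n. br x (br (e i) (f (e i)))) = br x F"
        unfolding F_def using br_sum(1)[OF x, of "{..<n}" "\<lambda>i. br (e i) (f (e i))"] e fL
        by (simp add: br_mem)
      finally show ?thesis using skew[OF x] by simp
    qed
    have comm_zero: "br (br x y) F = 0" if xy: "x \<in> L" "y \<in> L" for x y
    proof -
      have "br x (br y F) = ?C (s m y x)"
        using Cf[OF xy(2)] comm[OF xy(1), of "f y"] fL[OF xy(2)] f(2)[OF xy(2,1)] by simp
      moreover have "br y (br x F) = ?C (s m x y)"
        using Cf[OF xy(1)] comm[OF xy(2), of "f x"] fL[OF xy(1)] f(2)[OF xy] by simp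
      ultimately show ?thesis using left_mult_bracket[OF xy FL] ssym[OF xy] by simp
    qed
    have F0: "F = 0"
    proof (rule invariants_zero[OF FM])
      show "br x F = 0" if "x \<in> L" for x
        using perfect_kills[OF subspace br_left_linear[OF FL] comm_zero that] .
    qed
    \<comment> \<open>Since each \<open>e i\<close> has square 1, \<open>s m (e i) (e i)\<close> is
      \<open>m\<close> minus twice the i-th term of the Casimir operator; \<open>F = 0\<close> thus
      determines the scalar by which that operator acts.\<close>
    have "F = (\<Sum>i<n. m - 2 *\<^sub>C br (e i) (br (e i) m))"
      unfolding F_def
    proof (rule sum.cong[OF refl])
      fix i assume "i \<in> {..<n}"
      then show "br (e i) (f (e i)) = m - 2 *\<^sub>C br (e i) (br (e i) m)"
        using f(2) e e1 scaleC_add_left[of 1 1 "br (e i) (br (e i) m)"]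
        by (simp add: s_def scaleC_one)
    qed
    also have "\<dots> = of_nat n *\<^sub>C m - 2 *\<^sub>C ?C m"
      by (simp add: sum_subtractf casimir_def complex_vector.scale_sum_right
          complex_vector.sum_constant_scale)
    finally have "of_nat n *\<^sub>C m = 2 *\<^sub>C ?C m" using F0 by simp
    moreover have "?C g = 0" if g: "g \<in> M" "\<forall>v\<in>L. br v g = s m w v" for g
    proof -
      have "g - f w \<in> M" using g(1) f(1)[OF w] M_sub by (simp add: csub)
      moreover have "br v (g - f w) = 0" if "v \<in> L" for v
        using that g f(2)[OF w that] fL[OF w] M_mem by (simp add: br_simps)
      ultimately have "g - f w = 0" using invariants_zero by blast
      then show ?thesis using Cf[OF w] F0 w by (simp add: br_simps)
    qed
    ultimately show ?thesis by blast
  qed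
  obtain c where c: "c \<in> M" "\<And>v. v \<in> L \<Longrightarrow> br v c = \<psi> u v *\<^sub>C m - br u (br v m)"
    using H[OF m uv(1)] by blast
  let ?f = "c - br u m"
  have fM: "?f \<in> M" using c(1) M_right[OF uv(1) m] M_sub by (simp add: csub)
  have fs: "br v ?f = s m u v" if "v \<in> L" for v
    using c(2)[OF that] that uv(1) m c(1) M_mem by (simp add: br_simps br_mem s_def)
  have "?C ?f = 0" using *[OF m uv(1)] fM fs by blast
  then have "of_nat n *\<^sub>C ?f = 0" using *[OF fM uv(1)] by simp
  then have "?f = 0" using n by simp
  then have "s m u v = 0" using fs[OF uv(2)] uv(2) by (simp add: br_simps)
  then show ?thesis by (simp add: s_def algebra_simps)
qed

end

context nonlie_simple_leibniz
begin

section \<open>The double bracket formula and a complement of Leib\<close>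

definition clifford_form :: "('b \<Rightarrow> 'b \<Rightarrow> complex) \<Rightarrow> bool" where
  "clifford_form \<psi> \<longleftrightarrow> invariant_form \<psi> \<and> (\<exists>x\<in>L. \<exists>y\<in>L. \<psi> x y \<noteq> 0) \<and>
     (\<forall>u\<in>L. \<forall>v\<in>L. \<forall>m\<in>M. br u (br v m) + br v (br u m) = \<psi> u v *\<^sub>C m)"

text \<open>By \<open>kernel_M\<close> only the actions on \<open>M\<close> have to be compared.
  Moving \<open>v\<close> past \<open>u\<close> and then past \<open>w\<close> with the Clifford
  relation leaves the two terms on the right, just as commutators of generators of a Clifford
  algebra act on generators as infinitesimal rotations.\<close>

lemma double_bracket:
  assumes \<psi>: "clifford_form \<psi>" and L: "u \<in> L" "v \<in> L" "w \<in> L"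
  shows "br (br w u) v - ((2 * \<psi> u v) *\<^sub>C w - (2 * \<psi> w v) *\<^sub>C u) \<in> M"
proof (rule kernel_M)
  show "br (br w u) v - ((2 * \<psi> u v) *\<^sub>C w - (2 * \<psi> w v) *\<^sub>C u) \<in> L"
    using L by (simp add: L_closed)
  fix m assume m: "m \<in> M"
  have mL: "m \<in> L" using m M_mem by blast
  have cl: "br x (br y k) = \<psi> x y *\<^sub>C k - br y (br x k)" if "x \<in> L" "y \<in> L" "k \<in> M" for x y k
    using \<psi> that by (simp add: clifford_form_def eq_diff_eq)
  have uM: "br u m \<in> M" "br w m \<in> M" "br v m \<in> M" using M_right L m by auto
  have 1: "br w (br u (br v m)) = \<psi> u v *\<^sub>C br w m - (\<psi> w v *\<^sub>C br u m - br v (br w (br u m)))"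
    using cl[OF L(1,2) m] cl[OF L(3,2) uM(1)] L mL by (simp add: br_simps L_closed)
  have 2: "br u (br w (br v m)) = \<psi> w v *\<^sub>C br u m - (\<psi> u v *\<^sub>C br w m - br v (br u (br w m)))"
    using cl[OF L(3,2) m] cl[OF L(1,2) uM(2)] L mL by (simp add: br_simps L_closed)
  have two: "(2 * c) *\<^sub>C x = c *\<^sub>C x + c *\<^sub>C x" for c and x :: 'b
    by (metis mult_2 scaleC_add_left)
  have "br (br (br w u) v) m =
      br w (br u (br v m)) - br u (br w (br v m)) - (br v (br w (br u m)) - br v (br u (br w m)))"
    using L mL by (simp add: left_mult_bracket L_closed br_simps)
  also have "\<dots> = (2 * \<psi> u v) *\<^sub>C br w m - (2 * \<psi> w v) *\<^sub>C br u m"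
    unfolding 1 2 two by (simp add: algebra_simps)
  finally show "br (br (br w u) v - ((2 * \<psi> u v) *\<^sub>C w - (2 * \<psi> w v) *\<^sub>C u)) m = 0"
    using L mL by (simp add: br_simps L_closed)
qed

text \<open>Modulo \<open>M\<close> the operator \<open>C - n/2\<close> below is multiplication by \<open>3n/2 - 2 \<noteq> 0\<close>.\<close>

lemma left_invariant_complement_ex:
  assumes \<psi>: "clifford_form \<psi>"
  shows "\<exists>g. csubspace g \<and> g \<subseteq> L \<and> (\<forall>x\<in>L. \<forall>w\<in>g. br x w \<in> g) \<and> g \<inter> M = {0} \<and> L = g + M"
proof -
  have inv: "invariant_form \<psi>" and ne: "\<exists>x\<in>L. \<exists>y\<in>L. \<psi> x y \<noteq> 0"
    and cl: "\<And>u v m. \<lbrakk>u \<in> L; v \<in> L; m \<in> M\<rbrakk> \<Longrightarrow> br u (br v m) + br v (br u m) = \<psi> u v *\<^sub>C m"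
    using \<psi> by (auto simp: clifford_form_def)
  obtain n e where on: "orthonormal_mod_M \<psi> n e"
    using orthonormal_mod_M_ex[OF inv ne] by blast
  note n = orthonormal_mod_MD(1)[OF on] and e = orthonormal_mod_MD(2)[OF on]
    and e1 = orthonormal_mod_MD(3)[OF on] and ex = orthonormal_mod_MD(4)[OF on]
  let ?C = "casimir n e"
  define k h :: complex where kh: "k = of_nat n" "h = k / 2"
  define T where "T b = ?C b - h *\<^sub>C b" for b
  have C: "linear_on L L ?C" using casimir_linear[OF on] .
  have id: "linear_on L L (\<lambda>b. b)" by (auto simp: linear_on_def)
  have T: "linear_on L L T"
    unfolding T_def using linear_on_combine[OF C linear_on_combine(3)[OF id id subspace] subspace] by blast
  have comm: "\<forall>v\<in>L. \<forall>b\<in>L. br v (T b) = T (br v b)"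
    using casimir_commute[OF inv on] casimir_mem[OF on] by (simp add: T_def br_simps L_closed)
  have kill: "\<forall>m\<in>M. T m = 0"
  proof
    fix m assume m: "m \<in> M"
    have "br (e i) (br (e i) m) = (1/2) *\<^sub>C m" if "i < n" for i
    proof -
      have "br (e i) (br (e i) m) + br (e i) (br (e i) m) = m"
        using cl[OF e[OF that] e[OF that] m] e1[OF that] by (simp add: scaleC_one)
      then have "(1/2) *\<^sub>C m = (1/2 + 1/2) *\<^sub>C br (e i) (br (e i) m)"
        by (metis scaleC_add_left scaleC_add_right)
      then show ?thesis by (simp add: scaleC_one)
    qed
    then have "?C m = of_nat n *\<^sub>C ((1/2) *\<^sub>C m)"
      by (simp add: casimir_def complex_vector.sum_constant_scale)
    then show "T m = 0" by (simp add: T_def scaleC_scaleC kh)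
  qed
  obtain b where b: "b \<in> L" "b \<notin> M" using M_neq_L M_L by blast
  have "T b \<notin> M"
  proof
    assume Tb: "T b \<in> M"
    \<comment> \<open>This is \<open>double_bracket\<close> with \<open>e i\<close> in two places,
      after exchanging the order of the outer bracket modulo \<open>M\<close>. Summed over
      \<open>i\<close> it gives 2n times \<open>b\<close> minus twice the expansion of
      \<open>b\<close>, so the Casimir scalar on \<open>L/M\<close> is 2n - 2.\<close>
    have sq: "br (e i) (br (e i) b) - (2 *\<^sub>C b - (2 * \<psi> (e i) b) *\<^sub>C e i) \<in> M" if "i < n" for i
    proof -
      note ei = e[OF that]
      let ?x = "br (e i) b"
      have xL: "?x \<in> L" using ei b by (simp add: br_mem)
      have "br ?x (e i) - ((2 * \<psi> b (e i)) *\<^sub>C e i - (2 * \<psi> (e i) (e i)) *\<^sub>C b) \<in> M"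
        using double_bracket[OF \<psi> b(1) ei ei] .
      moreover have "br (e i) ?x + br ?x (e i) \<in> M" using sym_mem ei xL by blast
      ultimately have "(br (e i) ?x + br ?x (e i)) -
          (br ?x (e i) - ((2 * \<psi> b (e i)) *\<^sub>C e i - (2 * \<psi> (e i) (e i)) *\<^sub>C b)) \<in> M"
        using M_sub csub(4) by blast
      then show ?thesis
        using e1[OF that] form_sym[OF inv b(1) ei] by (simp add: algebra_simps)
    qed
    let ?p = "\<Sum>i<n. \<psi> (e i) b *\<^sub>C e i"
    have "(\<Sum>i<n. br (e i) (br (e i) b) - (2 *\<^sub>C b - (2 * \<psi> (e i) b) *\<^sub>C e i)) \<in> M"
      using sq by (intro complex_vector.subspace_sum[OF M_sub]) auto
    also have "(\<Sum>i<n. br (e i) (br (e i) b) - (2 *\<^sub>C b - (2 * \<psi> (e i) b) *\<^sub>C e i)) =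
        ?C b - (k *\<^sub>C (2 *\<^sub>C b) - 2 *\<^sub>C ?p)"
      by (simp add: sum_subtractf casimir_def complex_vector.sum_constant_scale
          complex_vector.scale_sum_right scaleC_scaleC kh(1))
    finally have 1: "?C b - (k *\<^sub>C (2 *\<^sub>C b) - 2 *\<^sub>C ?p) \<in> M" .
    have 2: "2 *\<^sub>C (b - ?p) \<in> M" using ex[OF b(1)] M_sub by (simp add: csub)
    have "T b - (?C b - (k *\<^sub>C (2 *\<^sub>C b) - 2 *\<^sub>C ?p)) + 2 *\<^sub>C (b - ?p) \<in> M"
      using complex_vector.subspace_add[OF M_sub complex_vector.subspace_diff[OF M_sub Tb 1] 2] .
    also have "T b - (?C b - (k *\<^sub>C (2 *\<^sub>C b) - 2 *\<^sub>C ?p)) + 2 *\<^sub>C (b - ?p) =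
        (k * 2 + 2 - h) *\<^sub>C b - 4 *\<^sub>C ?p"
    proof -
      have "4 *\<^sub>C ?p = 2 *\<^sub>C ?p + 2 *\<^sub>C ?p"
        using scaleC_add_left[of 2 2 ?p] by simp
      then show ?thesis
        by (simp add: T_def scaleC_add_left complex_vector.scale_left_diff_distrib
            complex_vector.scale_right_diff_distrib scaleC_scaleC)
    qed
    finally have 3: "(k * 2 + 2 - h) *\<^sub>C b - 4 *\<^sub>C ?p \<in> M" .
    have 4: "4 *\<^sub>C (b - ?p) \<in> M" using ex[OF b(1)] M_sub by (simp add: csub)
    have "((k * 2 + 2 - h) *\<^sub>C b - 4 *\<^sub>C ?p) - 4 *\<^sub>C (b - ?p) \<in> M"
      using complex_vector.subspace_diff[OF M_sub 3 4] .
    also have "((k * 2 + 2 - h) *\<^sub>C b - 4 *\<^sub>C ?p) - 4 *\<^sub>C (b - ?p) =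
        (k * 2 + 2 - h) *\<^sub>C b - 4 *\<^sub>C b"
      by (simp add: complex_vector.scale_right_diff_distrib)
    also have "\<dots> = ((k * 2 + 2 - h) - 4) *\<^sub>C b"
      by (rule complex_vector.scale_left_diff_distrib[symmetric])
    finally have 5: "((k * 2 + 2 - h) - 4) *\<^sub>C b \<in> M" .
    \<comment> \<open>The scalar is 3n/2 - 2, which vanishes only for \<open>3 * n = 4\<close>,
      impossible for a natural number.\<close>
    have nz: "(k * 2 + 2 - h) - 4 \<noteq> (0::complex)"
    proof
      assume "(k * 2 + 2 - h) - 4 = (0::complex)"
      then have "of_nat (3 * n) = (of_nat 4 :: complex)" by (simp add: kh field_simps)
      then have "3 * n = 4" using of_nat_eq_iff by blast
      then show False by presburger
    qed
    have "inverse ((k * 2 + 2 - h) - 4) *\<^sub>C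
        (((k * 2 + 2 - h) - 4) *\<^sub>C b) \<in> M"
      using 5 complex_vector.subspace_scale[OF M_sub] by blast
    then show False using b(2) nz by (simp add: scaleC_scaleC scaleC_one)
  qed
  then show ?thesis using split_by_intertwiner[OF T comm kill b(1)] by blast
qed

text \<open>Squares of elements of \<open>g\<close> lie in both \<open>g\<close> and
  \<open>M\<close>, so they are 0 and \<open>g\<close> is a Lie algebra. An ideal \<open>I\<close>
  of \<open>g\<close> gives the left stable space \<open>I + M\<close>; and as \<open>M\<close> acts
  by zero, submodules of \<open>M\<close> under \<open>g\<close> are submodules under
  \<open>L\<close>.\<close>

lemma complement_simple:
  assumes g: "csubspace g" "g \<subseteq> L" "\<And>x w. \<lbrakk>x \<in> L; w \<in> g\<rbrakk> \<Longrightarrow> br x w \<in> g"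
    and dec: "g \<inter> M = {0}" "L = g + M"
  shows "simple_lie_algebra g br" "simple_lie_module g br M br"
proof -
  have gL: "x \<in> L" if "x \<in> g" for x using that g(2) by blast
  have dec': "\<exists>w\<in>g. \<exists>m\<in>M. x = w + m" if "x \<in> L" for x
    using that dec(2) by (metis set_plus_elim)
  have leib: "left_leibniz_algebra g br"
  proof
    show "bilinear_on g g g br"
      using g gL by (auto simp: bilinear_on_def linear_on_def br_simps)
    show "br a (br b c) = br (br a b) c + br b (br a c)" if "a \<in> g" "b \<in> g" "c \<in> g" for a b c
      using that leibniz gL by blast
  qed (fact g(1))
  interpret g: left_leibniz_algebra g br by (fact leib)
  have sq0: "br x x = 0" if "x \<in> g" for x
    using that g(3) square_mem gL dec(1) by blast
  interpret g: lie_algebra g br by unfold_locales (fact sq0)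
  show "simple_lie_algebra g br"
  proof
    show "\<exists>x\<in>g. \<exists>y\<in>g. br x y \<noteq> 0"
    proof (rule ccontr)
      assume "\<not> ?thesis"
      then have zero: "br x y = 0" if "x \<in> g" "y \<in> g" for x y using that by blast
      have "br x y \<in> M" if xy: "x \<in> L" "y \<in> L" for x y
      proof -
        obtain w k m l where *: "x = w + m" "y = k + l" "w \<in> g" "k \<in> g" "m \<in> M" "l \<in> M"
          using dec'[OF xy(1)] dec'[OF xy(2)] by blast
        then have "br x y = br w l"
          using zero[of w k] gL M_mem M_left[of m] by (simp add: br_simps L_closed)
        then show ?thesis using * M_right gL by simp
      qed
      then have "L \<subseteq> M" using perfect_subset[OF M_sub] by blast
      then show False using M_neq_L M_L by blast
    qed
    fix I assume I: "leibniz_ideal I g br"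
    then have I': "csubspace I" "I \<subseteq> g" "\<And>x y. \<lbrakk>x \<in> g; y \<in> I\<rbrakk> \<Longrightarrow> br x y \<in> I"
      by (auto simp: leibniz_ideal_def)
    have IM: "M \<subseteq> I + M"
      using set_zero_plus2[of I M] complex_vector.subspace_0[OF I'(1)] by simp
    have II: "I \<subseteq> I + M"
      using set_zero_plus2[of M I] complex_vector.subspace_0[OF M_sub] by (simp add: add.commute)
    have "I + M = M \<or> I + M = L"
    proof (rule left_ideal_cases[OF subspace_plus[OF I'(1) M_sub] IM])
      show "I + M \<subseteq> L"
        using I'(2) gL M_mem by (auto elim!: set_plus_elim simp: L_closed subset_iff)
      fix x y assume x: "x \<in> L" and y: "y \<in> I + M"
      obtain w m where wm: "x = w + m" "w \<in> g" "m \<in> M" using dec'[OF x] by blast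
      obtain i l where il: "y = i + l" "i \<in> I" "l \<in> M" using y by (rule set_plus_elim)
      have "i \<in> L" using il I'(2) gL by blast
      then have "br x y = br w i + br w l"
        using wm il gL[OF wm(2)] M_mem[OF wm(3)] M_mem[OF il(3)] M_left[OF wm(3)]
        by (simp add: br_simps L_closed)
      then show "br x y \<in> I + M"
        using I'(3)[OF wm(2) il(2)] M_right[OF gL[OF wm(2)] il(3)] by (simp add: set_plus_intro)
    qed
    then show "I \<in> {{0}, g}"
    proof
      assume "I + M = M"
      then have "I \<subseteq> g \<inter> M" using II I'(2) by blast
      then show ?thesis using dec(1) complex_vector.subspace_0[OF I'(1)] by blast
    next
      assume IL: "I + M = L"
      have "g \<subseteq> I"
      proof
        fix w assume w: "w \<in> g"
        then have "w \<in> I + M" using gL IL by blast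
        then obtain i m where im: "w = i + m" "i \<in> I" "m \<in> M" by (rule set_plus_elim)
        then have "m = w - i" by simp
        then have "m \<in> g" using w im(2) I'(2) g(1) by (simp add: csub subset_iff)
        then have "m = 0" using im(3) dec(1) by blast
        then show "w \<in> I" using im by simp
      qed
      then show ?thesis using I'(2) by blast
    qed
  qed
  show "simple_lie_module g br M br"
  proof
    show "csubspace M" by (fact M_sub)
    show "bilinear_on g M M br"
      using gL M_mem M_right by (auto simp: bilinear_on_def linear_on_def br_simps)
    show "br (br x y) m = br x (br y m) - br y (br x m)" if "x \<in> g" "y \<in> g" "m \<in> M" for x y m
      using left_mult_bracket that gL M_mem by blast
    show "M \<noteq> {0}" by (fact M_nonzero)
    fix W assume W: "csubspace W" "W \<subseteq> M" "\<forall>x\<in>g. \<forall>w\<in>W. br x w \<in> W"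
    have "W = {0} \<or> W = M"
    proof (rule submodule_cases[OF W(1,2)])
      fix x y assume x: "x \<in> L" and y: "y \<in> W"
      obtain w m where wm: "x = w + m" "w \<in> g" "m \<in> M" using dec'[OF x] by blast
      have yL: "y \<in> L" using y W(2) M_mem by blast
      then have "br x y = br w y"
        using wm gL[OF wm(2)] M_mem[OF wm(3)] M_left[OF wm(3) yL] by (simp add: br_simps)
      then show "br x y \<in> W" using W(3) wm y by simp
    qed
    then show "W \<in> {{0}, M}" by blast
  qed
qed

end

section \<open>Finite-dimensional commutative algebras\<close>

context comm_algebra
begin

lemma mul_linear: "a \<in> A \<Longrightarrow> linear_on A A (mul a)"
  and mul_linear_left: "b \<in> A \<Longrightarrow> linear_on A A (\<lambda>a. mul a b)"
  using bilinear by (auto simp: bilinear_on_def)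

lemma mul_mem: "\<lbrakk>a \<in> A; b \<in> A\<rbrakk> \<Longrightarrow> mul a b \<in> A"
  using linear_on_mem[OF mul_linear] .

lemma mul_simps:
  "\<lbrakk>a \<in> A; b \<in> A; c \<in> A\<rbrakk> \<Longrightarrow> mul a (b + c) = mul a b + mul a c"
  "\<lbrakk>a \<in> A; b \<in> A; c \<in> A\<rbrakk> \<Longrightarrow> mul (a + b) c = mul a c + mul b c"
  "\<lbrakk>a \<in> A; b \<in> A; c \<in> A\<rbrakk> \<Longrightarrow> mul a (b - c) = mul a b - mul a c"
  "\<lbrakk>a \<in> A; b \<in> A; c \<in> A\<rbrakk> \<Longrightarrow> mul (a - b) c = mul a c - mul b c"
  "\<lbrakk>a \<in> A; b \<in> A\<rbrakk> \<Longrightarrow> mul a (k *\<^sub>C b) = k *\<^sub>C mul a b"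
  "\<lbrakk>a \<in> A; b \<in> A\<rbrakk> \<Longrightarrow> mul (k *\<^sub>C a) b = k *\<^sub>C mul a b"
  "a \<in> A \<Longrightarrow> mul a 0 = 0"
  "a \<in> A \<Longrightarrow> mul 0 a = 0"
  using linear_on_add[OF mul_linear] linear_on_add[OF mul_linear_left]
    linear_on_diff[OF mul_linear] linear_on_diff[OF mul_linear_left]
    linear_on_scale[OF mul_linear] linear_on_scale[OF mul_linear_left]
    linear_on_zero[OF mul_linear] linear_on_zero[OF mul_linear_left] subspace
  by simp_all

lemma unit_right: "a \<in> A \<Longrightarrow> mul a unit = a"
  using unit_left comm unit_closed by metis

lemmas A_closed = mul_mem complex_vector.subspace_add[OF subspace]
  complex_vector.subspace_scale[OF subspace] complex_vector.subspace_diff[OF subspace]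
  complex_vector.subspace_0[OF subspace] complex_vector.subspace_neg[OF subspace]
  complex_vector.subspace_sum[OF subspace]

text \<open>Nakayama's argument by elimination: with \<open>I F\<close> the ideal of products of
  \<open>X\<close> with \<open>F\<close>, start from \<open>e = 0\<close>, for which
  \<open>x - mul e x\<close> lies in \<open>I S\<close>, and correct \<open>e\<close> so as to drop
  one generator after another until the remainder lies in \<open>I {}\<close>, which is
  zero.\<close>

lemma idempotent_ideal_unit:
  assumes X: "csubspace X" "X \<subseteq> A" "finite_dim X" "\<And>a x. \<lbrakk>a \<in> A; x \<in> X\<rbrakk> \<Longrightarrow> mul a x \<in> X"
    and idem: "X \<subseteq> cspan {mul x y |x y. x \<in> X \<and> y \<in> X}"
  shows "\<exists>e\<in>X. \<forall>x\<in>X. mul e x = x"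
proof -
  have XA: "x \<in> A" if "x \<in> X" for x using that X(2) by blast
  define I where "I F = cspan {mul y s |y s. y \<in> X \<and> s \<in> F}" for F
  have Is: "csubspace (I F)" for F by (simp add: I_def)
  have IA: "I F \<subseteq> A" if "F \<subseteq> X" for F
    unfolding I_def
    by (rule complex_vector.span_minimal[OF _ subspace]) (use that XA mul_mem in blast)
  have Imul: "mul a z \<in> I F" if a: "a \<in> A" and F: "F \<subseteq> X" and z: "z \<in> I F" for a z F
  proof (rule linear_on_span_subset[OF mul_linear[OF a] subspace Is])
    show "{mul y s |y s. y \<in> X \<and> s \<in> F} \<subseteq> A" using F XA mul_mem by blast
    show "z \<in> cspan {mul y s |y s. y \<in> X \<and> s \<in> F}" using z by (simp add: I_def)
    fix x assume "x \<in> {mul y s |y s. y \<in> X \<and> s \<in> F}"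
    then obtain y s where ys: "x = mul y s" "y \<in> X" "s \<in> F" by blast
    then have "mul a x = mul (mul a y) s" using assoc a XA F by auto
    moreover have "mul a y \<in> X" using X(4) a ys by blast
    ultimately show "mul a x \<in> I F"
      unfolding I_def using ys(3) by (intro complex_vector.span_base) blast
  qed
  have Iins: "\<exists>y\<in>X. \<exists>f\<in>I F. z = mul y s + f" if s: "s \<in> X" and F: "F \<subseteq> X" and z: "z \<in> I (insert s F)" for s F z
    using z unfolding I_def[of "insert s F"]
  proof (induction rule: complex_vector.span_induct_alt)
    case base
    have "0 = mul 0 s + 0" using XA s by (simp add: mul_simps)
    then show ?case using csub(3)[OF X(1)] csub(3)[OF Is] by blast
  next
    case (step c x z)
    obtain y f where yf: "y \<in> X" "f \<in> I F" "z = mul y s + f" using step.IH by blast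
    obtain y' s' where x: "x = mul y' s'" "y' \<in> X" "s' \<in> insert s F" using step by blast
    show ?case
    proof (cases "s' = s")
      case True
      have "c *\<^sub>C x + z = mul (c *\<^sub>C y' + y) s + f"
        using x yf True XA s by (simp add: mul_simps A_closed)
      moreover have "c *\<^sub>C y' + y \<in> X" using X(1) x yf by (simp add: csub)
      ultimately show ?thesis using yf(2) by blast
    next
      case False
      then have "x \<in> I F" unfolding I_def using x by (intro complex_vector.span_base) blast
      then have "c *\<^sub>C x + f \<in> I F" using yf(2) Is by (simp add: csub)
      moreover have "c *\<^sub>C x + z = mul y s + (c *\<^sub>C x + f)" using yf by simp
      ultimately show ?thesis using yf(1) by blast
    qed
  qed
  obtain S where S: "finite S" "X = cspan S" using X(3) finite_dim_def by blast
  have SX: "S \<subseteq> X" using S(2) complex_vector.span_superset by blast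
  have red: "\<exists>e\<in>X. \<forall>x\<in>X. x - mul e x \<in> I {}"
    if "finite F" "F \<subseteq> X" "\<exists>e\<in>X. \<forall>x\<in>X. x - mul e x \<in> I F" for F
    using that
  proof (induction rule: finite_induct)
    case (insert s F)
    obtain e where e: "e \<in> X" "\<And>x. x \<in> X \<Longrightarrow> x - mul e x \<in> I (insert s F)"
      using insert.prems(2) by blast
    have sF: "s \<in> X" "F \<subseteq> X" using insert.prems by auto
    obtain y f where yf: "y \<in> X" "f \<in> I F" "s - mul e s = mul y s + f"
      using Iins[OF sF e(2)[OF sF(1)]] by blast
    \<comment> \<open>\<open>e + y\<close> is chosen so that \<open>s\<close> is fixed by
      \<open>e'\<close> up to \<open>I F\<close>.\<close>
    define e' where "e' = e + y"
    have e': "e' \<in> X" using e yf X(1) by (simp add: e'_def csub)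
    have se: "s - mul e' s \<in> I F"
    proof -
      have "s - mul e' s = f"
        using yf(3) e(1) yf(1) sF(1) XA by (simp add: e'_def mul_simps algebra_simps)
      then show ?thesis using yf(2) by simp
    qed
    \<comment> \<open>In terms of complements, 1 minus \<open>?e\<close> is the product of 1 minus
      \<open>e'\<close> and 1 minus \<open>e\<close>: the second factor maps into multiples of
      \<open>s\<close> plus \<open>I F\<close>, and the first sends these into
      \<open>I F\<close>.\<close>
    let ?e = "e + e' - mul e' e"
    have "?e \<in> X" using e(1) e' X(1) X(4)[OF XA[OF e'] e(1)] by (simp add: csub)
    moreover have "x - mul ?e x \<in> I F" if x: "x \<in> X" for x
    proof -
      obtain z h where zh: "z \<in> X" "h \<in> I F" "x - mul e x = mul z s + h"
        using Iins[OF sF e(2)[OF x]] by blast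
      have hA: "h \<in> A" using zh(2) IA[OF sF(2)] by blast
      note AA = XA[OF x] XA[OF e(1)] XA[OF e'] XA[OF zh(1)] XA[OF sF(1)] hA
      have "x - mul ?e x = (x - mul e x) - mul e' (x - mul e x)"
        using AA by (simp add: mul_simps A_closed assoc algebra_simps)
      also have "\<dots> = mul z (s - mul e' s) + (h - mul e' h)"
        unfolding zh(3) using AA assoc[of z e' s] assoc[of e' z s] comm[of z e']
        by (simp add: mul_simps A_closed)
      also have "\<dots> \<in> I F"
        using Imul[OF AA(4) sF(2) se] Imul[OF AA(3) sF(2) zh(2)] zh(2) Is by (simp add: csub)
      finally show ?thesis .
    qed
    ultimately show ?case using insert.IH[OF sF(2)] by blast
  qed
  have "x - mul 0 x \<in> I S" if x: "x \<in> X" for x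
  proof -
    have "mul y z \<in> I S" if y: "y \<in> X" and z: "z \<in> X" for y z
    proof (rule linear_on_span_subset[OF mul_linear[OF XA[OF y]] subspace Is])
      show "S \<subseteq> A" using SX X(2) by blast
      show "z \<in> cspan S" using z S by simp
      show "mul y s \<in> I S" if "s \<in> S" for s
        unfolding I_def using y that by (intro complex_vector.span_base) blast
    qed
    then have "cspan {mul x y |x y. x \<in> X \<and> y \<in> X} \<subseteq> I S"
      by (intro complex_vector.span_minimal Is) blast
    then show ?thesis using x idem XA by (auto simp: mul_simps)
  qed
  then have "\<exists>e\<in>X. \<forall>x\<in>X. x - mul e x \<in> I {}"
    using red[OF S(1) SX] csub(3)[OF X(1)] by blast
  then obtain e where "e \<in> X" "\<And>x. x \<in> X \<Longrightarrow> x - mul e x = 0" by (auto simp: I_def)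
  then show ?thesis by (metis eq_iff_diff_eq_0)
qed

end

section \<open>Simple vertex algebroids\<close>

locale simple_vertex_algebroid = vertex_algebroid V
  for V :: "('a::complex_vector, 'b::complex_vector) algebroid" (structure) +
  assumes fin_dim_Alg: "finite_dim (Alg V)"
    and fin_dim_Vec: "finite_dim (Vec V)"
    and simple: "simple_leibniz_algebra (Vec V) (bracket V)"
    and not_lie: "\<not> lie_algebra (Vec V) (bracket V)"
begin

sublocale S: nonlie_simple_leibniz "Vec V" "bracket V"
  by (intro nonlie_simple_leibniz.intro nonlie_simple_leibniz_axioms.intro simple fin_dim_Vec not_lie)

lemma act_linear: "a \<in> Alg V \<Longrightarrow> linear_on (Vec V) (Vec V) (aact V a)"
  and act_linear_left: "v \<in> Vec V \<Longrightarrow> linear_on (Alg V) (Vec V) (\<lambda>a. a \<cdot> v)"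
  using act_bilinear by (auto simp: bilinear_on_def)

lemma anchor_linear: "v \<in> Vec V \<Longrightarrow> linear_on (Alg V) (Alg V) (anchor V v)"
  and anchor_linear_left: "a \<in> Alg V \<Longrightarrow> linear_on (Vec V) (Alg V) (\<lambda>v. v \<rhd>\<^sub>0 a)"
  using anchor_bilinear by (auto simp: bilinear_on_def)

lemma pairing_linear: "u \<in> Vec V \<Longrightarrow> linear_on (Vec V) (Alg V) (pairing V u)"
  and pairing_linear_left: "v \<in> Vec V \<Longrightarrow> linear_on (Vec V) (Alg V) (\<lambda>u. u \<bullet>\<^sub>1 v)"
  using pairing_bilinear by (auto simp: bilinear_on_def)

lemma op_mem:
  "\<lbrakk>a \<in> Alg V; v \<in> Vec V\<rbrakk> \<Longrightarrow> a \<cdot> v \<in> Vec V"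
  "\<lbrakk>v \<in> Vec V; a \<in> Alg V\<rbrakk> \<Longrightarrow> v \<rhd>\<^sub>0 a \<in> Alg V"
  "\<lbrakk>u \<in> Vec V; v \<in> Vec V\<rbrakk> \<Longrightarrow> u \<bullet>\<^sub>1 v \<in> Alg V"
  "a \<in> Alg V \<Longrightarrow> \<partial> a \<in> Vec V"
  using linear_on_mem[OF act_linear] linear_on_mem[OF anchor_linear]
    linear_on_mem[OF pairing_linear] linear_on_mem[OF partial_linear] by auto

lemma anchor_mul:
  "\<lbrakk>v \<in> Vec V; a \<in> Alg V; b \<in> Alg V\<rbrakk> \<Longrightarrow>
    v \<rhd>\<^sub>0 (a \<star> b) = (v \<rhd>\<^sub>0 a) \<star> b + a \<star> (v \<rhd>\<^sub>0 b)"
  using anchor_derivation by (auto simp: derivations_def)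

lemma partial_add: "\<lbrakk>a \<in> Alg V; b \<in> Alg V\<rbrakk> \<Longrightarrow> \<partial> (a + b) = \<partial> a + \<partial> b"
  and partial_diff: "\<lbrakk>a \<in> Alg V; b \<in> Alg V\<rbrakk> \<Longrightarrow> \<partial> (a - b) = \<partial> a - \<partial> b"
  and partial_scale: "a \<in> Alg V \<Longrightarrow> \<partial> (c *\<^sub>C a) = c *\<^sub>C \<partial> a"
  and partial_zero: "\<partial> 0 = 0"
  using linear_on_add[OF partial_linear] linear_on_diff[OF partial_linear A.subspace]
    linear_on_scale[OF partial_linear] linear_on_zero[OF partial_linear A.subspace] by auto

lemma anchor_one:
  assumes "v \<in> Vec V"
  shows "v \<rhd>\<^sub>0 \<^bold>1 = 0"
proof -
  have "v \<rhd>\<^sub>0 (\<^bold>1 \<star> \<^bold>1) = v \<rhd>\<^sub>0 \<^bold>1 + v \<rhd>\<^sub>0 \<^bold>1"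
    using anchor_mul[OF assms A.unit_closed A.unit_closed]
      A.unit_left[of "v \<rhd>\<^sub>0 \<^bold>1"] A.unit_right[of "v \<rhd>\<^sub>0 \<^bold>1"] op_mem(2)[OF assms A.unit_closed]
    by simp
  then show ?thesis using A.unit_left[OF A.unit_closed] by simp
qed

lemma partial_bracket_left:
  assumes "a \<in> Alg V" "v \<in> Vec V"
  shows "\<partial> a \<bullet>\<^sub>0 v = 0"
proof -
  have "v \<bullet>\<^sub>0 \<partial> a + \<partial> a \<bullet>\<^sub>0 v = \<partial> (v \<bullet>\<^sub>1 \<partial> a)"
    using bracket_sym assms op_mem(4) by blast
  then show ?thesis
    using bracket_partial[OF assms(2,1)] pairing_partial[OF assms(2,1)] by simp
qed

text \<open>Twice \<open>[u, u]\<close> is \<open>\<partial>\<close> of \<open>u\<close> paired with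
  itself, so the image contains \<open>Leib\<close>; it is also left stable. It cannot be all of
  \<open>Vec V\<close>, because elements \<open>\<partial> a\<close> multiply to zero from the left
  and \<open>Vec V\<close> is perfect.\<close>

lemma partial_image: "partial V ` Alg V = S.M"
proof -
  let ?D = "partial V ` Alg V"
  have D: "csubspace ?D" using linear_on_image_subspace[OF partial_linear A.subspace] .
  have "u \<bullet>\<^sub>0 u \<in> ?D" if u: "u \<in> Vec V" for u
  proof -
    have p: "u \<bullet>\<^sub>1 u \<in> Alg V" using op_mem(3)[OF u u] .
    have "u \<bullet>\<^sub>0 u + u \<bullet>\<^sub>0 u = \<partial> (u \<bullet>\<^sub>1 u)" using bracket_sym[OF u u] .
    then have "(1/2) *\<^sub>C \<partial> (u \<bullet>\<^sub>1 u) = (1/2 + 1/2) *\<^sub>C (u \<bullet>\<^sub>0 u)"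
      by (metis scaleC_add_left scaleC_add_right)
    then have "u \<bullet>\<^sub>0 u = \<partial> ((1/2) *\<^sub>C (u \<bullet>\<^sub>1 u))"
      using partial_scale[OF p] by (simp add: scaleC_one)
    then show ?thesis using p by (auto simp: A.A_closed)
  qed
  then have MD: "S.M \<subseteq> ?D"
    unfolding Leib_def by (intro complex_vector.span_minimal D) blast
  have "?D = S.M \<or> ?D = Vec V"
    by (rule S.left_ideal_cases[OF D MD]) (auto simp: op_mem bracket_partial)
  moreover have "?D \<noteq> Vec V"
  proof
    assume DB: "?D = Vec V"
    have "x \<bullet>\<^sub>0 y = 0" if "x \<in> Vec V" "y \<in> Vec V" for x y
    proof -
      have "x \<in> ?D" using that(1) DB by simp
      then obtain a where "a \<in> Alg V" "x = \<partial> a" by blast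
      then show ?thesis using partial_bracket_left that(2) by blast
    qed
    then have "Vec V \<subseteq> {0}" using S.perfect_subset[of "{0}"] by simp
    then show False using S.M_neq_L S.M_L S.M_sub csub(3) by blast
  qed
  ultimately show ?thesis by blast
qed

lemma partial_M: "a \<in> Alg V \<Longrightarrow> \<partial> a \<in> S.M"
  unfolding partial_image[symmetric] by blast

lemma anchor_partial_kernel:
  "\<lbrakk>z \<in> Alg V; \<partial> z = 0; v \<in> Vec V\<rbrakk> \<Longrightarrow> v \<rhd>\<^sub>0 z = 0"
  using pairing_partial[of v z] linear_on_zero[OF pairing_linear B.subspace] by simp

lemma anchor_M: "\<lbrakk>m \<in> S.M; a \<in> Alg V\<rbrakk> \<Longrightarrow> m \<rhd>\<^sub>0 a = 0"
  using partial_anchor unfolding partial_image[symmetric] by blast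

text \<open>The kernel of the action on \<open>Alg V\<close> is left stable and contains
  \<open>Leib\<close>. If it were everything, bracketing with any \<open>\<partial> a\<close> would
  give 0, so \<open>Leib\<close> would consist of invariants.\<close>

lemma anchor_kernel:
  assumes "b \<in> Vec V" "\<And>a. a \<in> Alg V \<Longrightarrow> b \<rhd>\<^sub>0 a = 0"
  shows "b \<in> S.M"
proof -
  let ?Q = "{b \<in> Vec V. \<forall>a\<in>Alg V. b \<rhd>\<^sub>0 a = 0}"
  have "?Q = S.M \<or> ?Q = Vec V"
  proof (rule S.left_ideal_cases)
    show "csubspace ?Q"
      unfolding complex_vector.subspace_def
      by (auto simp: B.L_closed linear_on_zero[OF anchor_linear_left B.subspace]
          linear_on_add[OF anchor_linear_left] linear_on_scale[OF anchor_linear_left])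
    show "S.M \<subseteq> ?Q" using anchor_M S.M_mem by blast
    show "x \<bullet>\<^sub>0 y \<in> ?Q" if "x \<in> Vec V" "y \<in> ?Q" for x y
      using that by (auto simp: B.br_mem anchor_bracket op_mem
          linear_on_zero[OF anchor_linear A.subspace])
  qed blast
  moreover have "?Q \<noteq> Vec V"
  proof
    assume Q: "?Q = Vec V"
    have "m = 0" if m: "m \<in> S.M" for m
    proof (rule S.invariants_zero[OF m])
      obtain a where a: "a \<in> Alg V" "m = \<partial> a"
        using m unfolding partial_image[symmetric] by blast
      show "x \<bullet>\<^sub>0 m = 0" if "x \<in> Vec V" for x
      proof -
        have "x \<rhd>\<^sub>0 a = 0" using that a(1) Q by blast
        then show ?thesis using a bracket_partial[OF that a(1)] partial_zero by simp
      qed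
    qed
    then show False using S.M_nonzero S.M_sub csub(3) by blast
  qed
  ultimately show ?thesis using assms by blast
qed

section \<open>The square-zero ideal spanned by the image of the action on A\<close>

definition X :: "'a set" where
  "X = cspan {v \<rhd>\<^sub>0 a |v a. v \<in> Vec V \<and> a \<in> Alg V}"

lemma X_sub: "csubspace X"
  by (simp add: X_def)

lemma anchor_gens: "{v \<rhd>\<^sub>0 a |v a. v \<in> Vec V \<and> a \<in> Alg V} \<subseteq> Alg V"
  using op_mem(2) by blast

lemma X_Alg: "X \<subseteq> Alg V"
  unfolding X_def by (rule complex_vector.span_minimal[OF anchor_gens A.subspace])

lemma X_mem: "x \<in> X \<Longrightarrow> x \<in> Alg V"
  using X_Alg by blast

lemma anchor_X: "\<lbrakk>v \<in> Vec V; a \<in> Alg V\<rbrakk> \<Longrightarrow> v \<rhd>\<^sub>0 a \<in> X"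
  unfolding X_def by (rule complex_vector.span_base) blast

lemma X_induct:
  assumes "linear_on (Alg V) Y f" "csubspace W" "x \<in> X"
    and "\<And>v a. \<lbrakk>v \<in> Vec V; a \<in> Alg V\<rbrakk> \<Longrightarrow> f (v \<rhd>\<^sub>0 a) \<in> W"
  shows "f x \<in> W"
  by (rule linear_on_span_subset[OF assms(1) A.subspace assms(2) anchor_gens])
    (use assms(3,4) in \<open>auto simp: X_def\<close>)

text \<open>\<open>act_anchor\<close> absorbs a factor from the algebra into the acting
  vector.\<close>

lemma X_ideal:
  assumes "a \<in> Alg V" "x \<in> X"
  shows "a \<star> x \<in> X"
proof (rule X_induct[OF A.mul_linear[OF assms(1)] X_sub assms(2)])
  show "a \<star> (v \<rhd>\<^sub>0 b) \<in> X" if "v \<in> Vec V" "b \<in> Alg V" for v b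
    using act_anchor[OF assms(1) that] anchor_X[of "a \<cdot> v" b] op_mem(1)[OF assms(1)] that by simp
qed

lemma trace_mul_linear:
  assumes S: "is_basis (Alg V) S"
  shows "linear_on (Alg V) UNIV (\<lambda>a. trace_on S (\<lambda>b. a \<star> b))"
proof (rule linear_onI)
  fix a c assume ac: "a \<in> Alg V" "c \<in> Alg V"
  show "trace_on S (\<lambda>b. (a + c) \<star> b) = trace_on S (\<lambda>b. a \<star> b) + trace_on S (\<lambda>b. c \<star> b)"
    unfolding trace_add[OF S A.mul_linear[OF ac(1)] A.mul_linear[OF ac(2)], symmetric]
    by (rule trace_cong[OF S]) (use ac in \<open>simp add: A.mul_simps\<close>)
next
  fix k a assume a: "a \<in> Alg V"
  show "trace_on S (\<lambda>b. (k *\<^sub>C a) \<star> b) = k *\<^sub>C trace_on S (\<lambda>b. a \<star> b)"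
    unfolding scaleC_complex_def trace_scale[OF S A.mul_linear[OF a], symmetric]
    by (rule trace_cong[OF S]) (use a in \<open>simp add: A.mul_simps\<close>)
qed simp

text \<open>Multiplication by a value of the derivation \<open>anchor V v\<close> at
  \<open>a\<close> is the commutator of that derivation with multiplication by \<open>a\<close>,
  hence has trace 0.\<close>

lemma trace_X:
  assumes S: "is_basis (Alg V) S" and x: "x \<in> X"
  shows "trace_on S (\<lambda>b. x \<star> b) = 0"
proof -
  have "trace_on S (\<lambda>b. x \<star> b) \<in> {0}"
  proof (rule X_induct[OF trace_mul_linear[OF S] _ x])
    fix v a assume v: "v \<in> Vec V" and a: "a \<in> Alg V"
    note m = A.mul_linear[OF a] and d = anchor_linear[OF v]
    have "trace_on S (\<lambda>b. (v \<rhd>\<^sub>0 a) \<star> b) = trace_on S (\<lambda>b. v \<rhd>\<^sub>0 (a \<star> b) - a \<star> (v \<rhd>\<^sub>0 b))"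
      by (rule trace_cong[OF S]) (use v a in \<open>simp add: anchor_mul\<close>)
    also have "\<dots> = 0"
      using trace_diff[OF S linear_on_comp[OF m d] linear_on_comp[OF d m]] trace_commute[OF S d m] by simp
    finally show "trace_on S (\<lambda>b. (v \<rhd>\<^sub>0 a) \<star> b) \<in> {0}" by simp
  qed simp
  then show ?thesis by simp
qed

text \<open>If \<open>X \<star> X\<close> were nonzero, \<open>X\<close> would be an idempotent ideal. Its identity element would act
  on \<open>Alg V\<close> as a projection onto \<open>X\<close>, of trace \<open>dim X\<close>, whereas elements of \<open>X\<close> act
  with trace \<open>0\<close>.\<close>

lemma X_X:
  assumes x: "x \<in> X" and y: "y \<in> X"
  shows "x \<star> y = 0"
proof -
  let ?G = "{z \<cdot> b |z b. z \<in> X \<and> b \<in> Vec V}"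
  let ?W = "cspan ?G"
  have GB: "?G \<subseteq> Vec V" using op_mem(1) X_mem by blast
  have WB: "?W \<subseteq> Vec V" by (rule complex_vector.span_minimal[OF GB B.subspace])
  have Ws: "csubspace ?W" by simp
  have Wst: "u \<bullet>\<^sub>0 w \<in> ?W" if u: "u \<in> Vec V" and w: "w \<in> ?W" for u w
  proof (rule linear_on_span_subset[OF B.br_right_linear[OF u] B.subspace Ws GB _ w])
    fix g assume "g \<in> ?G"
    then obtain z b where zb: "g = z \<cdot> b" "z \<in> X" "b \<in> Vec V" by blast
    have "(u \<rhd>\<^sub>0 z) \<cdot> b \<in> ?W" "z \<cdot> (u \<bullet>\<^sub>0 b) \<in> ?W"
      using zb u anchor_X[OF u X_mem[OF zb(2)]] B.br_mem by (auto intro!: complex_vector.span_base)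
    then show "u \<bullet>\<^sub>0 g \<in> ?W"
      using bracket_act[OF u X_mem[OF zb(2)] zb(3)] zb(1) Ws by (simp add: csub)
  qed
  have MW: "S.M \<subseteq> ?W + S.M"
    using set_zero_plus2[of ?W S.M] csub(3)[OF Ws] by simp
  \<comment> \<open>In the first case elements of \<open>X \<cdot> B\<close> act by zero on the
    algebra, so \<open>x\<close> kills the generators of \<open>X\<close> by
    \<open>act_anchor\<close>. In the second, \<open>B\<close> is spanned by such elements modulo
    \<open>Leib\<close>, and the same axiom puts every generator of \<open>X\<close> into
    \<open>X \<star> X\<close>.\<close>
  have "?W + S.M = S.M \<or> ?W + S.M = Vec V"
  proof (rule S.left_ideal_cases[OF subspace_plus[OF Ws S.M_sub] MW])
    show "?W + S.M \<subseteq> Vec V" using WB S.M_L by (auto elim!: set_plus_elim simp: B.L_closed subset_iff)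
    fix u y assume u: "u \<in> Vec V" and y: "y \<in> ?W + S.M"
    obtain w m where wm: "y = w + m" "w \<in> ?W" "m \<in> S.M" using y by (rule set_plus_elim)
    then have "u \<bullet>\<^sub>0 y = u \<bullet>\<^sub>0 w + u \<bullet>\<^sub>0 m"
      using u WB S.M_mem by (simp add: B.br_simps subset_iff)
    then show "u \<bullet>\<^sub>0 y \<in> ?W + S.M"
      using Wst[OF u wm(2)] S.M_right[OF u wm(3)] by (simp add: set_plus_intro)
  qed
  then show ?thesis
  proof
    assume WM: "?W + S.M = S.M"
    have "z \<cdot> b \<in> S.M" if "z \<in> X" "b \<in> Vec V" for z b
    proof -
      have "z \<cdot> b \<in> ?W" using that by (intro complex_vector.span_base) blast
      then have "z \<cdot> b + 0 \<in> ?W + S.M" using csub(3)[OF S.M_sub] by (intro set_plus_intro)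
      then show ?thesis using WM by simp
    qed
    then have "x \<star> (v \<rhd>\<^sub>0 a) \<in> {0}" if "v \<in> Vec V" "a \<in> Alg V" for v a
      using act_anchor[OF X_mem[OF x] that] anchor_M x that by simp
    then have "x \<star> y \<in> {0}"
      by (intro X_induct[OF A.mul_linear[OF X_mem[OF x]] complex_vector.subspace_single_0 y])
    then show ?thesis by simp
  next
    assume WV: "?W + S.M = Vec V"
    let ?XX = "cspan {x \<star> y |x y. x \<in> X \<and> y \<in> X}"
    have XXs: "csubspace ?XX" by simp
    have W_XX: "w \<rhd>\<^sub>0 a \<in> ?XX" if a: "a \<in> Alg V" and w: "w \<in> ?W" for w a
    proof (rule linear_on_span_subset[OF anchor_linear_left[OF a] B.subspace XXs GB _ w])
      fix g assume "g \<in> ?G"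
      then obtain z b where zb: "g = z \<cdot> b" "z \<in> X" "b \<in> Vec V" by blast
      then have "g \<rhd>\<^sub>0 a = z \<star> (b \<rhd>\<^sub>0 a)" using act_anchor X_mem a by blast
      then show "g \<rhd>\<^sub>0 a \<in> ?XX"
        using zb anchor_X[OF zb(3) a] by (auto intro!: complex_vector.span_base)
    qed
    have "v \<rhd>\<^sub>0 a \<in> ?XX" if v: "v \<in> Vec V" and a: "a \<in> Alg V" for v a
    proof -
      have "v \<in> ?W + S.M" using v WV by simp
      then obtain w m where wm: "v = w + m" "w \<in> ?W" "m \<in> S.M" by (rule set_plus_elim)
      have "w \<in> Vec V" using wm(2) WB by blast
      then have "v \<rhd>\<^sub>0 a = w \<rhd>\<^sub>0 a"
        using linear_on_add[OF anchor_linear_left[OF a] _ S.M_mem[OF wm(3)]] anchor_M[OF wm(3) a]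
          wm(1) by simp
      then show ?thesis using W_XX[OF a wm(2)] by simp
    qed
    then have gens: "{v \<rhd>\<^sub>0 a |v a. v \<in> Vec V \<and> a \<in> Alg V} \<subseteq> ?XX" by blast
    have idem: "X \<subseteq> ?XX"
      using complex_vector.span_minimal[OF gens XXs] unfolding X_def[symmetric] .
    have fdX: "finite_dim X" using finite_dim_subset[OF fin_dim_Alg X_sub X_Alg] .
    obtain e where e: "e \<in> X" "\<And>z. z \<in> X \<Longrightarrow> e \<star> z = z"
      using A.idempotent_ideal_unit[OF X_sub X_Alg fdX X_ideal idem] by blast
    obtain S where S: "is_basis (Alg V) S" using basis_ex[OF fin_dim_Alg] by blast
    obtain T where T: "is_basis X T" using basis_ex[OF fdX] by blast
    have "e \<star> a \<in> X" if "a \<in> Alg V" for a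
      using X_ideal[OF that e(1)] A.comm X_mem[OF e(1)] that by simp
    then have "trace_on S (\<lambda>b. e \<star> b) = trace_on T (\<lambda>b. e \<star> b)"
      by (intro trace_range[OF S A.mul_linear[OF X_mem[OF e(1)]] X_sub X_Alg _ T]) blast
    then have "card T = 0"
      using trace_X[OF S e(1)] trace_id[OF T, of "\<lambda>b. e \<star> b"] e(2) by simp
    then have "T = {}" using T by (simp add: is_basis_def)
    then have "X = {0}" using T by (simp add: is_basis_def)
    then show ?thesis using x y A.mul_simps(7)[OF A.A_closed(5)] by simp
  qed
qed

lemma X_act:
  assumes x: "x \<in> X" and b: "b \<in> Vec V"
  shows "x \<cdot> b \<in> S.M"
proof (rule anchor_kernel[OF op_mem(1)[OF X_mem[OF x] b]])
  show "(x \<cdot> b) \<rhd>\<^sub>0 a = 0" if "a \<in> Alg V" for a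
    using act_anchor[OF X_mem[OF x] b that] X_X[OF x anchor_X[OF b that]] by simp
qed

lemma partial_X: "partial V ` X = S.M"
proof -
  have lin: "linear_on X (Vec V) (partial V)"
    using linear_on_subset[OF partial_linear X_Alg] op_mem(4) X_mem by blast
  have "partial V ` X = {0} \<or> partial V ` X = S.M"
  proof (rule S.submodule_cases)
    show "csubspace (partial V ` X)" using linear_on_image_subspace[OF lin X_sub] .
    show "partial V ` X \<subseteq> S.M" using partial_M X_mem by blast
    show "u \<bullet>\<^sub>0 y \<in> partial V ` X" if "u \<in> Vec V" "y \<in> partial V ` X" for u y
      using that bracket_partial anchor_X X_mem by auto
  qed
  moreover have "partial V ` X \<noteq> {0}"
  proof
    assume 0: "partial V ` X = {0}"
    have "m = 0" if m: "m \<in> S.M" for m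
    proof (rule S.invariants_zero[OF m])
      obtain a where a: "a \<in> Alg V" "m = \<partial> a"
        using m unfolding partial_image[symmetric] by blast
      show "x \<bullet>\<^sub>0 m = 0" if "x \<in> Vec V" for x
        using a bracket_partial[OF that a(1)] anchor_X[OF that a(1)] 0 by auto
    qed
    then show False using S.M_nonzero S.M_sub csub(3) by blast
  qed
  ultimately show ?thesis by blast
qed

lemma M_partial_X:
  assumes "m \<in> S.M"
  obtains x where "x \<in> X" "m = \<partial> x"
  using assms that unfolding partial_X[symmetric] by blast

lemma bracket_partial_mul:
  assumes x: "x \<in> X" and p: "p \<in> Alg V" and v: "v \<in> Vec V"
  shows "v \<bullet>\<^sub>0 \<partial> (x \<star> p) = \<partial> ((v \<rhd>\<^sub>0 x) \<star> p)"
proof -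
  have "v \<rhd>\<^sub>0 (x \<star> p) = (v \<rhd>\<^sub>0 x) \<star> p"
    using anchor_mul[OF v X_mem[OF x] p] X_X[OF x anchor_X[OF v p]] by simp
  then show ?thesis using bracket_partial v A.mul_mem X_mem[OF x] p by simp
qed

text \<open>If \<open>\<partial> x = 0\<close>, then \<open>pairing_partial\<close> shows that every
  vector acts on \<open>x\<close> by zero. Hence \<open>\<partial> (x \<star> p)\<close> is an
  invariant of \<open>Leib\<close>, because \<open>X \<star> X = 0\<close> leaves only the term in
  which \<open>x\<close> is differentiated.\<close>

lemma partial_mul_kernel:
  assumes x: "x \<in> X" "\<partial> x = 0" and p: "p \<in> Alg V"
  shows "\<partial> (x \<star> p) = 0"
proof (rule S.invariants_zero)
  show "\<partial> (x \<star> p) \<in> S.M" using partial_M A.mul_mem X_mem[OF x(1)] p by blast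
  show "v \<bullet>\<^sub>0 \<partial> (x \<star> p) = 0" if "v \<in> Vec V" for v
    using bracket_partial_mul[OF x(1) p that] anchor_partial_kernel[OF X_mem[OF x(1)] x(2) that]
      A.mul_simps(8)[OF p] partial_zero by simp
qed

text \<open>Schur's lemma. Multiplication by \<open>p\<close> on \<open>X\<close> descends along
  \<open>\<partial>\<close> to an endomorphism of \<open>Leib\<close>, well defined by
  \<open>partial_mul_kernel\<close>; it commutes with brackets because derivatives of
  \<open>p\<close> lie in \<open>X\<close> and are killed by \<open>X\<close>. An eigenspace is a
  nonzero submodule, hence everything.\<close>

lemma partial_mul_scalar_ex:
  assumes p: "p \<in> Alg V"
  shows "\<exists>c. \<forall>x\<in>X. \<partial> (x \<star> p) = c *\<^sub>C \<partial> x"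
proof -
  define pre where "pre m = (SOME x. x \<in> X \<and> \<partial> x = m)" for m
  define g where "g m = \<partial> (pre m \<star> p)" for m
  have pre: "pre m \<in> X \<and> \<partial> (pre m) = m" if "m \<in> S.M" for m
    unfolding pre_def by (rule someI_ex) (use M_partial_X[OF that] in blast)
  have g: "g (\<partial> x) = \<partial> (x \<star> p)" if x: "x \<in> X" for x
  proof -
    let ?y = "pre (\<partial> x)"
    have y: "?y \<in> X" "\<partial> ?y = \<partial> x" using pre[OF partial_M[OF X_mem[OF x]]] by auto
    have "?y - x \<in> X" "\<partial> (?y - x) = 0"
      using x y X_sub X_mem by (auto simp: csub partial_diff)
    then have "\<partial> ((?y - x) \<star> p) = 0" using partial_mul_kernel p by blast
    then show ?thesis
      using x y X_mem p by (simp add: g_def A.mul_simps partial_diff A.mul_mem)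
  qed
  have fdM: "finite_dim S.M" using finite_dim_subset[OF fin_dim_Vec S.M_sub S.M_L] .
  have lin: "linear_on S.M S.M g"
  proof (rule linear_onI)
    fix m assume "m \<in> S.M"
    then show "g m \<in> S.M" using pre X_mem A.mul_mem p partial_M by (auto simp: g_def)
  next
    fix m k assume mk: "m \<in> S.M" "k \<in> S.M"
    then obtain x y where xy: "x \<in> X" "m = \<partial> x" "y \<in> X" "k = \<partial> y"
      using M_partial_X by metis
    have "g (m + k) = \<partial> ((x + y) \<star> p)"
      using g[OF complex_vector.subspace_add[OF X_sub xy(1,3)]]
        partial_add[OF X_mem[OF xy(1)] X_mem[OF xy(3)]] xy by simp
    then show "g (m + k) = g m + g k"
      using g[OF xy(1)] g[OF xy(3)] xy(2,4) X_mem[OF xy(1)] X_mem[OF xy(3)] p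
      by (simp add: A.mul_simps partial_add A.mul_mem)
  next
    fix c m assume m: "m \<in> S.M"
    obtain x where x: "x \<in> X" "m = \<partial> x" using M_partial_X[OF m] .
    have "g (c *\<^sub>C m) = \<partial> ((c *\<^sub>C x) \<star> p)"
      using g[OF complex_vector.subspace_scale[OF X_sub x(1)]] partial_scale[OF X_mem[OF x(1)]] x
      by simp
    then show "g (c *\<^sub>C m) = c *\<^sub>C g m"
      using g[OF x(1)] x(2) X_mem[OF x(1)] p by (simp add: A.mul_simps partial_scale A.mul_mem)
  qed
  obtain w c where w: "w \<in> S.M" "w \<noteq> 0" "g w = c *\<^sub>C w"
    using eigenvector_ex[OF fdM S.M_nonzero lin] by blast
  let ?E = "{m \<in> S.M. g m = c *\<^sub>C m}"
  have "?E = {0} \<or> ?E = S.M"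
  proof (rule S.submodule_cases)
    show "csubspace ?E"
      unfolding complex_vector.subspace_def
      using S.M_sub linear_on_zero[OF lin S.M_sub] linear_on_add[OF lin] linear_on_scale[OF lin]
      by (auto simp: csub scaleC_add_right scaleC_scaleC mult.commute)
    show "v \<bullet>\<^sub>0 m \<in> ?E" if v: "v \<in> Vec V" and m: "m \<in> ?E" for v m
    proof -
      obtain x where x: "x \<in> X" "m = \<partial> x" using m M_partial_X by blast
      have "g (v \<bullet>\<^sub>0 m) = \<partial> ((v \<rhd>\<^sub>0 x) \<star> p)"
        using bracket_partial[OF v X_mem[OF x(1)]] g[OF anchor_X[OF v X_mem[OF x(1)]]] x by simp
      also have "\<dots> = v \<bullet>\<^sub>0 g m" using bracket_partial_mul[OF x(1) p v] g x by simp
      also have "\<dots> = c *\<^sub>C (v \<bullet>\<^sub>0 m)" using m S.M_mem v by (simp add: B.br_simps)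
      finally show ?thesis using S.M_right[OF v] m by simp
    qed
  qed blast
  then have E: "?E = S.M" using w by blast
  have "\<partial> (x \<star> p) = c *\<^sub>C \<partial> x" if "x \<in> X" for x
  proof -
    have "\<partial> x \<in> ?E" using partial_M[OF X_mem[OF that]] unfolding E .
    then show ?thesis using g[OF that] by simp
  qed
  then show ?thesis by blast
qed

section \<open>The character of A on Leib and the form it defines\<close>

definition \<chi> :: "'a \<Rightarrow> complex" where
  "\<chi> p = (SOME c. \<forall>x\<in>X. \<partial> (x \<star> p) = c *\<^sub>C \<partial> x)"

lemma \<chi>: "\<lbrakk>p \<in> Alg V; x \<in> X\<rbrakk> \<Longrightarrow> \<partial> (x \<star> p) = \<chi> p *\<^sub>C \<partial> x"
  unfolding \<chi>_def by (rule bspec[OF someI_ex[OF partial_mul_scalar_ex]])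

lemma \<chi>_eqI:
  assumes "p \<in> Alg V" "\<And>x. x \<in> X \<Longrightarrow> \<partial> (x \<star> p) = c *\<^sub>C \<partial> x"
  shows "\<chi> p = c"
proof -
  obtain m where m: "m \<in> S.M" "m \<noteq> 0" using S.M_nonzero S.M_sub csub(3) by blast
  obtain x where "x \<in> X" "m = \<partial> x" using M_partial_X[OF m(1)] .
  then have x: "x \<in> X" "\<partial> x \<noteq> 0" using m(2) by simp_all
  then have "\<chi> p *\<^sub>C \<partial> x = c *\<^sub>C \<partial> x" using \<chi>[OF assms(1) x(1)] assms(2) by simp
  then show ?thesis using x(2) by simp
qed

lemma \<chi>_linear: "linear_on (Alg V) UNIV \<chi>"
proof (rule linear_onI)
  fix p q assume p: "p \<in> Alg V" and q: "q \<in> Alg V"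
  show "\<chi> (p + q) = \<chi> p + \<chi> q"
  proof (rule \<chi>_eqI)
    fix x assume x: "x \<in> X"
    show "\<partial> (x \<star> (p + q)) = (\<chi> p + \<chi> q) *\<^sub>C \<partial> x"
      using \<chi>[OF p x] \<chi>[OF q x] X_mem[OF x] p q
      by (simp add: A.mul_simps partial_add A.mul_mem scaleC_add_left)
  qed (use p q in \<open>simp add: A.A_closed\<close>)
next
  fix c p assume p: "p \<in> Alg V"
  show "\<chi> (c *\<^sub>C p) = c *\<^sub>C \<chi> p"
  proof (rule \<chi>_eqI)
    fix x assume x: "x \<in> X"
    show "\<partial> (x \<star> (c *\<^sub>C p)) = (c *\<^sub>C \<chi> p) *\<^sub>C \<partial> x"
      using \<chi>[OF p x] X_mem[OF x] p
      by (simp add: A.mul_simps partial_scale A.mul_mem scaleC_scaleC scaleC_complex_def)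
  qed (use p in \<open>simp add: A.A_closed\<close>)
qed simp

lemma \<chi>_X: "p \<in> X \<Longrightarrow> \<chi> p = 0"
  by (rule \<chi>_eqI) (simp_all add: X_mem X_X partial_zero)

definition \<psi> :: "'b \<Rightarrow> 'b \<Rightarrow> complex" where
  "\<psi> u v = \<chi> (u \<bullet>\<^sub>1 v)"

text \<open>\<open>\<chi>\<close> kills \<open>X\<close>. Derivatives of pairings lie in
  \<open>X\<close>, which gives invariance, and so do pairings with elements
  \<open>\<partial> a\<close>, which gives vanishing on \<open>Leib\<close>.\<close>

lemma \<psi>_invariant: "S.invariant_form \<psi>"
  unfolding S.invariant_form_def
proof (intro conjI ballI)
  show "bilinear_on (Vec V) (Vec V) UNIV \<psi>"
    unfolding bilinear_on_def \<psi>_def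
    using linear_on_comp[OF pairing_linear \<chi>_linear] linear_on_comp[OF pairing_linear_left \<chi>_linear]
    by blast
  show "\<psi> u v = \<psi> v u" if "u \<in> Vec V" "v \<in> Vec V" for u v
    using pairing_sym[OF that] by (simp add: \<psi>_def)
  show "\<psi> (z \<bullet>\<^sub>0 u) v + \<psi> u (z \<bullet>\<^sub>0 v) = 0" if "z \<in> Vec V" "u \<in> Vec V" "v \<in> Vec V" for z u v
    using anchor_pairing[OF that] \<chi>_X[OF anchor_X[OF that(1) op_mem(3)[OF that(2,3)]]] that
      linear_on_add[OF \<chi>_linear, of "(z \<bullet>\<^sub>0 u) \<bullet>\<^sub>1 v" "u \<bullet>\<^sub>1 (z \<bullet>\<^sub>0 v)"]
    by (simp add: \<psi>_def op_mem B.br_mem)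
  show "\<psi> m v = 0" if "m \<in> S.M" "v \<in> Vec V" for m v
  proof -
    obtain a where a: "a \<in> Alg V" "m = \<partial> a"
      using \<open>m \<in> S.M\<close> unfolding partial_image[symmetric] by blast
    then have "m \<bullet>\<^sub>1 v = v \<rhd>\<^sub>0 a" using pairing_sym op_mem(4) that(2) pairing_partial by metis
    then show ?thesis using \<chi>_X[OF anchor_X[OF that(2) a(1)]] by (simp add: \<psi>_def)
  qed
qed

text \<open>As \<open>x \<cdot> u\<close> lies in \<open>Leib\<close>, it is some
  \<open>\<partial> c\<close>. Pairing it with \<open>v\<close> computes the action of
  \<open>v\<close> on \<open>c\<close> through \<open>act_pairing\<close>; applying
  \<open>\<partial>\<close> turns the product term into the scalar
  \<open>\<psi> u v\<close>.\<close>

lemma bracket_X_act: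
  assumes x: "x \<in> X" and u: "u \<in> Vec V" and v: "v \<in> Vec V"
  shows "v \<bullet>\<^sub>0 (x \<cdot> u) = \<psi> u v *\<^sub>C \<partial> x - u \<bullet>\<^sub>0 (v \<bullet>\<^sub>0 \<partial> x)"
proof -
  note xA = X_mem[OF x]
  obtain c where c: "c \<in> Alg V" "x \<cdot> u = \<partial> c"
    using M_partial_X[OF X_act[OF x u]] X_mem by metis
  have "v \<rhd>\<^sub>0 c = x \<star> (u \<bullet>\<^sub>1 v) - u \<rhd>\<^sub>0 (v \<rhd>\<^sub>0 x)"
    using act_pairing[OF xA u v] c pairing_partial[OF v c(1)] pairing_sym[OF v op_mem(4)[OF c(1)]]
    by simp
  then have "v \<bullet>\<^sub>0 (x \<cdot> u) = \<partial> (x \<star> (u \<bullet>\<^sub>1 v)) - \<partial> (u \<rhd>\<^sub>0 (v \<rhd>\<^sub>0 x))"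
    using c bracket_partial[OF v c(1)] u v xA by (simp add: partial_diff op_mem A.mul_mem)
  then show ?thesis
    using \<chi>[OF op_mem(3)[OF u v] x] bracket_partial u v xA by (simp add: \<psi>_def op_mem)
qed

text \<open>This supplies hypothesis \<open>H\<close> of the Clifford lemmas: for
  \<open>m = \<partial> x\<close> the element \<open>c\<close> is
  \<open>x \<cdot> u\<close>.\<close>

lemma M_act_ex:
  assumes "m \<in> S.M" "u \<in> Vec V"
  shows "\<exists>c\<in>S.M. \<forall>v\<in>Vec V. v \<bullet>\<^sub>0 c = \<psi> u v *\<^sub>C m - u \<bullet>\<^sub>0 (v \<bullet>\<^sub>0 m)"
proof -
  obtain x where "x \<in> X" "m = \<partial> x" using M_partial_X[OF assms(1)] .
  then have "\<forall>v\<in>Vec V. v \<bullet>\<^sub>0 (x \<cdot> u) = \<psi> u v *\<^sub>C m - u \<bullet>\<^sub>0 (v \<bullet>\<^sub>0 m)"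
    using bracket_X_act assms(2) by blast
  then show ?thesis using X_act[OF \<open>x \<in> X\<close> assms(2)] by blast
qed

lemma \<psi>_clifford: "S.clifford_form \<psi>"
  unfolding S.clifford_form_def
  using \<psi>_invariant S.clifford_form_nonzero[of \<psi>] S.clifford[OF \<psi>_invariant] M_act_ex by simp

lemma clifford_M:
  "\<lbrakk>u \<in> Vec V; v \<in> Vec V; m \<in> S.M\<rbrakk> \<Longrightarrow> u \<bullet>\<^sub>0 (v \<bullet>\<^sub>0 m) + v \<bullet>\<^sub>0 (u \<bullet>\<^sub>0 m) = \<psi> u v *\<^sub>C m"
  using \<psi>_clifford by (simp add: S.clifford_form_def)

text \<open>By the Clifford relation \<open>bracket_X_act\<close> says that
  \<open>x \<cdot> u\<close> and the bracket of \<open>u\<close> with \<open>\<partial> x\<close>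
  have the same image under every left multiplication. Their difference is an invariant of
  \<open>Leib\<close>, hence 0.\<close>

lemma X_act_eq:
  assumes x: "x \<in> X" and u: "u \<in> Vec V"
  shows "x \<cdot> u = \<partial> (u \<rhd>\<^sub>0 x)"
proof -
  note xA = X_mem[OF x]
  have uM: "u \<bullet>\<^sub>0 \<partial> x \<in> S.M" using S.M_right[OF u partial_M[OF xA]] .
  have "x \<cdot> u - u \<bullet>\<^sub>0 \<partial> x = 0"
  proof (rule S.invariants_zero)
    show "x \<cdot> u - u \<bullet>\<^sub>0 \<partial> x \<in> S.M" using X_act[OF x u] uM S.M_sub by (simp add: csub)
    show "v \<bullet>\<^sub>0 (x \<cdot> u - u \<bullet>\<^sub>0 \<partial> x) = 0" if v: "v \<in> Vec V" for v
    proof -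
      have "v \<bullet>\<^sub>0 (x \<cdot> u) = v \<bullet>\<^sub>0 (u \<bullet>\<^sub>0 \<partial> x)"
        unfolding bracket_X_act[OF x u v] clifford_M[OF u v partial_M[OF xA], symmetric] by simp
      then show ?thesis using u v xA by (simp add: B.br_simps op_mem B.br_mem)
    qed
  qed
  then show ?thesis using bracket_partial[OF u xA] by simp
qed

lemma levi_factor_ex:
  obtains g where "levi_factor V g"
proof -
  obtain g where g: "csubspace g" "g \<subseteq> Vec V" "\<And>x w. \<lbrakk>x \<in> Vec V; w \<in> g\<rbrakk> \<Longrightarrow> x \<bullet>\<^sub>0 w \<in> g"
    "g \<inter> S.M = {0}" "Vec V = g + S.M"
    using S.left_invariant_complement_ex[OF \<psi>_clifford] by blast
  then have "levi_factor V g"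
    unfolding levi_factor_def partial_image using S.complement_simple[OF g] by blast
  then show ?thesis using that by blast
qed

text \<open>A complement of the identity is the kernel of the trace of multiplications, which
  contains the image of every derivation \<open>v\<^sub>0\<close>.\<close>

lemma unit_complement_ex:
  assumes "levi_factor V g"
  shows "\<exists>N. unit_complement V g N"
proof -
  have gB: "g \<subseteq> Vec V" and "simple_lie_algebra g (bracket V)"
    using assms by (auto simp: levi_factor_def)
  then interpret g: simple_lie_algebra g "bracket V" by blast
  obtain S where S: "is_basis (Alg V) S" using basis_ex[OF fin_dim_Alg] by blast
  define \<tau> where "\<tau> a = trace_on S (\<lambda>b. a \<star> b)" for a
  have \<tau>: "linear_on (Alg V) UNIV \<tau>"
    unfolding \<tau>_def using trace_mul_linear[OF S] .
  define N where "N = {a \<in> Alg V. \<tau> a = 0}"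
  have Ns: "csubspace N"
    using linear_on_preimage_subspace[OF \<tau> A.subspace, of "{0}"] by (simp add: N_def)
  have XN: "X \<subseteq> N" using trace_X[OF S] X_mem by (auto simp: N_def \<tau>_def)
  have NA: "N \<subseteq> Alg V" by (auto simp: N_def)
  have "\<tau> \<^bold>1 = of_nat (card S)"
    unfolding \<tau>_def using trace_id[OF S] A.unit_left by blast
  moreover have "card S \<noteq> 0"
  proof
    assume "card S = 0"
    then have "Alg V = {0}" using S by (auto simp: is_basis_def)
    then have "S.M = {0}" using partial_image partial_zero by auto
    then show False using S.M_nonzero by blast
  qed
  ultimately have t1: "\<tau> \<^bold>1 \<noteq> 0" by simp
  have one: "cspan {\<^bold>1} = {c *\<^sub>C \<^bold>1 |c. True}"
    by (auto simp: complex_vector.span_singleton)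
  have "direct_sum (Alg V) (cspan {\<^bold>1}) N"
    unfolding direct_sum_def
  proof (intro conjI)
    show "Alg V = cspan {\<^bold>1} + N"
    proof (intro equalityI subsetI)
      fix a assume a: "a \<in> Alg V"
      let ?c = "\<tau> a / \<tau> \<^bold>1"
      have "a - ?c *\<^sub>C \<^bold>1 \<in> N"
        using a t1 A.unit_closed linear_on_diff[OF \<tau> A.subspace] linear_on_scale[OF \<tau>]
        by (simp add: N_def A.A_closed scaleC_complex_def)
      moreover have "?c *\<^sub>C \<^bold>1 \<in> cspan {\<^bold>1}" unfolding one by blast
      ultimately have "?c *\<^sub>C \<^bold>1 + (a - ?c *\<^sub>C \<^bold>1) \<in> cspan {\<^bold>1} + N" by (rule set_plus_intro[rotated])
      then show "a \<in> cspan {\<^bold>1} + N" by simp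
    next
      fix a assume "a \<in> cspan {\<^bold>1} + N"
      then show "a \<in> Alg V"
        unfolding one using NA A.unit_closed by (auto elim!: set_plus_elim simp: A.A_closed subset_iff)
    qed
    show "cspan {\<^bold>1} \<inter> N = {0}"
    proof (intro equalityI subsetI)
      fix a assume "a \<in> cspan {\<^bold>1} \<inter> N"
      then obtain c where c: "a = c *\<^sub>C \<^bold>1" "\<tau> a = 0" unfolding one N_def by blast
      then have "c = 0" using t1 linear_on_scale[OF \<tau> A.unit_closed] by (simp add: scaleC_complex_def)
      then show "a \<in> {0}" using c by simp
    qed (use Ns in \<open>simp add: csub\<close>)
  qed (use Ns in simp_all)
  moreover have "lie_module g (bracket V) N (anchor V)"
  proof
    show "csubspace N" by (fact Ns)
    show "bilinear_on g N N (anchor V)"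
      unfolding bilinear_on_def
    proof (intro conjI ballI)
      show "linear_on N N (anchor V u)" if "u \<in> g" for u
        using linear_on_subset[OF anchor_linear NA, of u N] anchor_X XN NA that gB by blast
      show "linear_on g N (\<lambda>u. u \<rhd>\<^sub>0 a)" if "a \<in> N" for a
        using linear_on_subset[OF anchor_linear_left gB, of a N] anchor_X XN NA that gB by blast
    qed
    show "(u \<bullet>\<^sub>0 v) \<rhd>\<^sub>0 a = u \<rhd>\<^sub>0 (v \<rhd>\<^sub>0 a) - v \<rhd>\<^sub>0 (u \<rhd>\<^sub>0 a)"
      if "u \<in> g" "v \<in> g" "a \<in> N" for u v a
      using anchor_bracket that gB NA by blast
  qed
  ultimately show ?thesis unfolding unit_complement_def by blast
qed

end

section \<open>Lie algebras with Clifford-type bracket\<close>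

text \<open>The Lie-theoretic end of the argument. In the application \<open>g\<close> is a Levi
  factor; there the double bracket formula holds exactly, not just modulo
  \<open>Leib\<close>.\<close>

locale clifford_lie_algebra = lie_algebra g br
  for g :: "'g::complex_vector set" and br +
  fixes \<kappa> :: "'g \<Rightarrow> 'g \<Rightarrow> complex"
  assumes form_bilinear: "bilinear_on g g UNIV \<kappa>"
    and form_sym: "\<lbrakk>x \<in> g; y \<in> g\<rbrakk> \<Longrightarrow> \<kappa> x y = \<kappa> y x"
    and form_assoc: "\<lbrakk>x \<in> g; y \<in> g; z \<in> g\<rbrakk> \<Longrightarrow> \<kappa> (br x y) z = \<kappa> x (br y z)"
    and form_nondegenerate: "\<lbrakk>x \<in> g; \<And>y. y \<in> g \<Longrightarrow> \<kappa> x y = 0\<rbrakk> \<Longrightarrow> x = 0"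
    and double_bracket: "\<lbrakk>u \<in> g; v \<in> g; w \<in> g\<rbrakk> \<Longrightarrow>
      br (br w u) v = (2 * \<kappa> u v) *\<^sub>C w - (2 * \<kappa> w v) *\<^sub>C u"
    and nontrivial: "g \<noteq> {0}"
begin

lemma form_scale:
  "\<lbrakk>x \<in> g; y \<in> g\<rbrakk> \<Longrightarrow> \<kappa> (c *\<^sub>C x) y = c * \<kappa> x y"
  "\<lbrakk>x \<in> g; y \<in> g\<rbrakk> \<Longrightarrow> \<kappa> x (c *\<^sub>C y) = c * \<kappa> x y"
  using form_bilinear by (auto simp: bilinear_on_def linear_on_def scaleC_complex_def)

lemma antisym:
  assumes "x \<in> g" "y \<in> g"
  shows "br y x = - br x y"
proof -
  have "br (x + y) (x + y) = br x x + br y x + (br x y + br y y)"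
    using assms by (simp only: br_simps L_closed)
  then have "br x y + br y x = 0"
    using assms alternating[of x] alternating[of y] alternating[of "x + y"]
    by (simp add: L_closed add.commute)
  then show ?thesis by (simp add: add_eq_0_iff)
qed

text \<open>For commuting \<open>x\<close> and \<open>y\<close> the double bracket formula has left
  side 0 and becomes a linear relation between them. With nondegeneracy this forces rank
  one.\<close>

lemma commuting_dependent:
  assumes "x \<in> g" "y \<in> g" "br x y = 0" "v \<in> g"
  shows "\<kappa> y v *\<^sub>C x = \<kappa> x v *\<^sub>C y"
proof -
  have "(2 * \<kappa> y v) *\<^sub>C x = (2 * \<kappa> x v) *\<^sub>C y"
    using double_bracket[OF assms(2,4,1)] assms by (simp add: br_simps)
  then have "(1/2) *\<^sub>C ((2 * \<kappa> y v) *\<^sub>C x) = (1/2) *\<^sub>C ((2 * \<kappa> x v) *\<^sub>C y)" by (rule arg_cong)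
  then show ?thesis unfolding scaleC_scaleC by simp
qed

text \<open>On the orthogonal space of \<open>t\<close> the formula for \<open>[[t, x], t]\<close>
  keeps only its term in \<open>x\<close>. All information about roots comes from this
  square.\<close>

lemma ad_square:
  assumes "t \<in> g" "x \<in> g" "\<kappa> t x = 0"
  shows "br t (br t x) = (2 * \<kappa> t t) *\<^sub>C x"
proof -
  have "br t (br t x) = - br (br t x) t"
    using antisym[OF br_mem[OF assms(1,2)] assms(1)] .
  also have "\<dots> = (2 * \<kappa> t t) *\<^sub>C x"
    using double_bracket[of x t t] assms form_sym[of t x] by simp
  finally show ?thesis .
qed

lemma lower_central_subspace:
  assumes "lie_algebra h br"
  shows "csubspace (lower_central h br n) \<and> lower_central h br n \<subseteq> h"
proof -
  interpret h: lie_algebra h br by fact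
  show ?thesis
  proof (induction n)
    case (Suc n)
    then have "{br x y |x y. x \<in> h \<and> y \<in> lower_central h br n} \<subseteq> h" using h.br_mem by blast
    then show ?case
      unfolding lower_central.simps commutator_def
      using complex_vector.span_minimal[OF _ h.subspace] by simp
  qed (simp add: h.subspace)
qed

text \<open>The last nonzero term of the lower central series is central in \<open>h\<close>, so by
  \<open>commuting_dependent\<close> any nonzero \<open>t\<close> in it spans \<open>h\<close>. If
  \<open>\<kappa> t t\<close> were 0, then \<open>[[t, u], t]\<close> would be a multiple of
  \<open>t\<close>, so \<open>[t, u]\<close> would normalize \<open>h\<close> and lie in
  \<open>h\<close>, hence commute with \<open>t\<close>. That makes \<open>\<kappa> u t\<close>
  vanish for all \<open>u\<close>, against nondegeneracy.\<close>

lemma cartan_line: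
  assumes h: "cartan_subalgebra g br h"
  obtains t where "t \<in> g" "\<kappa> t t \<noteq> 0" "h = {c *\<^sub>C t |c. True}"
proof -
  have hg: "h \<subseteq> g" and lie: "lie_algebra h br" and nil: "\<exists>n. lower_central h br n = {0}"
    and norm: "{x \<in> g. \<forall>y\<in>h. br x y \<in> h} = h"
    using h by (auto simp: cartan_subalgebra_def)
  interpret h: lie_algebra h br by (fact lie)
  \<comment> \<open>The zero subspace is normalized by all of \<open>g\<close>, so it is
    self-normalizing only if \<open>g\<close> is zero.\<close>
  have h0: "h \<noteq> {0}"
  proof
    assume "h = {0}"
    then have "{x \<in> g. \<forall>y\<in>{0}. br x y \<in> {0}} = {0}" using norm by simp
    moreover have "{x \<in> g. \<forall>y\<in>{0}. br x y \<in> {0}} = g" by (auto simp: br_simps)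
    ultimately show False using nontrivial by simp
  qed
  define n where "n = (LEAST n. lower_central h br n = {0})"
  have n: "lower_central h br n = {0}" unfolding n_def using nil by (rule LeastI_ex)
  then obtain k where k: "n = Suc k" using h0 by (cases n) auto
  have "lower_central h br k \<noteq> {0}"
    using not_less_Least[of k "\<lambda>n. lower_central h br n = {0}"] k by (simp add: n_def)
  then obtain t where t: "t \<in> lower_central h br k" "t \<noteq> 0"
    using lower_central_subspace[OF lie, of k] csub(3) by blast
  have th: "t \<in> h" using t lower_central_subspace[OF lie, of k] by blast
  have tg: "t \<in> g" using th hg by blast
  have central: "br y t = 0" if "y \<in> h" for y
  proof -
    have "br y t \<in> lower_central h br (Suc k)"
      unfolding lower_central.simps commutator_def
      by (rule complex_vector.span_base) (use that t in blast)
    then show ?thesis using n k by simp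
  qed
  obtain v where v: "v \<in> g" "\<kappa> t v \<noteq> 0" using form_nondegenerate[OF tg] t(2) by blast
  have line: "h = {c *\<^sub>C t |c. True}"
  proof (intro equalityI subsetI)
    fix y assume y: "y \<in> h"
    have yg: "y \<in> g" using y hg by blast
    have "\<kappa> t v *\<^sub>C y = \<kappa> y v *\<^sub>C t"
      using commuting_dependent[OF yg tg central[OF y] v(1)] .
    then have "(1 / \<kappa> t v) *\<^sub>C (\<kappa> t v *\<^sub>C y) = (1 / \<kappa> t v) *\<^sub>C (\<kappa> y v *\<^sub>C t)" by simp
    then have "y = (\<kappa> y v / \<kappa> t v) *\<^sub>C t" using v(2) by (simp add: scaleC_scaleC scaleC_one)
    then show "y \<in> {c *\<^sub>C t |c. True}" by blast
  qed (use th h.subspace in \<open>auto simp: csub\<close>)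
  have "\<kappa> t t \<noteq> 0"
  proof
    assume tt: "\<kappa> t t = 0"
    have "\<kappa> t u = 0" if u: "u \<in> g" for u
    proof -
      have dbl: "br (br t u) t = (2 * \<kappa> u t) *\<^sub>C t"
        using double_bracket[OF u tg tg] tt by simp
      have "br (br t u) y \<in> h" if y: "y \<in> h" for y
      proof -
        obtain c where c: "y = c *\<^sub>C t" using y line by blast
        have "br (br t u) y = (c * (2 * \<kappa> u t)) *\<^sub>C t"
          using c dbl u tg by (simp add: br_simps br_mem scaleC_scaleC)
        then show ?thesis using line by blast
      qed
      then have "br t u \<in> h" using norm u tg br_mem by blast
      then have "br (br t u) t = 0" using central by blast
      then have "\<kappa> u t = 0" using dbl t(2) by simp
      then show ?thesis using form_sym tg u by simp
    qed
    then show False using form_nondegenerate[OF tg] t(2) by blast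
  qed
  then show ?thesis using that tg line by blast
qed

section \<open>Roots and weights relative to a Cartan line spanned by t\<close>

context
  fixes h t
  assumes t: "t \<in> g" "\<kappa> t t \<noteq> 0" and h: "h = {c *\<^sub>C t |c. True}"
begin

lemma t_h: "t \<in> h"
proof -
  have "t = 1 *\<^sub>C t" by (simp add: scaleC_one)
  then show ?thesis using h by blast
qed

lemma dual_space_scale: "\<alpha> \<in> dual_space h \<Longrightarrow> \<alpha> (c *\<^sub>C t) = c * \<alpha> t"
  using t_h by (simp add: dual_space_def linear_on_def scaleC_complex_def)

lemma dual_space_eqI:
  assumes "\<alpha> \<in> dual_space h" "\<beta> \<in> dual_space h" "\<alpha> t = \<beta> t"
  shows "\<alpha> = \<beta>"
proof
  fix x
  show "\<alpha> x = \<beta> x"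
  proof (cases "x \<in> h")
    case True
    then obtain c where "x = c *\<^sub>C t" using h by blast
    then show ?thesis
      using assms(3) dual_space_scale[OF assms(1)] dual_space_scale[OF assms(2)] by simp
  qed (use assms in \<open>simp add: dual_space_def\<close>)
qed

lemma zero_dual: "0 \<in> dual_space h"
  by (simp add: dual_space_def linear_on_def)

lemma root_vector:
  assumes "\<alpha> \<in> roots g br h"
  obtains x where "x \<in> g" "x \<noteq> 0" "br t x = \<alpha> t *\<^sub>C x"
proof -
  have "0 \<in> root_space g br h \<alpha>"
    using h t(1) by (auto simp: root_space_def L_closed br_simps)
  then obtain x where "x \<in> root_space g br h \<alpha>" "x \<noteq> 0"
    using assms by (auto simp: roots_def)
  then show ?thesis using that t_h by (auto simp: root_space_def)
qed

lemma eigenvector_orthogonal: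
  assumes "x \<in> g" "br t x = c *\<^sub>C x" "c \<noteq> 0"
  shows "\<kappa> t x = 0"
proof -
  have "c * \<kappa> t x = \<kappa> (br t t) x" using form_assoc[OF t(1,1) assms(1)] assms t form_scale by simp
  also have "\<dots> = 0" using alternating t(1) form_scale(1)[OF t(1) assms(1), of 0] by simp
  finally show ?thesis using assms(3) by simp
qed

text \<open>By invariance an eigenvector with nonzero eigenvalue is orthogonal to \<open>t\<close>,
  so \<open>ad_square\<close> applies. Hence nonzero eigenvalues of \<open>t\<close>, and with them
  all roots, agree up to sign.\<close>

lemma eigenvalue_square:
  assumes "x \<in> g" "x \<noteq> 0" "br t x = c *\<^sub>C x" "c \<noteq> 0"
  shows "c\<^sup>2 = 2 * \<kappa> t t"
proof -
  have "(c\<^sup>2) *\<^sub>C x = br t (br t x)"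
    using assms t by (simp add: br_simps scaleC_scaleC power2_eq_square)
  also have "\<dots> = (2 * \<kappa> t t) *\<^sub>C x"
    using ad_square[OF t(1) assms(1) eigenvector_orthogonal[OF assms(1,3,4)]] .
  finally show ?thesis using assms(2) by simp
qed

lemma root_nonzero:
  assumes "\<alpha> \<in> roots g br h"
  shows "\<alpha> t \<noteq> 0"
proof
  assume "\<alpha> t = 0"
  then have "\<alpha> = 0"
    by (intro dual_space_eqI[OF _ zero_dual]) (use assms in \<open>auto simp: roots_def\<close>)
  then show False using assms by (simp add: roots_def)
qed

lemma root_square:
  assumes "\<alpha> \<in> roots g br h"
  shows "(\<alpha> t)\<^sup>2 = 2 * \<kappa> t t"
proof -
  obtain x where "x \<in> g" "x \<noteq> 0" "br t x = \<alpha> t *\<^sub>C x" using root_vector[OF assms] .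
  then show ?thesis using eigenvalue_square root_nonzero[OF assms] by blast
qed

lemma dual_vector_eq:
  assumes "\<alpha> \<in> dual_space h"
  shows "dual_vector h \<kappa> \<alpha> = (\<alpha> t / \<kappa> t t) *\<^sub>C t"
  unfolding dual_vector_def
proof (rule the_equality)
  show "(\<alpha> t / \<kappa> t t) *\<^sub>C t \<in> h \<and> (\<forall>x\<in>h. \<kappa> ((\<alpha> t / \<kappa> t t) *\<^sub>C t) x = \<alpha> x)"
    using h t dual_space_scale[OF assms] by (auto simp: form_scale L_closed)
  fix s assume s: "s \<in> h \<and> (\<forall>x\<in>h. \<kappa> s x = \<alpha> x)"
  then obtain d where d: "s = d *\<^sub>C t" using h by blast
  have "\<kappa> s t = \<alpha> t" using s t_h by blast
  then have "d = \<alpha> t / \<kappa> t t" using d t by (simp add: form_scale field_simps)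
  then show "s = (\<alpha> t / \<kappa> t t) *\<^sub>C t" using d by simp
qed

lemma dual_form_eq:
  assumes "\<alpha> \<in> dual_space h" "\<beta> \<in> dual_space h"
  shows "dual_form h \<kappa> \<alpha> \<beta> = \<alpha> t * \<beta> t / \<kappa> t t"
  using t by (simp add: dual_form_def dual_vector_eq[OF assms(1)] dual_vector_eq[OF assms(2)]
      form_scale L_closed)

text \<open>On a line \<open>(\<alpha>, \<alpha>)\<close> is the square of \<open>\<alpha> t\<close>
  divided by \<open>\<kappa> t t\<close>. The normalization 2 is thus the coefficient 2 of the
  double bracket formula.\<close>

lemma dual_form_root:
  assumes "\<alpha> \<in> roots g br h"
  shows "dual_form h \<kappa> \<alpha> \<alpha> = 2"
proof -
  have "\<alpha> \<in> dual_space h" using assms by (simp add: roots_def)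
  then show ?thesis
    using dual_form_eq root_square[OF assms] t(2) by (simp add: power2_eq_square)
qed

text \<open>Two roots are equal or opposite, so an independent set of roots has at most one element,
  and it is nonempty because \<open>h\<close> has a nonzero functional. A natural multiple of
  \<open>\<alpha>\<close> that is a root can only be \<open>\<alpha>\<close>, since the factor
  cannot be -1.\<close>

lemma root_base_single:
  assumes \<Delta>: "root_base g br h \<Delta>"
  obtains \<alpha> where "\<alpha> \<in> roots g br h" "\<Delta> = {\<alpha>}" "positive_roots g br h \<Delta> \<subseteq> {\<alpha>}"
proof -
  have D: "\<Delta> \<subseteq> roots g br h" "\<not> cdependent \<Delta>" "cspan \<Delta> = dual_space h"
    using \<Delta> by (auto simp: root_base_def)
  have "\<Delta> \<noteq> {}"
  proof
    assume "\<Delta> = {}"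
    then have 0: "dual_space h = {0}" using D(3) by simp
    \<comment> \<open>The functional \<open>\<kappa> t\<close> on \<open>h\<close>, extended by 0 as
      \<open>dual_space\<close> demands, takes the nonzero value \<open>\<kappa> t t\<close> at
      \<open>t\<close>.\<close>
    let ?a = "\<lambda>x. if x \<in> h then \<kappa> t x else 0"
    have "linear_on h UNIV ?a"
    proof (rule linear_onI)
      fix x y assume "x \<in> h" "y \<in> h"
      then obtain c d where cd: "x = c *\<^sub>C t" "y = d *\<^sub>C t" using h by blast
      then have "x + y = (c + d) *\<^sub>C t" by (simp add: scaleC_add_left)
      then have "x + y \<in> h" "\<kappa> t (x + y) = (c + d) * \<kappa> t t" using h t form_scale by auto
      then show "?a (x + y) = ?a x + ?a y"
        using cd h t form_scale by (auto simp: algebra_simps)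
    next
      fix c x assume "x \<in> h"
      then obtain d where d: "x = d *\<^sub>C t" using h by blast
      then have "c *\<^sub>C x = (c * d) *\<^sub>C t" by (simp add: scaleC_scaleC)
      then have "c *\<^sub>C x \<in> h" "\<kappa> t (c *\<^sub>C x) = c * (d * \<kappa> t t)" using h t form_scale by auto
      then show "?a (c *\<^sub>C x) = c *\<^sub>C ?a x"
        using d h t form_scale by (auto simp: scaleC_complex_def)
    qed simp
    then have "?a \<in> dual_space h" by (simp add: dual_space_def)
    then have "?a = 0" using 0 by blast
    then have "?a t = 0" using fun_cong[of ?a 0 t] by (simp add: zero_fun_def)
    then show False using t_h t(2) by simp
  qed
  then obtain \<alpha> where \<alpha>: "\<alpha> \<in> \<Delta>" by blast
  have ar: "\<alpha> \<in> roots g br h" using \<alpha> D by blast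
  have dual: "\<beta> \<in> dual_space h" if "\<beta> \<in> roots g br h" for \<beta> using that by (simp add: roots_def)
  have pm: "\<beta> t = \<alpha> t \<or> \<beta> t = - \<alpha> t" if "\<beta> \<in> roots g br h" for \<beta>
    using root_square[OF that] root_square[OF ar] by (metis power2_eq_iff)
  have "\<beta> = \<alpha>" if b: "\<beta> \<in> \<Delta>" for \<beta>
  proof (rule ccontr)
    assume ne: "\<beta> \<noteq> \<alpha>"
    have br: "\<beta> \<in> roots g br h" using b D by blast
    have "\<beta> t = - \<alpha> t" using pm[OF br] dual_space_eqI[OF dual[OF br] dual[OF ar]] ne by blast
    have "(-1) *\<^sub>C \<alpha> \<in> cspan \<Delta>" using \<alpha> by (intro complex_vector.span_scale complex_vector.span_base)
    then have "(-1) *\<^sub>C \<alpha> \<in> dual_space h" using D(3) by simp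
    then have "\<beta> = (-1) *\<^sub>C \<alpha>"
      using \<open>\<beta> t = - \<alpha> t\<close> dual[OF br]
      by (intro dual_space_eqI) (auto simp: scaleC_fun_def scaleC_complex_def)
    moreover have "(-1) *\<^sub>C \<alpha> \<in> cspan (\<Delta> - {\<beta>})"
      using \<alpha> ne by (intro complex_vector.span_scale complex_vector.span_base) simp
    ultimately show False using b D(2) unfolding complex_vector.dependent_def by auto
  qed
  then have single: "\<Delta> = {\<alpha>}" using \<alpha> by blast
  have "\<gamma> = \<alpha>" if g: "\<gamma> \<in> positive_roots g br h \<Delta>" for \<gamma>
  proof -
    have gr: "\<gamma> \<in> roots g br h" using g by (simp add: positive_roots_def)
    obtain k :: nat where k: "\<gamma> = of_nat k *\<^sub>C \<alpha>"
      using g single by (auto simp: positive_roots_def nat_combinations_def)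
    then have kt: "\<gamma> t = of_nat k * \<alpha> t" by (simp add: scaleC_fun_def scaleC_complex_def)
    have "\<gamma> t = \<alpha> t"
    proof (rule ccontr)
      assume "\<gamma> t \<noteq> \<alpha> t"
      then have "of_nat k * \<alpha> t = - \<alpha> t" using pm[OF gr] kt by simp
      then have "(of_nat k + 1) * \<alpha> t = 0" by (simp add: algebra_simps)
      then have "of_nat (Suc k) = (0::complex)" using root_nonzero[OF ar] by (simp add: add.commute)
      then show False using of_nat_neq_0 by blast
    qed
    then show ?thesis using dual_space_eqI[OF dual[OF gr] dual[OF ar]] by blast
  qed
  then show ?thesis using that ar single by blast
qed

text \<open>Let \<open>e\<close> be a root vector for \<open>\<alpha>\<close>. It is orthogonal to
  \<open>t\<close>, so on the module \<open>t\<close> and \<open>e\<close> anticommute, while their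
  commutator is \<open>\<alpha> t\<close> times \<open>e\<close>. Hence every nonzero
  \<open>act e w\<close> has weight half of \<open>\<alpha>\<close>. A vector of a positive root
  space both commutes and anticommutes with \<open>e\<close>, and kills \<open>act e w\<close>
  because the root space itself kills the module twice over.\<close>

lemma highest_weight_module:
  assumes \<Delta>: "root_base g br h \<Delta>" and M: "simple_lie_module g br M act" and fin: "finite_dim M"
    and cl: "\<And>u v m. \<lbrakk>u \<in> g; v \<in> g; m \<in> M\<rbrakk> \<Longrightarrow> act u (act v m) + act v (act u m) = \<kappa> u v *\<^sub>C m"
  shows "\<exists>\<mu>. dominant_integral h \<Delta> \<kappa> \<mu> \<and> irreducible_highest_weight_module g br h \<Delta> M act \<mu>"
proof -
  interpret M: simple_lie_module g br M act by (fact M)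
  have actl: "linear_on M M (act x)" if "x \<in> g" for x
    using M.module_bilinear that by (simp add: bilinear_on_def)
  have actr: "linear_on g M (\<lambda>x. act x m)" if "m \<in> M" for m
    using M.module_bilinear that by (simp add: bilinear_on_def)
  have act_mem: "act x m \<in> M" if "x \<in> g" "m \<in> M" for x m using linear_on_mem[OF actl] that .
  obtain \<alpha> where \<alpha>: "\<alpha> \<in> roots g br h" "\<Delta> = {\<alpha>}" "positive_roots g br h \<Delta> \<subseteq> {\<alpha>}"
    using root_base_single[OF \<Delta>] .
  have at: "\<alpha> t \<noteq> 0" "(\<alpha> t)\<^sup>2 = 2 * \<kappa> t t"
    using root_nonzero[OF \<alpha>(1)] root_square[OF \<alpha>(1)] by auto
  have ad: "\<alpha> \<in> dual_space h" using \<alpha>(1) by (simp add: roots_def)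
  obtain e where e: "e \<in> g" "e \<noteq> 0" "br t e = \<alpha> t *\<^sub>C e" using root_vector[OF \<alpha>(1)] .
  \<comment> \<open>If \<open>e\<close> acted by zero, the Clifford relation of \<open>e\<close>
    with any \<open>v\<close> would give \<open>\<kappa> e v = 0\<close>, against
    nondegeneracy.\<close>
  have "\<exists>w\<in>M. act e w \<noteq> 0"
  proof (rule ccontr)
    assume "\<not> ?thesis"
    then have zero: "act e w = 0" if "w \<in> M" for w using that by blast
    obtain m where m: "m \<in> M" "m \<noteq> 0" using M.nonzero M.module_subspace csub(3) by blast
    have "\<kappa> e v = 0" if v: "v \<in> g" for v
      using cl[OF e(1) v m(1)] zero[OF act_mem[OF v m(1)]] zero[OF m(1)]
        linear_on_zero[OF actl[OF v] M.module_subspace] m(2) by simp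
    then show False using form_nondegenerate[OF e(1)] e(2) by blast
  qed
  then obtain w where w: "w \<in> M" "act e w \<noteq> 0" by blast
  let ?m = "act e w"
  have mM: "?m \<in> M" using act_mem e(1) w(1) by blast
  define \<mu> where "\<mu> = (1/2) *\<^sub>C \<alpha>"
  have \<mu>x: "\<mu> x = \<alpha> x / 2" for x by (simp add: \<mu>_def scaleC_fun_def scaleC_complex_def)
  have \<mu>d: "\<mu> \<in> dual_space h"
    using ad by (simp add: dual_space_def linear_on_def \<mu>x scaleC_complex_def add_divide_distrib)
  have tm: "act t ?m = \<mu> t *\<^sub>C ?m"
  proof -
    have "\<alpha> t *\<^sub>C ?m = act (br t e) w" using linear_on_scale[OF actr[OF w(1)] e(1)] e(3) by simp
    also have "\<dots> = act t ?m - act e (act t w)" using M.module_bracket t(1) e(1) w(1) by simp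
    also have "act e (act t w) = - act t ?m"
      using cl[OF t(1) e(1) w(1)] eigenvector_orthogonal[OF e(1,3) at(1)]
      by (simp add: eq_neg_iff_add_eq_0 add.commute)
    finally have "(1/2) *\<^sub>C (\<alpha> t *\<^sub>C ?m) = (1/2 + 1/2) *\<^sub>C act t ?m"
      by (simp only: diff_minus_eq_add scaleC_add_left scaleC_add_right)
    then show ?thesis by (simp add: \<mu>x scaleC_scaleC scaleC_one)
  qed
  have "act s ?m = \<mu> s *\<^sub>C ?m" if "s \<in> h" for s
  proof -
    obtain c where "s = c *\<^sub>C t" using \<open>s \<in> h\<close> h by blast
    then show ?thesis
      using tm linear_on_scale[OF actr[OF mM] t(1)] dual_space_scale[OF \<mu>d] by (simp add: scaleC_scaleC)
  qed
  moreover have "act x ?m = 0"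
    if "\<beta> \<in> positive_roots g br h \<Delta>" "x \<in> root_space g br h \<beta>" for \<beta> x
  proof -
    have x: "x \<in> g" "br t x = \<alpha> t *\<^sub>C x" using that \<alpha>(3) t_h by (auto simp: root_space_def)
    have "\<alpha> t * \<kappa> e x = \<kappa> (br t e) x" using e x form_scale by simp
    also have "\<dots> = \<kappa> ((-1) *\<^sub>C br e t) x" using antisym[OF e(1) t(1)] by (simp add: scaleC_one)
    also have "\<dots> = - \<kappa> e (br t x)"
      using form_scale(1)[of "br e t" x "-1"] form_assoc[OF e(1) t(1) x(1)] e t x br_mem by simp
    also have "\<dots> = - (\<alpha> t * \<kappa> e x)" using x e form_scale by simp
    finally have ex: "\<kappa> e x = 0" using at(1) by simp
    \<comment> \<open>A nonzero bracket would be an eigenvector of \<open>t\<close> with eigenvalue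
      twice \<open>\<alpha> t\<close>, whose square is four times the only possible value.\<close>
    have "br e x = 0"
    proof (rule ccontr)
      let ?z = "br e x"
      assume z0: "?z \<noteq> 0"
      have zg: "?z \<in> g" using e x br_mem by blast
      have "br t ?z = \<alpha> t *\<^sub>C ?z + \<alpha> t *\<^sub>C ?z"
        using leibniz[OF t(1) e(1) x(1)] e x by (simp add: br_simps)
      then have tz: "br t ?z = (2 * \<alpha> t) *\<^sub>C ?z" by (simp only: mult_2 scaleC_add_left)
      have "(2 * \<alpha> t)\<^sup>2 = 2 * \<kappa> t t"
        by (rule eigenvalue_square[OF zg z0 tz]) (use at(1) in simp)
      then have "(2 * \<alpha> t)\<^sup>2 = (\<alpha> t)\<^sup>2" using at(2) by simp
      then show False using at(1) by (simp add: power2_eq_square)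
    qed
    then have "act e (act x w) - act x ?m = 0"
      using M.module_bracket[OF e(1) x(1) w(1)] linear_on_zero[OF actr[OF w(1)] subspace] by simp
    moreover have "act e (act x w) + act x ?m = 0" using cl[OF e(1) x(1) w(1)] ex by simp
    ultimately have "act x ?m + act x ?m = 0" by simp
    then have "2 *\<^sub>C act x ?m = 0" by (metis one_add_one scaleC_add_left scaleC_one)
    then show ?thesis by simp
  qed
  ultimately have "irreducible_highest_weight_module g br h \<Delta> M act \<mu>"
    unfolding irreducible_highest_weight_module_def using M fin mM w(2) by blast
  moreover have "dominant_integral h \<Delta> \<kappa> \<mu>"
  proof -
    \<comment> \<open>\<open>\<mu>\<close> is half of \<open>\<alpha>\<close>, so its pairing with
      the coroot of \<open>\<alpha>\<close> is 1.\<close>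
    have "2 * dual_form h \<kappa> \<mu> \<alpha> / dual_form h \<kappa> \<alpha> \<alpha> = 1"
      using at t(2) dual_form_root[OF \<alpha>(1)]
      by (simp add: dual_form_eq[OF \<mu>d ad] \<mu>x power2_eq_square)
    then show ?thesis unfolding dominant_integral_def using \<mu>d \<alpha>(2) by simp
  qed
  ultimately show ?thesis by blast
qed

end

lemma normalized: "normalized_killing_form g br \<kappa>"
  unfolding normalized_killing_form_def
proof (intro conjI allI impI ballI)
  show "x = 0" if "x \<in> g" "\<forall>y\<in>g. \<kappa> x y = 0" for x
    using form_nondegenerate that by blast
  show "dual_form h \<kappa> \<alpha> \<alpha> = 2"
    if h: "cartan_subalgebra g br h" and \<alpha>: "\<alpha> \<in> long_roots g br h \<kappa>" for h \<alpha>
  proof -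
    obtain t where t: "t \<in> g" "\<kappa> t t \<noteq> 0" "h = {c *\<^sub>C t |c. True}" using cartan_line[OF h] .
    show ?thesis by (rule dual_form_root[OF t]) (use \<alpha> in \<open>simp add: long_roots_def\<close>)
  qed
qed (use form_bilinear form_sym form_assoc in auto)

end

section \<open>Transport of structure\<close>

lemma linear_on_transport:
  assumes h: "linear_on X Z h" and f: "linear_on X Y f" and X: "csubspace X"
    and F: "\<And>x. x \<in> X \<Longrightarrow> F (f x) = h x"
  shows "linear_on (f ` X) Z F"
proof (rule linear_onI)
  show "F y \<in> Z" if "y \<in> f ` X" for y
    using that F linear_on_mem[OF h] by auto
next
  fix y y' assume "y \<in> f ` X" "y' \<in> f ` X"
  then obtain x x' where x: "x \<in> X" "y = f x" "x' \<in> X" "y' = f x'" by blast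
  have "F (y + y') = F (f (x + x'))" using linear_on_add[OF f x(1,3)] x(2,4) by simp
  also have "\<dots> = h x + h x'"
    using F[OF complex_vector.subspace_add[OF X x(1,3)]] linear_on_add[OF h x(1,3)] by simp
  finally show "F (y + y') = F y + F y'" using F x by simp
next
  fix c y assume "y \<in> f ` X"
  then obtain x where x: "x \<in> X" "y = f x" by blast
  have "F (c *\<^sub>C y) = F (f (c *\<^sub>C x))" using linear_on_scale[OF f x(1)] x(2) by simp
  also have "\<dots> = c *\<^sub>C h x"
    using F[OF complex_vector.subspace_scale[OF X x(1)]] linear_on_scale[OF h x(1)] by simp
  finally show "F (c *\<^sub>C y) = c *\<^sub>C F y" using F x by simp
qed

lemma bilinear_on_transport:
  assumes "bilinear_on X Y Z op1"
    and f: "linear_on X X' f" "f ` X = X'" and g: "linear_on Y Y' g" "g ` Y = Y'"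
    and k: "linear_on Z Z' k" and sub: "csubspace X" "csubspace Y"
    and op: "\<And>x y. \<lbrakk>x \<in> X; y \<in> Y\<rbrakk> \<Longrightarrow> op2 (f x) (g y) = k (op1 x y)"
  shows "bilinear_on X' Y' Z' op2"
proof -
  have r: "linear_on Y Z (op1 x)" if "x \<in> X" for x using assms(1) that by (simp add: bilinear_on_def)
  have l: "linear_on X Z (\<lambda>x. op1 x y)" if "y \<in> Y" for y using assms(1) that by (simp add: bilinear_on_def)
  have "linear_on Y' Z' (op2 x')" if x': "x' \<in> X'" for x'
  proof -
    obtain x where x: "x \<in> X" "x' = f x" using x' f(2) by (metis imageE)
    note rx = linear_on_comp[OF r[OF x(1)] k]
    have "op2 x' (g y) = k (op1 x y)" if "y \<in> Y" for y using op[OF x(1) that] x(2) by simp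
    then have "linear_on (g ` Y) Z' (op2 x')" by (rule linear_on_transport[OF rx g(1) sub(2)])
    then show ?thesis using g(2) by simp
  qed
  moreover have "linear_on X' Z' (\<lambda>x'. op2 x' y')" if y': "y' \<in> Y'" for y'
  proof -
    obtain y where y: "y \<in> Y" "y' = g y" using y' g(2) by (metis imageE)
    note ly = linear_on_comp[OF l[OF y(1)] k]
    have "op2 (f x) y' = k (op1 x y)" if "x \<in> X" for x using op[OF that y(1)] y(2) by simp
    then have "linear_on (f ` X) Z' (\<lambda>x'. op2 x' y')" by (rule linear_on_transport[OF ly f(1) sub(1)])
    then show ?thesis using f(2) by simp
  qed
  ultimately show ?thesis by (simp add: bilinear_on_def)
qed

context vertex_algebroid
begin

text \<open>Every axiom is an identity between the operations, and a bijective pair of maps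
  respecting them carries it over. This proves that \<open>B_lambda\<close> is an algebroid without
  checking its formulas one by one.\<close>

lemma transport:
  fixes W :: "('c::complex_vector, 'd::complex_vector) algebroid"
  assumes hom: "algebroid_hom V W f g" and bij: "bij_betw f (Alg V) (Alg W)" "bij_betw g (Vec V) (Vec W)"
  shows "vertex_algebroid W"
proof -
  have f: "linear_on (Alg V) (Alg W) f" and g: "linear_on (Vec V) (Vec W) g"
    and one: "f \<^bold>1 = aone W"
    and mulW: "\<And>a b. \<lbrakk>a \<in> Alg V; b \<in> Alg V\<rbrakk> \<Longrightarrow> f (a \<star> b) = amult W (f a) (f b)"
    and brW: "\<And>u v. \<lbrakk>u \<in> Vec V; v \<in> Vec V\<rbrakk> \<Longrightarrow> g (u \<bullet>\<^sub>0 v) = bracket W (g u) (g v)"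
    and actW: "\<And>a v. \<lbrakk>a \<in> Alg V; v \<in> Vec V\<rbrakk> \<Longrightarrow> g (a \<cdot> v) = aact W (f a) (g v)"
    and pairW: "\<And>u v. \<lbrakk>u \<in> Vec V; v \<in> Vec V\<rbrakk> \<Longrightarrow> pairing W (g u) (g v) = f (u \<bullet>\<^sub>1 v)"
    and parW: "\<And>a. a \<in> Alg V \<Longrightarrow> g (\<partial> a) = partial W (f a)"
    and ancW: "\<And>v a. \<lbrakk>v \<in> Vec V; a \<in> Alg V\<rbrakk> \<Longrightarrow> f (v \<rhd>\<^sub>0 a) = anchor W (g v) (f a)"
    using hom unfolding algebroid_hom_def by blast+
  note one = one[symmetric] and mulW = mulW[symmetric] and brW = brW[symmetric]
    and actW = actW[symmetric] and parW = parW[symmetric] and ancW = ancW[symmetric]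
  have fim: "f ` Alg V = Alg W" and gim: "g ` Vec V = Vec W" using bij by (auto simp: bij_betw_def)
  have Asub: "csubspace (Alg W)" and Vsub: "csubspace (Vec W)"
    using linear_on_image_subspace[OF f A.subspace] linear_on_image_subspace[OF g B.subspace] fim gim by auto
  have fE: "\<exists>a\<in>Alg V. x = f a" if "x \<in> Alg W" for x using that unfolding fim[symmetric] by blast
  have gE: "\<exists>v\<in>Vec V. x = g v" if "x \<in> Vec W" for x using that unfolding gim[symmetric] by blast
  note lin = linear_on_add[OF f, symmetric] linear_on_diff[OF f A.subspace, symmetric]
    linear_on_add[OF g, symmetric] linear_on_diff[OF g B.subspace, symmetric]
  note mem = A.mul_mem B.br_mem linear_on_mem[OF bilinear_on_right[OF act_bilinear]]
    linear_on_mem[OF bilinear_on_right[OF anchor_bilinear]]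
    linear_on_mem[OF bilinear_on_right[OF pairing_bilinear]] linear_on_mem[OF partial_linear]
    A.unit_closed
  note W = one mulW brW actW pairW parW ancW
  note z = linear_on_zero[OF f A.subspace]
  have bil_anc: "bilinear_on (Vec W) (Alg W) (Alg W) (anchor W)"
    using bilinear_on_transport[OF anchor_bilinear g gim f fim f B.subspace A.subspace] ancW by blast
  have der: "v \<rhd>\<^sub>0 (a \<star> b) = (v \<rhd>\<^sub>0 a) \<star> b + a \<star> (v \<rhd>\<^sub>0 b)"
    if "v \<in> Vec V" "a \<in> Alg V" "b \<in> Alg V" for v a b
    using anchor_derivation that by (auto simp: derivations_def)
  show ?thesis
  proof (intro vertex_algebroid.intro comm_algebra.intro left_leibniz_algebra.intro
      vertex_algebroid_axioms.intro)
    show "csubspace (Alg W)" "csubspace (Vec W)" by (fact Asub, fact Vsub)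
    show "bilinear_on (Alg W) (Alg W) (Alg W) (amult W)"
      using bilinear_on_transport[OF A.bilinear f fim f fim f A.subspace A.subspace] mulW by blast
    show "bilinear_on (Vec W) (Vec W) (Vec W) (bracket W)"
      using bilinear_on_transport[OF B.bilinear g gim g gim g B.subspace B.subspace] brW by blast
    show "bilinear_on (Alg W) (Vec W) (Vec W) (aact W)"
      using bilinear_on_transport[OF act_bilinear f fim g gim g A.subspace B.subspace] actW by blast
    show "bilinear_on (Vec W) (Alg W) (Alg W) (anchor W)" by (fact bil_anc)
    show "bilinear_on (Vec W) (Vec W) (Alg W) (pairing W)"
      using bilinear_on_transport[OF pairing_bilinear g gim g gim f B.subspace B.subspace] pairW by blast
    show "linear_on (Alg W) (Vec W) (partial W)"
    proof (rule linear_onI)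
      fix x assume "x \<in> Alg W"
      then show "partial W x \<in> Vec W" using fE[of x] parW linear_on_mem[OF g] mem by auto
    next
      fix x y assume "x \<in> Alg W" "y \<in> Alg W"
      then obtain a b where "a \<in> Alg V" "x = f a" "b \<in> Alg V" "y = f b" using fE by meson
      then show "partial W (x + y) = partial W x + partial W y"
        by (simp add: lin parW mem A.A_closed linear_on_add[OF partial_linear])
    next
      fix c x assume "x \<in> Alg W"
      then obtain a where "a \<in> Alg V" "x = f a" using fE by meson
      then show "partial W (c *\<^sub>C x) = c *\<^sub>C partial W x"
        by (simp add: parW mem A.A_closed linear_on_scale[OF partial_linear]
            linear_on_scale[OF f, symmetric] linear_on_scale[OF g, symmetric])
    qed
    show "anchor W u \<in> derivations (Alg W) (amult W)" if "u \<in> Vec W" for u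
      unfolding derivations_def
    proof (intro CollectI conjI ballI)
      show "linear_on (Alg W) (Alg W) (anchor W u)" using bilinear_on_right[OF bil_anc that] .
      fix x y assume "x \<in> Alg W" "y \<in> Alg W"
      then obtain a b v where "a \<in> Alg V" "x = f a" "b \<in> Alg V" "y = f b" "v \<in> Vec V" "u = g v"
        using fE gE \<open>u \<in> Vec W\<close> by meson
      then show "anchor W u (amult W x y) = amult W (anchor W u x) y + amult W x (anchor W u y)"
        by (simp add: W mem lin der)
    qed
    show "amult W x y = amult W y x" if "x \<in> Alg W" "y \<in> Alg W" for x y
      using fE[OF that(1)] fE[OF that(2)] A.comm by (auto simp: mulW)
    show "pairing W x y = pairing W y x" if "x \<in> Vec W" "y \<in> Vec W" for x y
      using gE[OF that(1)] gE[OF that(2)] pairing_sym by (auto simp: pairW)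
    show "amult W (amult W a b) c = amult W a (amult W b c)"
      if "a \<in> Alg W" "b \<in> Alg W" "c \<in> Alg W" for a b c
      using fE[OF that(1)] fE[OF that(2)] fE[OF that(3)] by (auto simp: W mem lin A.assoc)
    show "amult W (aone W) a = a"
      if "a \<in> Alg W" for a
      using fE[OF that] by (auto simp: W mem lin A.unit_left)
    show "bracket W u (bracket W v w) = bracket W (bracket W u v) w + bracket W v (bracket W u w)"
      if "u \<in> Vec W" "v \<in> Vec W" "w \<in> Vec W" for u v w
      using gE[OF that(1)] gE[OF that(2)] gE[OF that(3)] by (auto simp: W mem lin B.L_closed B.left_mult_bracket)
    show "aact W (aone W) v = v"
      if "v \<in> Vec W" for v
      using gE[OF that] by (auto simp: W mem lin act_one)
    show "anchor W (bracket W u v) a = anchor W u (anchor W v a) - anchor W v (anchor W u a)"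
      if "u \<in> Vec W" "v \<in> Vec W" "a \<in> Alg W" for u v a
      using gE[OF that(1)] gE[OF that(2)] fE[OF that(3)] by (auto simp: W mem lin anchor_bracket)
    show "anchor W (partial W a) b = 0"
      if "a \<in> Alg W" "b \<in> Alg W" for a b
      using fE[OF that(1)] fE[OF that(2)] by (auto simp: W mem lin partial_anchor z)
    show "aact W a (aact W b v) - aact W (amult W a b) v = aact W (anchor W v a) (partial W b) + aact W (anchor W v b) (partial W a)"
      if "a \<in> Alg W" "b \<in> Alg W" "v \<in> Vec W" for a b v
      using fE[OF that(1)] fE[OF that(2)] gE[OF that(3)] by (auto simp: W mem lin act_act)
    show "bracket W u (aact W a v) = aact W (anchor W u a) v + aact W a (bracket W u v)"
      if "u \<in> Vec W" "a \<in> Alg W" "v \<in> Vec W" for u a v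
      using gE[OF that(1)] fE[OF that(2)] gE[OF that(3)] by (auto simp: W mem lin bracket_act)
    show "bracket W u v + bracket W v u = partial W (pairing W u v)"
      if "u \<in> Vec W" "v \<in> Vec W" for u v
      using gE[OF that(1)] gE[OF that(2)] by (auto simp: W mem lin bracket_sym)
    show "anchor W (aact W a v) b = amult W a (anchor W v b)"
      if "a \<in> Alg W" "v \<in> Vec W" "b \<in> Alg W" for a v b
      using fE[OF that(1)] gE[OF that(2)] fE[OF that(3)] by (auto simp: W mem lin act_anchor)
    show "pairing W (aact W a u) v = amult W a (pairing W u v) - anchor W u (anchor W v a)"
      if "a \<in> Alg W" "u \<in> Vec W" "v \<in> Vec W" for a u v
      using fE[OF that(1)] gE[OF that(2)] gE[OF that(3)] by (auto simp: W mem lin act_pairing)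
    show "anchor W v (pairing W u w) = pairing W (bracket W v u) w + pairing W u (bracket W v w)"
      if "v \<in> Vec W" "u \<in> Vec W" "w \<in> Vec W" for v u w
      using gE[OF that(1)] gE[OF that(2)] gE[OF that(3)] by (auto simp: W mem lin anchor_pairing)
    show "partial W (amult W a b) = aact W a (partial W b) + aact W b (partial W a)"
      if "a \<in> Alg W" "b \<in> Alg W" for a b
      using fE[OF that(1)] fE[OF that(2)] by (auto simp: W mem lin partial_mult)
    show "bracket W v (partial W a) = partial W (anchor W v a)"
      if "v \<in> Vec W" "a \<in> Alg W" for v a
      using gE[OF that(1)] fE[OF that(2)] by (auto simp: W mem lin bracket_partial)
    show "pairing W v (partial W a) = anchor W v a"
      if "v \<in> Vec W" "a \<in> Alg W" for v a
      using gE[OF that(1)] fE[OF that(2)] by (auto simp: W mem lin pairing_partial)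
    show "aone W \<in> Alg W" using linear_on_mem[OF f A.unit_closed] one by simp
  qed
qed

end

section \<open>Square-zero extensions are local\<close>

context comm_algebra
begin

text \<open>An element \<open>c *\<^sub>C unit + n\<close> with \<open>c \<noteq> 0\<close> is
  invertible: as \<open>n\<close> has square 0, a geometric series with two terms gives the inverse.
  So an ideal not contained in \<open>N\<close> is everything, and \<open>N\<close> is the only
  maximal ideal.\<close>

lemma local_algebra_square_zero:
  assumes N: "csubspace N" "N \<subseteq> A" and dec: "\<And>a. a \<in> A \<Longrightarrow> \<exists>c. \<exists>n\<in>N. a = c *\<^sub>C unit + n"
    and unit: "unit \<notin> N" and zero: "\<And>m n. \<lbrakk>m \<in> N; n \<in> N\<rbrakk> \<Longrightarrow> mul m n = 0"
  shows "local_algebra A mul unit"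
proof -
  let ?R = "\<lparr>carrier = A, monoid.mult = mul, one = unit, zero = 0, add = (+)\<rparr>"
  have NA: "n \<in> A" if "n \<in> N" for n using that N(2) by blast
  have NA': "N \<noteq> A" using unit unit_closed by blast
  have "cring ?R"
  proof (rule cringI)
    show "abelian_group ?R"
    proof (rule abelian_groupI)
      show "\<exists>y\<in>carrier ?R. y \<oplus>\<^bsub>?R\<^esub> x = \<zero>\<^bsub>?R\<^esub>" if "x \<in> carrier ?R" for x
        using that by (intro bexI[of _ "- x"]) (auto simp: A_closed)
    qed (auto simp: A_closed algebra_simps)
    show "Group.comm_monoid ?R"
      by (rule comm_monoidI) (auto simp: A_closed unit_closed assoc unit_left intro: comm)
  qed (auto simp: mul_simps)
  then interpret R: cring ?R .
  have mulN: "mul a n \<in> N" if a: "a \<in> A" and n: "n \<in> N" for a n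
  proof -
    obtain c m where "a = c *\<^sub>C unit + m" "m \<in> N" using dec[OF a] by blast
    then have "mul a n = c *\<^sub>C n"
      using n NA zero unit_closed by (simp add: mul_simps A_closed unit_left)
    then show ?thesis using n N(1) by (simp add: csub)
  qed
  have ideal: "ideal N ?R"
  proof (rule idealI)
    show "ring ?R" by (fact R.ring_axioms)
    show "subgroup N (add_monoid ?R)"
    proof (rule R.add.subgroupI)
      show "\<ominus>\<^bsub>?R\<^esub> a \<in> N" if "a \<in> N" for a
      proof -
        have "\<ominus>\<^bsub>?R\<^esub> a = - a"
          by (rule R.minus_equality) (use that NA in \<open>auto simp: A_closed\<close>)
        then show ?thesis using that N(1) by (simp add: csub)
      qed
      show "N \<noteq> {}" using csub(3)[OF N(1)] by blast
    qed (use N NA in \<open>auto simp: csub\<close>)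
    show "x \<otimes>\<^bsub>?R\<^esub> a \<in> N" "a \<otimes>\<^bsub>?R\<^esub> x \<in> N" if "a \<in> N" "x \<in> carrier ?R" for a x
    proof -
      show "a \<otimes>\<^bsub>?R\<^esub> x \<in> N" using that mulN[of x a] comm[of a x] NA by simp
      show "x \<otimes>\<^bsub>?R\<^esub> a \<in> N" using that mulN by simp
    qed
  qed
  have big: "J = A" if J: "ideal J ?R" and a: "a \<in> J" "a \<notin> N" for J a
  proof -
    interpret J: ideal J ?R by (fact J)
    have aA: "a \<in> A" using J.a_subset a(1) by auto
    obtain c n where cn: "a = c *\<^sub>C unit + n" "n \<in> N" using dec[OF aA] by blast
    have c: "c \<noteq> 0"
    proof
      assume "c = 0"
      then have "a = n" using cn(1) by simp
      then show False using cn(2) a(2) by simp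
    qed
    let ?b = "(1 / c) *\<^sub>C unit - (1 / c\<^sup>2) *\<^sub>C n"
    have b: "?b \<in> A" using unit_closed NA cn(2) by (simp add: A_closed)
    have "mul a ?b = unit"
      using cn NA[OF cn(2)] unit_closed zero[OF cn(2,2)] c unit_left[OF unit_closed]
        unit_left[OF NA[OF cn(2)]] unit_right[OF NA[OF cn(2)]]
      by (simp add: mul_simps A_closed scaleC_scaleC scaleC_one scaleC_add_right
          power2_eq_square)
    then have "unit \<in> J" using J.I_r_closed[OF a(1), of ?b] b by simp
    then show ?thesis using J.one_imp_carrier by simp
  qed
  have max: "maximalideal N ?R"
  proof (rule maximalidealI[OF ideal])
    show "carrier ?R \<noteq> N" using NA' by auto
    show "J = N \<or> J = carrier ?R" if "ideal J ?R" "N \<subseteq> J" "J \<subseteq> carrier ?R" for J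
    proof (cases "J \<subseteq> N")
      case True
      then show ?thesis using that(2) by blast
    next
      case False
      then obtain a where "a \<in> J" "a \<notin> N" by blast
      then show ?thesis using big[OF that(1)] by simp
    qed
  qed
  show ?thesis
    unfolding local_algebra_def
  proof (rule ex1I[OF _ ])
    show "maximalideal N ?R" by (fact max)
    fix J assume J: "maximalideal J ?R"
    interpret J: maximalideal J ?R by (fact J)
    have "J \<noteq> A" using J.I_notcarr by simp
    then have JN: "J \<subseteq> N" using big[OF J.ideal_axioms] by blast
    have "N = J \<or> N = carrier ?R" using J.I_maximal[OF ideal JN] N(2) by simp
    moreover have "N \<noteq> carrier ?R" using NA' by simp
    ultimately show "J = N" by blast
  qed
qed

end

section \<open>The classification\<close>

text \<open>The Levi factor and the complement of the identity are arbitrary here, not the ones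
  constructed above, so their relation to \<open>Leib\<close> and \<open>X\<close> has to be derived
  anew.\<close>

locale split_vertex_algebroid = simple_vertex_algebroid V
  for V :: "('a::complex_vector, 'b::complex_vector) algebroid" (structure) +
  fixes g :: "'b set" and N :: "'a set" and form :: "'b \<Rightarrow> 'b \<Rightarrow> complex"
  assumes levi: "levi_factor V g"
    and complement: "unit_complement V g N"
    and form_bilinear: "bilinear_on g g UNIV form"
    and form_pairing: "\<lbrakk>u \<in> g; v \<in> g\<rbrakk> \<Longrightarrow> form u v *\<^sub>C \<^bold>1 = u \<bullet>\<^sub>1 v"
    and partial_kernel: "{a \<in> Alg V. \<partial> a = 0} = cspan {\<^bold>1}"
begin

lemma g_Vec: "x \<in> g \<Longrightarrow> x \<in> Vec V"
  using levi by (auto simp: levi_factor_def)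

sublocale g: simple_lie_algebra g "bracket V"
  using levi by (simp add: levi_factor_def)

lemma module_M: "simple_lie_module g (bracket V) S.M (bracket V)"
  using levi by (simp add: levi_factor_def partial_image)

sublocale N: lie_module g "bracket V" N "anchor V"
  using complement by (simp add: unit_complement_def)

lemma Vec_sum: "Vec V = g + S.M"
  using levi by (simp add: levi_factor_def partial_image)

lemma Vec_cases:
  assumes "v \<in> Vec V"
  obtains x m where "v = x + m" "x \<in> g" "m \<in> S.M"
proof -
  have "v \<in> g + S.M" using assms Vec_sum by simp
  then show ?thesis using that by (rule set_plus_elim)
qed

text \<open>\<open>levi_factor\<close> states only a sum. It is direct because the intersection is
  an ideal of \<open>g\<close>, and it is not \<open>g\<close>, since elements of
  \<open>Leib\<close> multiply to zero from the left and \<open>g\<close> is not abelian.\<close>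

lemma g_M: "x = 0" if x: "x \<in> g" "x \<in> S.M"
proof -
  have "leibniz_ideal (g \<inter> S.M) g (bracket V)"
    unfolding leibniz_ideal_def
  proof (intro conjI ballI)
    show "csubspace (g \<inter> S.M)"
      using g.subspace S.M_sub by (rule complex_vector.subspace_inter)
    fix y z assume yz: "y \<in> g" "z \<in> g \<inter> S.M"
    show "y \<bullet>\<^sub>0 z \<in> g \<inter> S.M" using yz g.br_mem S.M_right g_Vec by simp
    show "z \<bullet>\<^sub>0 y \<in> g \<inter> S.M"
      using yz S.M_left[of z y] g_Vec csub(3)[OF g.subspace] csub(3)[OF S.M_sub] by simp
  qed simp
  then have "g \<inter> S.M = {0} \<or> g \<inter> S.M = g" using g.ideals by blast
  moreover have "g \<inter> S.M \<noteq> g"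
  proof
    assume "g \<inter> S.M = g"
    then have "y \<bullet>\<^sub>0 z = 0" if "y \<in> g" "z \<in> g" for y z
      using S.M_left[of y z] g_Vec that by blast
    then show False using g.nonabelian by blast
  qed
  ultimately show ?thesis using x by blast
qed

lemma g_nontrivial: "g \<noteq> {0}"
proof
  assume "g = {0}"
  then have "x \<bullet>\<^sub>0 y = 0" if "x \<in> g" "y \<in> g" for x y
    using g.br_mem[OF that] by simp
  then show False using g.nonabelian by blast
qed

lemma Alg_sum: "Alg V = cspan {\<^bold>1} + N"
  and N_one: "cspan {\<^bold>1} \<inter> N = {0}"
  using complement unfolding unit_complement_def direct_sum_def by simp_all

lemma N_Alg:
  assumes "n \<in> N"
  shows "n \<in> Alg V"
  using set_plus_intro[OF complex_vector.span_zero assms, of "{\<^bold>1}"] unfolding Alg_sum by simp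

lemma Alg_cases:
  assumes "a \<in> Alg V"
  obtains c n where "a = c *\<^sub>C \<^bold>1 + n" "n \<in> N"
proof -
  have "a \<in> cspan {\<^bold>1} + N" using assms unfolding Alg_sum .
  then obtain z n where "a = z + n" "z \<in> cspan {\<^bold>1}" "n \<in> N" by (rule set_plus_elim)
  then show ?thesis using that by (auto simp: complex_vector.span_singleton)
qed

lemma anchor_add_M:
  assumes "x \<in> g" "m \<in> S.M" "a \<in> Alg V"
  shows "(x + m) \<rhd>\<^sub>0 a = x \<rhd>\<^sub>0 a"
  using linear_on_add[OF anchor_linear_left[OF assms(3)] g_Vec[OF assms(1)] S.M_mem[OF assms(2)]]
    anchor_M[OF assms(2,3)] by simp

lemma anchor_add_one:
  assumes "x \<in> g" "n \<in> N"
  shows "x \<rhd>\<^sub>0 (c *\<^sub>C \<^bold>1 + n) = x \<rhd>\<^sub>0 n"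
  using linear_on_add[OF anchor_linear[OF g_Vec[OF assms(1)]]
      complex_vector.subspace_scale[OF A.subspace A.unit_closed] N_Alg[OF assms(2)]]
    linear_on_scale[OF anchor_linear[OF g_Vec[OF assms(1)]] A.unit_closed]
    anchor_one[OF g_Vec[OF assms(1)]] by simp

lemma anchor_N: "\<lbrakk>x \<in> g; n \<in> N\<rbrakk> \<Longrightarrow> x \<rhd>\<^sub>0 n \<in> N"
  using linear_on_mem[OF bilinear_on_right[OF N.module_bilinear]] .

lemma partial_inj_N:
  assumes "n \<in> N" "k \<in> N" "\<partial> n = \<partial> k"
  shows "n = k"
proof -
  have "n - k \<in> N" using assms N.module_subspace by (simp add: csub)
  moreover have "\<partial> (n - k) = 0" using assms N_Alg by (simp add: partial_diff)
  ultimately have "n - k \<in> cspan {\<^bold>1} \<inter> N" using N_Alg partial_kernel by blast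
  then show ?thesis using N_one by simp
qed

text \<open>The identity and \<open>Leib\<close> contribute nothing to the action, so generators of
  \<open>X\<close> come from \<open>g\<close> acting on \<open>N\<close>. Conversely
  \<open>\<partial>\<close> already maps \<open>X\<close> onto \<open>Leib\<close> and is injective
  on \<open>N\<close>. All results on \<open>X\<close> thus become results on
  \<open>N\<close>.\<close>

lemma N_X: "N = X"
proof
  show "X \<subseteq> N"
    unfolding X_def
  proof (rule complex_vector.span_minimal[OF _ N.module_subspace], clarify)
    fix v a assume "v \<in> Vec V" "a \<in> Alg V"
    then obtain x m c n where *: "v = x + m" "x \<in> g" "m \<in> S.M" "a = c *\<^sub>C \<^bold>1 + n" "n \<in> N"
      using Vec_cases Alg_cases by metis
    then have "v \<rhd>\<^sub>0 a = x \<rhd>\<^sub>0 n"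
      using anchor_add_M[OF *(2,3) \<open>a \<in> Alg V\<close>] anchor_add_one[OF *(2,5)] by simp
    then show "v \<rhd>\<^sub>0 a \<in> N" using anchor_N * by simp
  qed
  then have XN: "x \<in> N" if "x \<in> X" for x using that by blast
  show "N \<subseteq> X"
  proof
    fix n assume n: "n \<in> N"
    obtain x where x: "x \<in> X" "\<partial> n = \<partial> x" using M_partial_X[OF partial_M[OF N_Alg[OF n]]] .
    then show "n \<in> X" using partial_inj_N[OF n XN[OF x(1)]] by simp
  qed
qed

lemma M_partial_N:
  assumes "m \<in> S.M"
  obtains n where "n \<in> N" "m = \<partial> n"
  using M_partial_X[OF assms] unfolding N_X by blast

lemma N_N: "\<lbrakk>n \<in> N; k \<in> N\<rbrakk> \<Longrightarrow> n \<star> k = 0"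
  using X_X unfolding N_X .

lemma partial_one: "\<partial> \<^bold>1 = 0"
proof -
  have "\<^bold>1 \<in> cspan {\<^bold>1}" by (rule complex_vector.span_base) simp
  then show ?thesis using partial_kernel by blast
qed

lemma \<chi>_one: "\<chi> \<^bold>1 = 1"
  by (rule \<chi>_eqI) (simp_all add: A.unit_closed A.unit_right X_mem scaleC_one)

lemma \<chi>_sum:
  assumes "n \<in> N"
  shows "\<chi> (c *\<^sub>C \<^bold>1 + n) = c"
  using linear_on_add[OF \<chi>_linear complex_vector.subspace_scale[OF A.subspace A.unit_closed] N_Alg[OF assms]]
    linear_on_scale[OF \<chi>_linear A.unit_closed] \<chi>_one \<chi>_X assms
  by (simp add: N_X scaleC_complex_def)

lemma one_N: "\<^bold>1 \<notin> N"
  using \<chi>_one \<chi>_X[of "\<^bold>1"] unfolding N_X by force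

text \<open>Apply \<open>\<chi>\<close>, which takes the value 1 at the identity, to
  \<open>form_pairing\<close>.\<close>

lemma form_\<psi>: "\<lbrakk>u \<in> g; v \<in> g\<rbrakk> \<Longrightarrow> form u v = \<psi> u v"
  using linear_on_scale[OF \<chi>_linear A.unit_closed, of "form u v"] \<chi>_one form_pairing[of u v]
  by (simp add: \<psi>_def scaleC_complex_def)

lemma local: "local_algebra (Alg V) (amult V) \<^bold>1"
proof (rule A.local_algebra_square_zero[OF N.module_subspace _ _ one_N N_N])
  show "N \<subseteq> Alg V" using N_Alg by blast
  show "\<exists>c. \<exists>n\<in>N. a = c *\<^sub>C \<^bold>1 + n" if "a \<in> Alg V" for a
    using Alg_cases[OF that] by metis
qed

lemma act_N: "\<lbrakk>n \<in> N; v \<in> Vec V\<rbrakk> \<Longrightarrow> n \<cdot> v = \<partial> (v \<rhd>\<^sub>0 n)"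
  using X_act_eq unfolding N_X .

text \<open>Both sides lie in \<open>N\<close>, where \<open>\<partial>\<close> is injective, and
  \<open>\<partial>\<close> carries the equation to the Clifford relation on
  \<open>Leib\<close>.\<close>

lemma clifford_N:
  assumes n: "n \<in> N" and u: "u \<in> g" and v: "v \<in> g"
  shows "u \<rhd>\<^sub>0 (v \<rhd>\<^sub>0 n) + v \<rhd>\<^sub>0 (u \<rhd>\<^sub>0 n) = form u v *\<^sub>C n"
proof (rule partial_inj_N)
  note un = anchor_N[OF u n] and vn = anchor_N[OF v n]
  show "u \<rhd>\<^sub>0 (v \<rhd>\<^sub>0 n) + v \<rhd>\<^sub>0 (u \<rhd>\<^sub>0 n) \<in> N"
    using anchor_N[OF u vn] anchor_N[OF v un] N.module_subspace by (simp add: csub)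
  show "form u v *\<^sub>C n \<in> N" using n N.module_subspace by (simp add: csub)
  have "\<partial> (u \<rhd>\<^sub>0 (v \<rhd>\<^sub>0 n) + v \<rhd>\<^sub>0 (u \<rhd>\<^sub>0 n)) =
      u \<bullet>\<^sub>0 (v \<bullet>\<^sub>0 \<partial> n) + v \<bullet>\<^sub>0 (u \<bullet>\<^sub>0 \<partial> n)"
    using g_Vec[OF u] g_Vec[OF v] N_Alg[OF n] N_Alg[OF un] N_Alg[OF vn]
    by (simp add: partial_add op_mem bracket_partial)
  also have "\<dots> = \<psi> u v *\<^sub>C \<partial> n"
    by (rule clifford_M[OF g_Vec[OF u] g_Vec[OF v] partial_M[OF N_Alg[OF n]]])
  also have "\<dots> = \<partial> (form u v *\<^sub>C n)"
    using form_\<psi>[OF u v] N_Alg[OF n] by (simp add: partial_scale)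
  finally show "\<partial> (u \<rhd>\<^sub>0 (v \<rhd>\<^sub>0 n) + v \<rhd>\<^sub>0 (u \<rhd>\<^sub>0 n)) = \<partial> (form u v *\<^sub>C n)" .
qed

text \<open>Relations known modulo \<open>Leib\<close> hold exactly in \<open>g\<close>, because
  both sides lie in \<open>g\<close> and \<open>g\<close> meets \<open>Leib\<close> only in
  0.\<close>

sublocale clifford: clifford_lie_algebra g "bracket V" form
proof
  show "bilinear_on g g UNIV form" by (fact form_bilinear)
  show "form x y = form y x" if "x \<in> g" "y \<in> g" for x y
    using S.form_sym[OF \<psi>_invariant] that g_Vec form_\<psi> by simp
  show "form (x \<bullet>\<^sub>0 y) z = form x (y \<bullet>\<^sub>0 z)" if xyz: "x \<in> g" "y \<in> g" "z \<in> g" for x y z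
  proof -
    have xyV: "x \<in> Vec V" "y \<in> Vec V" "z \<in> Vec V" using xyz g_Vec by auto
    have "x \<bullet>\<^sub>0 y + y \<bullet>\<^sub>0 x = 0"
      using S.sym_mem[OF xyV(1,2)] xyz g.br_mem g.subspace by (intro g_M) (auto simp: csub)
    then have "x \<bullet>\<^sub>0 y = - (y \<bullet>\<^sub>0 x)" by (simp add: eq_neg_iff_add_eq_0)
    then have "\<psi> (x \<bullet>\<^sub>0 y) z = - \<psi> (y \<bullet>\<^sub>0 x) z"
      using linear_on_neg[OF S.form_left[OF \<psi>_invariant xyV(3)]] xyV B.br_mem by simp
    also have "\<dots> = \<psi> x (y \<bullet>\<^sub>0 z)"
      using S.form_inv[OF \<psi>_invariant xyV(1,3,2)] by simp
    finally show ?thesis using form_\<psi> xyz g.br_mem by simp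
  qed
  show "x = 0" if x: "x \<in> g" and zero: "\<And>y. y \<in> g \<Longrightarrow> form x y = 0" for x
  proof (rule g_M[OF x S.form_radical[OF \<psi>_invariant]])
    show "\<exists>x\<in>Vec V. \<exists>y\<in>Vec V. \<psi> x y \<noteq> 0" using \<psi>_clifford by (simp add: S.clifford_form_def)
    show "x \<in> Vec V" using x g_Vec by blast
    show "\<psi> x y = 0" if "y \<in> Vec V" for y
    proof -
      obtain z m where zm: "y = z + m" "z \<in> g" "m \<in> S.M" using Vec_cases[OF \<open>y \<in> Vec V\<close>] .
      then have "\<psi> x y = \<psi> x z + \<psi> x m"
        using linear_on_add[OF S.form_right[OF \<psi>_invariant g_Vec[OF x]]] g_Vec S.M_mem by simp
      then show ?thesis
        using zero[OF zm(2)] form_\<psi>[OF x zm(2)] S.form_M'[OF \<psi>_invariant zm(3) g_Vec[OF x]] by simp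
    qed
  qed
  show "(w \<bullet>\<^sub>0 u) \<bullet>\<^sub>0 v = (2 * form u v) *\<^sub>C w - (2 * form w v) *\<^sub>C u"
    if "u \<in> g" "v \<in> g" "w \<in> g" for u v w
  proof -
    have "(w \<bullet>\<^sub>0 u) \<bullet>\<^sub>0 v - ((2 * \<psi> u v) *\<^sub>C w - (2 * \<psi> w v) *\<^sub>C u) = 0"
      using S.double_bracket[OF \<psi>_clifford] that g_Vec
      by (intro g_M) (auto intro!: g.L_closed)
    then show ?thesis using form_\<psi> that by simp
  qed
  show "g \<noteq> {0}" by (fact g_nontrivial)
qed

section \<open>Coordinates and the isomorphism with B_lambda\<close>

definition alg_coord :: "'a \<Rightarrow> complex \<times> 'a" where
  "alg_coord a = (\<chi> a, a - \<chi> a *\<^sub>C \<^bold>1)"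

text \<open>The projection to \<open>g\<close> along \<open>Leib\<close>; the choice is unique by
  \<open>g_M\<close>.\<close>

definition g_part :: "'b \<Rightarrow> 'b" where
  "g_part v = (SOME x. x \<in> g \<and> v - x \<in> S.M)"

definition vec_coord :: "'b \<Rightarrow> 'b \<times> 'b" where
  "vec_coord v = (g_part v, v - g_part v)"

text \<open>\<open>\<chi>\<close> reads off the coefficient of the identity, since it is 1 there and
  vanishes on \<open>N\<close>.\<close>

lemma alg_coord: "n \<in> N \<Longrightarrow> alg_coord (c *\<^sub>C \<^bold>1 + n) = (c, n)"
  by (simp add: alg_coord_def \<chi>_sum)

lemma alg_coord_N: "n \<in> N \<Longrightarrow> alg_coord n = (0, n)"
  using alg_coord[of n 0] by simp

lemma vec_coord:
  assumes "x \<in> g" "m \<in> S.M"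
  shows "vec_coord (x + m) = (x, m)"
proof -
  have "g_part (x + m) \<in> g \<and> (x + m) - g_part (x + m) \<in> S.M"
    unfolding g_part_def by (rule someI[of _ x]) (use assms in simp)
  then have y: "g_part (x + m) \<in> g" "(x + m) - g_part (x + m) \<in> S.M" by auto
  have "((x + m) - g_part (x + m)) - m \<in> S.M"
    by (rule complex_vector.subspace_diff[OF S.M_sub y(2) assms(2)])
  then have "x - g_part (x + m) \<in> S.M" by (simp add: algebra_simps)
  moreover have "x - g_part (x + m) \<in> g"
    using complex_vector.subspace_diff[OF g.subspace assms(1) y(1)] .
  ultimately have "g_part (x + m) = x" using g_M by fastforce
  then show ?thesis by (simp add: vec_coord_def)
qed

lemma vec_coord_M: "m \<in> S.M \<Longrightarrow> vec_coord m = (0, m)"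
  using vec_coord[of 0 m] csub(3)[OF g.subspace] by simp

text \<open>The modules inside \<open>V\<close> themselves serve as the data of
  \<open>B_lambda\<close>, so the isomorphism is just the decomposition of elements into their two
  components.\<close>

abbreviation "W \<equiv> B_lambda g (bracket V) form N (anchor V) S.M (bracket V) (partial V)"

lemma partial_iso: "lie_module_iso g N (anchor V) S.M (bracket V) (partial V)"
  unfolding lie_module_iso_def
proof (intro conjI ballI)
  show "linear_on N S.M (partial V)"
    using N_Alg partial_M by (intro linear_onI) (auto simp: partial_add partial_scale)
  show "bij_betw (partial V) N S.M"
    unfolding bij_betw_def
    using partial_X partial_inj_N by (auto simp: inj_on_def N_X)
  show "\<partial> (x \<rhd>\<^sub>0 n) = x \<bullet>\<^sub>0 \<partial> n" if "x \<in> g" "n \<in> N" for x n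
    using bracket_partial g_Vec N_Alg that by simp
qed

lemma inv_partial: "n \<in> N \<Longrightarrow> inv_into N (partial V) (\<partial> n) = n"
  using partial_iso by (auto simp: lie_module_iso_def bij_betw_def inv_into_f_f)

text \<open>After splitting both arguments, the terms absent from \<open>B_lambda\<close> vanish:
  products within \<open>N\<close>, brackets with \<open>Leib\<close> on the left, and pairings
  within \<open>Leib\<close>. What remains is read off from \<open>form_pairing\<close>,
  \<open>pairing_partial\<close> and \<open>act_N\<close>.\<close>

lemma coord_hom: "algebroid_hom V W alg_coord vec_coord"
  unfolding algebroid_hom_def
proof (intro conjI ballI)
  have Ns: "csubspace N" by (fact N.module_subspace)
  show "linear_on (Alg V) (Alg W) alg_coord"
  proof (rule linear_onI)
    fix a assume "a \<in> Alg V"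
    then obtain c n where "a = c *\<^sub>C \<^bold>1 + n" "n \<in> N" by (rule Alg_cases)
    then show "alg_coord a \<in> Alg W" by (simp add: alg_coord B_lambda_def)
  next
    fix a b assume "a \<in> Alg V" "b \<in> Alg V"
    then show "alg_coord (a + b) = alg_coord a + alg_coord b"
      by (simp add: alg_coord_def linear_on_add[OF \<chi>_linear] scaleC_add_left algebra_simps)
  next
    fix k a assume "a \<in> Alg V"
    then show "alg_coord (k *\<^sub>C a) = k *\<^sub>C alg_coord a"
      by (simp add: alg_coord_def linear_on_scale[OF \<chi>_linear] scaleC_prod_def scaleC_complex_def
          complex_vector.scale_right_diff_distrib scaleC_scaleC)
  qed
  show "linear_on (Vec V) (Vec W) vec_coord"
  proof (rule linear_onI)
    fix v assume "v \<in> Vec V"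
    then obtain x m where "v = x + m" "x \<in> g" "m \<in> S.M" by (rule Vec_cases)
    then show "vec_coord v \<in> Vec W" by (simp add: vec_coord B_lambda_def)
  next
    fix u v assume uv: "u \<in> Vec V" "v \<in> Vec V"
    obtain x m where u: "u = x + m" "x \<in> g" "m \<in> S.M" using Vec_cases[OF uv(1)] .
    obtain y l where v: "v = y + l" "y \<in> g" "l \<in> S.M" using Vec_cases[OF uv(2)] .
    have "u + v = (x + y) + (m + l)" using u v by simp
    then have "vec_coord (u + v) = (x + y, m + l)"
      using vec_coord[OF complex_vector.subspace_add[OF g.subspace u(2) v(2)]
          complex_vector.subspace_add[OF S.M_sub u(3) v(3)]] by simp
    then show "vec_coord (u + v) = vec_coord u + vec_coord v" using u v by (simp add: vec_coord)
  next
    fix k v assume "v \<in> Vec V"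
    then obtain x m where v: "v = x + m" "x \<in> g" "m \<in> S.M" by (rule Vec_cases)
    then have "k *\<^sub>C v = k *\<^sub>C x + k *\<^sub>C m" by (simp add: scaleC_add_right)
    then have "vec_coord (k *\<^sub>C v) = (k *\<^sub>C x, k *\<^sub>C m)"
      using vec_coord[OF complex_vector.subspace_scale[OF g.subspace v(2)]
          complex_vector.subspace_scale[OF S.M_sub v(3)]] by simp
    then show "vec_coord (k *\<^sub>C v) = k *\<^sub>C vec_coord v" using v by (simp add: vec_coord scaleC_prod_def)
  qed
  show "alg_coord \<^bold>1 = \<^bold>1\<^bsub>W\<^esub>"
    using alg_coord[of 0 1] csub(3)[OF Ns] by (simp add: B_lambda_def scaleC_one)
next
  fix a b assume ab: "a \<in> Alg V" "b \<in> Alg V"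
  obtain c n where a: "a = c *\<^sub>C \<^bold>1 + n" "n \<in> N" using Alg_cases[OF ab(1)] .
  obtain d k where b: "b = d *\<^sub>C \<^bold>1 + k" "k \<in> N" using Alg_cases[OF ab(2)] .
  have "a \<star> b = (c * d) *\<^sub>C \<^bold>1 + (c *\<^sub>C k + d *\<^sub>C n)"
    using a b N_Alg N_N A.unit_closed
    by (simp add: A.mul_simps A.A_closed A.unit_left A.unit_right scaleC_scaleC scaleC_add_right mult.commute)
  moreover have "c *\<^sub>C k + d *\<^sub>C n \<in> N" using a b N.module_subspace by (simp add: csub)
  ultimately have "alg_coord (a \<star> b) = (c * d, c *\<^sub>C k + d *\<^sub>C n)" by (simp add: alg_coord)
  then show "alg_coord (a \<star> b) = alg_coord a \<star>\<^bsub>W\<^esub> alg_coord b"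
    using a b by (simp add: alg_coord B_lambda_def)
next
  fix u v assume uv: "u \<in> Vec V" "v \<in> Vec V"
  obtain x m where u: "u = x + m" "x \<in> g" "m \<in> S.M" using Vec_cases[OF uv(1)] .
  obtain y l where v: "v = y + l" "y \<in> g" "l \<in> S.M" using Vec_cases[OF uv(2)] .
  note V = g_Vec[OF u(2)] S.M_mem[OF u(3)] g_Vec[OF v(2)] S.M_mem[OF v(3)]
  have "u \<bullet>\<^sub>0 v = x \<bullet>\<^sub>0 y + x \<bullet>\<^sub>0 l"
    using u(1) v(1) V S.M_left[OF u(3)] by (simp add: B.br_simps B.L_closed)
  then have "vec_coord (u \<bullet>\<^sub>0 v) = (x \<bullet>\<^sub>0 y, x \<bullet>\<^sub>0 l)"
    using vec_coord[OF g.br_mem[OF u(2) v(2)] S.M_right[OF V(1) v(3)]] by simp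
  then show "vec_coord (u \<bullet>\<^sub>0 v) = vec_coord u \<bullet>\<^sub>0\<^bsub>W\<^esub> vec_coord v"
    using u v by (simp add: vec_coord B_lambda_def)
  obtain p where p: "p \<in> N" "m = \<partial> p" using M_partial_N[OF u(3)] .
  obtain q where q: "q \<in> N" "l = \<partial> q" using M_partial_N[OF v(3)] .
  note pq = N_Alg[OF p(1)] N_Alg[OF q(1)]
  have xq: "x \<rhd>\<^sub>0 q + y \<rhd>\<^sub>0 p \<in> N"
    using anchor_N u v p q N.module_subspace by (simp add: csub)
  have "u \<bullet>\<^sub>1 v = (x \<bullet>\<^sub>1 y + x \<bullet>\<^sub>1 l) + (m \<bullet>\<^sub>1 y + m \<bullet>\<^sub>1 l)"
    unfolding u(1) v(1)
    using V linear_on_add[OF pairing_linear_left[of "y + l"], of x m]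
      linear_on_add[OF pairing_linear[of x]] linear_on_add[OF pairing_linear[of m]]
    by (simp add: B.L_closed)
  also have "x \<bullet>\<^sub>1 y = form x y *\<^sub>C \<^bold>1" using form_pairing[OF u(2) v(2)] by simp
  also have "x \<bullet>\<^sub>1 l = x \<rhd>\<^sub>0 q" using pairing_partial[OF V(1) pq(2)] q(2) by simp
  also have "m \<bullet>\<^sub>1 y = y \<rhd>\<^sub>0 p"
    using pairing_partial[OF V(3) pq(1)] p(2) pairing_sym[OF V(2,3)] by simp
  also have "m \<bullet>\<^sub>1 l = 0"
    using pairing_partial[OF V(2) pq(2)] q(2) anchor_M[OF u(3) pq(2)] by simp
  finally have "u \<bullet>\<^sub>1 v = form x y *\<^sub>C \<^bold>1 + (x \<rhd>\<^sub>0 q + y \<rhd>\<^sub>0 p)" by simp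
  then have "alg_coord (u \<bullet>\<^sub>1 v) = (form x y, x \<rhd>\<^sub>0 q + y \<rhd>\<^sub>0 p)"
    using alg_coord[OF xq] by simp
  moreover have "vec_coord u \<bullet>\<^sub>1\<^bsub>W\<^esub> vec_coord v = (form x y, x \<rhd>\<^sub>0 q + y \<rhd>\<^sub>0 p)"
    using vec_coord[OF u(2,3)] vec_coord[OF v(2,3)] u(1) v(1) inv_partial p q
    by (simp add: B_lambda_def)
  ultimately show "vec_coord u \<bullet>\<^sub>1\<^bsub>W\<^esub> vec_coord v = alg_coord (u \<bullet>\<^sub>1 v)" by simp
next
  fix a v assume a': "a \<in> Alg V" and v': "v \<in> Vec V"
  obtain c n where a: "a = c *\<^sub>C \<^bold>1 + n" "n \<in> N" using Alg_cases[OF a'] .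
  obtain x m where v: "v = x + m" "x \<in> g" "m \<in> S.M" using Vec_cases[OF v'] .
  have vn: "v \<rhd>\<^sub>0 n = x \<rhd>\<^sub>0 n" using anchor_add_M[OF v(2,3) N_Alg[OF a(2)]] v(1) by simp
  have "a \<cdot> v = c *\<^sub>C v + n \<cdot> v"
    unfolding a(1)
    using linear_on_add[OF act_linear_left[OF v'] _ N_Alg[OF a(2)], of "c *\<^sub>C \<^bold>1"]
      linear_on_scale[OF act_linear_left[OF v'] A.unit_closed] act_one[OF v'] A.unit_closed
    by (simp add: A.A_closed)
  then have "a \<cdot> v = c *\<^sub>C x + (c *\<^sub>C m + \<partial> (x \<rhd>\<^sub>0 n))"
    using act_N[OF a(2) v'] vn v(1) by (simp add: scaleC_add_right add.assoc)
  moreover have "c *\<^sub>C m + \<partial> (x \<rhd>\<^sub>0 n) \<in> S.M"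
    using v(3) partial_M N_Alg[OF anchor_N[OF v(2) a(2)]] S.M_sub by (simp add: csub)
  ultimately have "vec_coord (a \<cdot> v) = (c *\<^sub>C x, c *\<^sub>C m + \<partial> (x \<rhd>\<^sub>0 n))"
    using vec_coord[OF complex_vector.subspace_scale[OF g.subspace v(2)]] by simp
  then show "vec_coord (a \<cdot> v) = alg_coord a \<cdot>\<^bsub>W\<^esub> vec_coord v"
    using a v by (simp add: vec_coord alg_coord B_lambda_def)
  have "alg_coord (v \<rhd>\<^sub>0 a) = (0, x \<rhd>\<^sub>0 n)"
    using alg_coord_N[OF anchor_N[OF v(2) a(2)]] anchor_add_M[OF v(2,3) a'] v(1)
      anchor_add_one[OF v(2) a(2)] a(1) by simp
  then show "alg_coord (v \<rhd>\<^sub>0 a) = vec_coord v \<rhd>\<^sub>0\<^bsub>W\<^esub> alg_coord a"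
    using a v by (simp add: vec_coord alg_coord B_lambda_def)
next
  fix a assume a': "a \<in> Alg V"
  obtain c n where a: "a = c *\<^sub>C \<^bold>1 + n" "n \<in> N" using Alg_cases[OF a'] .
  have "\<partial> a = \<partial> n"
    unfolding a(1) using N_Alg[OF a(2)] A.unit_closed
    by (simp add: partial_add partial_scale partial_one A.A_closed)
  then have "vec_coord (\<partial> a) = (0, \<partial> n)" using vec_coord_M[OF partial_M[OF N_Alg[OF a(2)]]] by simp
  then show "vec_coord (\<partial> a) = \<partial>\<^bsub>W\<^esub> (alg_coord a)"
    using a by (simp add: alg_coord B_lambda_def)
qed

lemma isomorphic: "algebroid_isomorphic V W"
proof -
  have f: "bij_betw alg_coord (Alg V) (Alg W)"
    unfolding bij_betw_def
  proof (intro conjI equalityI subsetI)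
    show "inj_on alg_coord (Alg V)" by (rule inj_onI) (auto simp: alg_coord_def)
    show "p \<in> Alg W" if "p \<in> alg_coord ` Alg V" for p
      using that coord_hom by (auto simp: algebroid_hom_def linear_on_def)
    fix p assume "p \<in> Alg W"
    then obtain c n where p: "p = (c, n)" "n \<in> N" by (auto simp: B_lambda_def)
    then have "p = alg_coord (c *\<^sub>C \<^bold>1 + n)" "c *\<^sub>C \<^bold>1 + n \<in> Alg V"
      using N_Alg A.unit_closed by (simp_all add: alg_coord A.A_closed)
    then show "p \<in> alg_coord ` Alg V" by blast
  qed
  have h: "bij_betw vec_coord (Vec V) (Vec W)"
    unfolding bij_betw_def
  proof (intro conjI equalityI subsetI)
    show "inj_on vec_coord (Vec V)" by (rule inj_onI) (auto simp: vec_coord_def)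
    show "p \<in> Vec W" if "p \<in> vec_coord ` Vec V" for p
      using that coord_hom by (auto simp: algebroid_hom_def linear_on_def)
    fix p assume "p \<in> Vec W"
    then obtain x m where p: "p = (x, m)" "x \<in> g" "m \<in> S.M" by (auto simp: B_lambda_def)
    then have "p = vec_coord (x + m)" "x + m \<in> Vec V"
      using g_Vec S.M_mem by (simp_all add: vec_coord B.L_closed)
    then show "p \<in> vec_coord ` Vec V" by blast
  qed
  show ?thesis
    unfolding algebroid_isomorphic_def
    using vertex_algebroid_axioms transport[OF coord_hom f h] coord_hom f h by blast
qed

lemma classification:
  assumes "cartan_subalgebra g (bracket V) h" "root_base g (bracket V) h \<Delta>"
  shows "\<exists>\<mu> (L :: 'b set) actL (N' :: 'a set) actN d.
    dominant_integral h \<Delta> form \<mu> \<and>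
    irreducible_highest_weight_module g (bracket V) h \<Delta> L actL \<mu> \<and>
    lie_module g (bracket V) N' actN \<and>
    lie_module_iso g N' actN L actL d \<and>
    algebroid_isomorphic V (B_lambda g (bracket V) form N' actN L actL d)"
proof -
  obtain t where t: "t \<in> g" "form t t \<noteq> 0" "h = {c *\<^sub>C t |c. True}"
    using clifford.cartan_line[OF assms(1)] .
  have fdM: "finite_dim S.M" using finite_dim_subset[OF fin_dim_Vec S.M_sub S.M_L] .
  have "\<exists>\<mu>. dominant_integral h \<Delta> form \<mu> \<and>
      irreducible_highest_weight_module g (bracket V) h \<Delta> S.M (bracket V) \<mu>"
    by (rule clifford.highest_weight_module[OF t assms(2) module_M fdM])
      (simp add: clifford_M g_Vec form_\<psi>)
  then show ?thesis using N.lie_module_axioms partial_iso isomorphic by blast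
qed

end

theorem theorem17:
  fixes V :: "('a::complex_vector, 'b::complex_vector) algebroid" (structure)
  assumes "vertex_algebroid V"
    and "finite_dim (Alg V)"
    and "finite_dim (Vec V)"
    and "simple_leibniz_algebra (Vec V) (bracket V)"
    and "\<not> lie_algebra (Vec V) (bracket V)"
  shows
    "(\<exists>g. levi_factor V g \<and> (\<exists>N. unit_complement V g N)) \<and>
     (\<forall>g N (form :: 'b \<Rightarrow> 'b \<Rightarrow> complex).
        levi_factor V g \<longrightarrow>
        unit_complement V g N \<longrightarrow>
        bilinear_on g g UNIV form \<longrightarrow>
        (\<forall>b\<in>g. \<forall>b'\<in>g. form b b' *\<^sub>C \<^bold>1 = b \<bullet>\<^sub>1 b') \<longrightarrow>
        (\<exists>u\<in>g. \<exists>v\<in>g. u \<bullet>\<^sub>1 v \<noteq> 0) \<longrightarrow>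
        {a \<in> Alg V. \<partial> a = 0} = cspan {\<^bold>1} \<longrightarrow>
        cspan {n \<cdot> b |n b. n \<in> N \<and> b \<in> Vec V} \<subseteq> partial V ` Alg V \<longrightarrow>
        normalized_killing_form g (bracket V) form \<and>
        local_algebra (Alg V) (amult V) \<^bold>1 \<and>
        (\<forall>a\<in>N. \<forall>a'\<in>N. a \<star> a' = 0) \<and>
        (\<forall>a\<in>N. \<forall>u\<in>g. \<forall>v\<in>g. \<forall>a'\<in>Alg V.
           a \<cdot> (u + \<partial> a') = \<partial> (u \<rhd>\<^sub>0 a) \<and>
           u \<rhd>\<^sub>0 (v \<rhd>\<^sub>0 a) + v \<rhd>\<^sub>0 (u \<rhd>\<^sub>0 a) = (u \<bullet>\<^sub>1 v) \<star> a) \<and>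
        (\<forall>h \<Delta>. cartan_subalgebra g (bracket V) h \<longrightarrow> root_base g (bracket V) h \<Delta> \<longrightarrow>
           (\<exists>\<mu> (L :: 'b set) actL (N' :: 'a set) actN d.
              dominant_integral h \<Delta> form \<mu> \<and>
              irreducible_highest_weight_module g (bracket V) h \<Delta> L actL \<mu> \<and>
              lie_module g (bracket V) N' actN \<and>
              lie_module_iso g N' actN L actL d \<and>
              algebroid_isomorphic V (B_lambda g (bracket V) form N' actN L actL d))))"
proof -
  interpret simple_vertex_algebroid V
    by (intro simple_vertex_algebroid.intro simple_vertex_algebroid_axioms.intro assms)
  show ?thesis
  proof (intro conjI allI impI)
    obtain g where "levi_factor V g" using levi_factor_ex .
    then show "\<exists>g. levi_factor V g \<and> (\<exists>N. unit_complement V g N)"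
      using unit_complement_ex by blast
  next
    fix g N and form :: "'b \<Rightarrow> 'b \<Rightarrow> complex"
    assume levi: "levi_factor V g" and "unit_complement V g N" and "bilinear_on g g UNIV form"
      and "\<forall>b\<in>g. \<forall>b'\<in>g. form b b' *\<^sub>C \<^bold>1 = b \<bullet>\<^sub>1 b'"
      and "{a \<in> Alg V. \<partial> a = 0} = cspan {\<^bold>1}"
    then interpret split_vertex_algebroid V g N form
      by unfold_locales auto
    show "normalized_killing_form g (bracket V) form" by (fact clifford.normalized)
    show "local_algebra (Alg V) (amult V) \<^bold>1" by (fact local)
    show "\<forall>a\<in>N. \<forall>a'\<in>N. a \<star> a' = 0" using N_N by blast
    show "\<forall>a\<in>N. \<forall>u\<in>g. \<forall>v\<in>g. \<forall>a'\<in>Alg V.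
        a \<cdot> (u + \<partial> a') = \<partial> (u \<rhd>\<^sub>0 a) \<and>
        u \<rhd>\<^sub>0 (v \<rhd>\<^sub>0 a) + v \<rhd>\<^sub>0 (u \<rhd>\<^sub>0 a) = (u \<bullet>\<^sub>1 v) \<star> a"
    proof (intro ballI conjI)
      fix a u v a' assume a: "a \<in> N" and u: "u \<in> g" and v: "v \<in> g" and a': "a' \<in> Alg V"
      show "a \<cdot> (u + \<partial> a') = \<partial> (u \<rhd>\<^sub>0 a)"
        using act_N[OF a B.L_closed(2)[OF g_Vec[OF u] op_mem(4)[OF a']]]
          anchor_add_M[OF u partial_M[OF a'] N_Alg[OF a]] by simp
      show "u \<rhd>\<^sub>0 (v \<rhd>\<^sub>0 a) + v \<rhd>\<^sub>0 (u \<rhd>\<^sub>0 a) = (u \<bullet>\<^sub>1 v) \<star> a"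
        using clifford_N[OF a u v] form_pairing[OF u v, symmetric] N_Alg[OF a] A.unit_closed
        by (simp add: A.mul_simps A.unit_left)
    qed
    show "\<exists>\<mu> (L :: 'b set) actL (N' :: 'a set) actN d.
        dominant_integral h \<Delta> form \<mu> \<and>
        irreducible_highest_weight_module g (bracket V) h \<Delta> L actL \<mu> \<and>
        lie_module g (bracket V) N' actN \<and>
        lie_module_iso g N' actN L actL d \<and>
        algebroid_isomorphic V (B_lambda g (bracket V) form N' actN L actL d)"
      if "cartan_subalgebra g (bracket V) h" "root_base g (bracket V) h \<Delta>" for h \<Delta>
      using classification[OF that] .
  qed
qed

end
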